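(* For each integer $n \geq 2$, let $V' \subset \mathbf{P}^{n+1}(a_0',\ldots,a_{n+1}')$ be the weighted projective hypersurface of dimension $n$, of degree $D'$, defined in the context, together with the integers $u'_n$ and $m'_n$ defined there. Then $V'$ is well-formed, quasi-smooth, and Calabi--Yau (in the sense that $D'=\sum_j a'_j$). The degree $D'$ of $V'$ is given by $D' = u'_{2r+1}$ if $n = 2r+1$ is odd, and $D' = 2u'_{2r}$ if $n = 2r$ is even. The last two weights $a_n'$ and $a_{n+1}'$ of $V'$ equal $1$. There is an action on $V'$ by the cyclic group of order $m' = m'_n$, which is free in codimension $1$.
   Context: Sylvester's sequence: $s_0=2$, $s_{j+1}=s_j(s_j-1)+1$. Alternating sums: given integers $b_i$, write $$B_{i_1\cdots i_k} := b_{i_1}\cdots b_{i_k}-b_{i_1}\cdots b_{i_{k-1}}+\cdots+(-1)^{k-1}b_{i_1}+(-1)^k,$$ with $B=1$ for the empty subscript. Empty products are $1$. Let $n=2r+1$ or $n=2r$ with $r\ge 1$. For $0\le i\le r$ let $b_i:=s_i$. For $1\le i\le r$ define inductively $$b_{r+i} := 1+(b_{r+1-i}-1)^2B_{r+1,r,r+2,r-1,\ldots,r-1+i,r+2-i},$$ where the subscript list is the concatenation of the pairs $(r+j,\,r+1-j)$ for $j=1,\ldots,i-1$ (empty for $i=1$). Subscript lists below: "$r+1,r,\ldots,2r,1$" is the concatenation of the pairs $(r+j,r+1-j)$ for $j=1,\ldots,r$; "$r+1,r,\ldots,2r-1,2$" is the same for $j=1,\ldots,r-1$ (empty if $r=1$);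 "$1,2r,\ldots,r,r+1$" is the concatenation of the pairs $(j,2r+1-j)$ for $j=1,\ldots,r$; "$2,2r-1,\ldots,r,r+1$" is the same for $j=2,\ldots,r$ (empty if $r=1$). In an alternating sum of $B$'s, each successive term drops the first remaining index, ending with $B$ of the empty list, $1$. Define $$b'_{2r+1} := \tfrac{1}{2}\left(1 + b_1 \cdots b_{2r} + (s_1-1)B_{r+1,r,\ldots,2r,1}\right),$$ $$b'_{2r} := \tfrac{1}{3}\left(1 + 2(s_1-1)^2 b_2 \cdots b_{2r-1} + 2(s_2-1)B_{r+1,r,\ldots,2r-1,2}\right),$$ (which are integers) and $$v'_{2r+1} := B_{1,2r,\ldots,r,r+1} + (s_1-1)[B_{r+1,r,\ldots,2r,1} - B_{r,\ldots,2r,1} + \cdots - B_1 + 1]-1,$$ $$v'_{2r} := (s_1-1)^2 B_{2,2r-1,\ldots,r,r+1} + (s_2-1)[B_{r+1,r,\ldots,2r-1,2} - B_{r,\ldots,2r-1,2} + \cdots - B_2 + 1] - 1.$$ The hypersurface $V'$: for $n=2r+1$, the polynomial defining $V'$ is the sum of the monomials $x_i^{b_i}x_{2r+2-i}$ ($0\le i\le r$), $x_{r+j}^{b_{r+j}}x_{r+1-j}$ ($1\le j\le r$), $x_{2r+1}^{b'_{2r+1}}x_0$, and $x_{2r+2}^{v'_{2r+1}}x_{r+1}$. For $n=2r$, it is the sum of $x_0^{b_0}$, $x_i^{b_i}x_{2r+2-i}$ ($1\le i\le r$), $x_{r+j}^{b_{r+j}}x_{r+1-j}$ ($1\le j\le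 r-1$), $x_{2r}^{b'_{2r}}x_1$, and $x_{2r+1}^{v'_{2r}}x_{r+1}$. The weights $a'_0,\ldots,a'_{n+1}$ (positive integers) and degree $D'$ are uniquely determined by requiring the polynomial to be weighted-homogeneous and $\gcd(a'_0,\ldots,a'_{n+1})=1$. The integers: $$u'_{2r+1} := b_1 \cdots b_{2r} + (s_1-1)B_{r+1,r,\ldots,2r,1},\qquad u'_{2r} :=(s_1-1)b_2 \cdots b_{2r-1} + s_1 B_{r+1,r,\ldots,2r-1,2},$$ $$m'_{2r+1} := b_0b'_{2r+1}B_{1,2r,\ldots,r,r+1} - b_0 + 1,\qquad m'_{2r} := b_1 b'_{2r} B_{2,2r-1,\ldots,r,r+1} - b_1 + 1.$$ Weighted projective space $Y=\mathbf{P}^N(a_0,\ldots,a_N)=(A^{N+1}-0)/G_m$ over $\mathbf{C}$ is well-formed if $\gcd(a_0,\ldots,\widehat{a_j},\ldots,a_N)=1$ for each $j$. A closed subvariety $X\subset Y$ is well-formed if $Y$ is well-formed and $X\cap Y^{\mathrm{sing}}$ has codimension at least $2$ in $X$; it is quasi-smooth if its affine cone in $A^{N+1}$ is smooth outside the origin. A group action is free in codimension $1$ if it is free outside a closed subset of codimension at least $2$. *)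

theory Defs
  imports
    "HOL-Analysis.Analysis"
    "HOL-Library.Poly_Mapping"
    "HOL-Library.Extended_Nat"
    "HOL-Algebra.Elementary_Groups"
    "HOL-Algebra.Group_Action"
begin

section \<open>Polynomials\<close>

text \<open>Polynomials over the complex numbers in the variables \<open>x\<^sub>0, x\<^sub>1, \<dots>\<close>:
  finitely supported maps from exponent vectors to coefficients.\<close>

type_synonym cpoly = "(nat \<Rightarrow>\<^sub>0 nat) \<Rightarrow>\<^sub>0 complex"

definition peval :: "cpoly \<Rightarrow> (nat \<Rightarrow> complex) \<Rightarrow> complex" where
  "peval p x = (\<Sum>m\<in>Poly_Mapping.keys p.
     Poly_Mapping.lookup p m * (\<Prod>i\<in>Poly_Mapping.keys m. x i ^ Poly_Mapping.lookup m i))"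

definition xpow :: "nat \<Rightarrow> nat \<Rightarrow> cpoly" where
  "xpow i e = Poly_Mapping.single (Poly_Mapping.single i e) 1"

text \<open>The polynomial \<open>p\<close> lies in \<open>\<complex>[x\<^sub>0, \<dots>, x\<^sub>N]\<close> and is homogeneous of degree \<open>d\<close> when
  \<open>x\<^sub>i\<close> has weight \<open>a i\<close>; the zero polynomial is homogeneous of every degree.\<close>

definition whomogeneous :: "(nat \<Rightarrow> nat) \<Rightarrow> nat \<Rightarrow> nat \<Rightarrow> cpoly \<Rightarrow> bool" where
  "whomogeneous a N d p \<longleftrightarrow> (\<forall>m\<in>Poly_Mapping.keys p.
     Poly_Mapping.keys m \<subseteq> {..N} \<and>
     (\<Sum>i\<in>Poly_Mapping.keys m. a i * Poly_Mapping.lookup m i) = d)"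

section \<open>Irreducible closed sets and codimension\<close>

definition irreducible_closedin :: "'a topology \<Rightarrow> 'a set \<Rightarrow> bool" where
  "irreducible_closedin T W \<longleftrightarrow> closedin T W \<and> W \<noteq> {} \<and>
     (\<forall>A B. closedin T A \<and> closedin T B \<and> W \<subseteq> A \<union> B \<longrightarrow> W \<subseteq> A \<or> W \<subseteq> B)"

definition codim_irreducible :: "'a topology \<Rightarrow> 'a set \<Rightarrow> enat" where
  "codim_irreducible T W = Sup {enat k | k. \<exists>C :: nat \<Rightarrow> 'a set. C 0 = W \<and>
     (\<forall>i\<le>k. irreducible_closedin T (C i)) \<and> (\<forall>i<k. C i \<subset> C (Suc i))}"

text \<open>For a closed set \<open>Z\<close>, the infimum over the irreducible closed subsets of \<open>Z\<close>;
  the empty set has codimension \<open>\<infinity>\<close>.\<close>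

definition codim :: "'a topology \<Rightarrow> 'a set \<Rightarrow> enat" where
  "codim T Z = (INF W\<in>{W. irreducible_closedin T W \<and> W \<subseteq> Z}. codim_irreducible T W)"

section \<open>Weighted projective space\<close>

text \<open>Points of \<open>A\<^bsup>N+1\<^esup>\<close> are functions vanishing at all indices above \<open>N\<close>, and a
  point of \<open>\<^bold>P\<^bsup>N\<^esup>(a\<^sub>0, \<dots>, a\<^sub>N)\<close> is an orbit of \<open>G\<^sub>m\<close> on \<open>A\<^bsup>N+1\<^esup> - 0\<close>, as a set of
  representatives.  Varieties are given by their closed points.\<close>

type_synonym wpoint = "(nat \<Rightarrow> complex) set"

definition affine_space :: "nat \<Rightarrow> (nat \<Rightarrow> complex) set" where
  "affine_space N = {x. \<forall>i>N. x i = 0}"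

definition Gm_orbit :: "(nat \<Rightarrow> nat) \<Rightarrow> (nat \<Rightarrow> complex) \<Rightarrow> wpoint" where
  "Gm_orbit a x = {\<lambda>i. t ^ a i * x i | t. t \<noteq> 0}"

definition wproj :: "(nat \<Rightarrow> nat) \<Rightarrow> nat \<Rightarrow> wpoint set" where
  "wproj a N = Gm_orbit a ` (affine_space N - {\<lambda>_. 0})"

text \<open>The sets \<open>{g \<noteq> 0}\<close> for homogeneous \<open>g\<close> form a basis of the Zariski topology;
  \<open>g = 1\<close> gives the whole space.\<close>

definition zariski :: "(nat \<Rightarrow> nat) \<Rightarrow> nat \<Rightarrow> wpoint topology" where
  "zariski a N = topology_generated_by
     {{P \<in> wproj a N. \<forall>x\<in>P. peval g x \<noteq> 0} | g. \<exists>d. whomogeneous a N d g}"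

abbreviation zariski_on :: "(nat \<Rightarrow> nat) \<Rightarrow> nat \<Rightarrow> wpoint set \<Rightarrow> wpoint topology" where
  "zariski_on a N X \<equiv> subtopology (zariski a N) X"

definition hypersurface :: "(nat \<Rightarrow> nat) \<Rightarrow> nat \<Rightarrow> cpoly \<Rightarrow> wpoint set" where
  "hypersurface a N f = {P \<in> wproj a N. \<forall>x\<in>P. peval f x = 0}"

text \<open>Regular functions on an open subset \<open>U\<close> of a closed set \<open>X\<close>: locally quotients of
  homogeneous polynomials of equal degree.\<close>

definition regular_on ::
  "(nat \<Rightarrow> nat) \<Rightarrow> nat \<Rightarrow> wpoint set \<Rightarrow> wpoint set \<Rightarrow> (wpoint \<Rightarrow> complex) \<Rightarrow> bool" where
  "regular_on a N X U h \<longleftrightarrow> openin (zariski_on a N X) U \<and>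
     (\<forall>P\<in>U. \<exists>U' f g d. openin (zariski_on a N X) U' \<and> P \<in> U' \<and> U' \<subseteq> U \<and>
        whomogeneous a N d f \<and> whomogeneous a N d g \<and>
        (\<forall>Q\<in>U'. \<forall>x\<in>Q. peval g x \<noteq> 0 \<and> h Q = peval f x / peval g x))"

definition self_morphism ::
  "(nat \<Rightarrow> nat) \<Rightarrow> nat \<Rightarrow> wpoint set \<Rightarrow> (wpoint \<Rightarrow> wpoint) \<Rightarrow> bool" where
  "self_morphism a N X \<psi> \<longleftrightarrow>
     continuous_map (zariski_on a N X) (zariski_on a N X) \<psi> \<and>
     (\<forall>U h. regular_on a N X U h \<longrightarrow> regular_on a N X {P \<in> X. \<psi> P \<in> U} (h \<circ> \<psi>))"

text \<open>The maximal ideal of the local ring of \<open>X\<close> at \<open>P\<close> is generated by the germs of \<open>d\<close>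
  functions.  If \<open>d\<close> is the dimension of that ring, this says that the ring is regular.\<close>

definition max_ideal_generated_by ::
  "(nat \<Rightarrow> nat) \<Rightarrow> nat \<Rightarrow> wpoint set \<Rightarrow> wpoint \<Rightarrow> nat \<Rightarrow> bool" where
  "max_ideal_generated_by a N X P d \<longleftrightarrow>
     (\<exists>U (t :: nat \<Rightarrow> wpoint \<Rightarrow> complex). P \<in> U \<and> openin (zariski_on a N X) U \<and>
        (\<forall>i<d. regular_on a N X U (t i) \<and> t i P = 0) \<and>
        (\<forall>U' h. P \<in> U' \<and> regular_on a N X U' h \<and> h P = 0 \<longrightarrow>
           (\<exists>U'' (c :: nat \<Rightarrow> wpoint \<Rightarrow> complex). P \<in> U'' \<and> U'' \<subseteq> U \<inter> U' \<and>
              openin (zariski_on a N X) U'' \<and> (\<forall>i<d. regular_on a N X U'' (c i)) \<and>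
              (\<forall>Q\<in>U''. h Q = (\<Sum>i<d. c i Q * t i Q)))))"

text \<open>All local rings of \<open>\<^bold>P\<^bsup>N\<^esup>(a\<^sub>0, \<dots>, a\<^sub>N)\<close> at closed points have dimension \<open>N\<close>.\<close>

definition wproj_sing :: "(nat \<Rightarrow> nat) \<Rightarrow> nat \<Rightarrow> wpoint set" where
  "wproj_sing a N = {P \<in> wproj a N. \<not> max_ideal_generated_by a N (wproj a N) P N}"

definition well_formed_space :: "(nat \<Rightarrow> nat) \<Rightarrow> nat \<Rightarrow> bool" where
  "well_formed_space a N \<longleftrightarrow> (\<forall>j\<le>N. Gcd (a ` ({..N} - {j})) = 1)"

definition well_formed :: "(nat \<Rightarrow> nat) \<Rightarrow> nat \<Rightarrow> wpoint set \<Rightarrow> bool" where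
  "well_formed a N X \<longleftrightarrow> irreducible_closedin (zariski a N) X \<and> well_formed_space a N \<and>
     2 \<le> codim (zariski_on a N X) (X \<inter> wproj_sing a N)"

text \<open>Smoothness of the affine cone \<open>Spec \<complex>[x\<^sub>0, \<dots>, x\<^sub>N]/(f)\<close> away from the origin, by the
  Jacobian criterion.\<close>

definition quasi_smooth_hypersurface :: "nat \<Rightarrow> cpoly \<Rightarrow> bool" where
  "quasi_smooth_hypersurface N f \<longleftrightarrow>
     (\<forall>x \<in> affine_space N - {\<lambda>_. 0}. peval f x = 0 \<longrightarrow>
        (\<exists>i\<le>N. deriv (\<lambda>z. peval f (x(i := z))) (x i) \<noteq> 0))"

section \<open>Algebraic group actions\<close>

definition algebraic_action ::
  "('g, 'm) monoid_scheme \<Rightarrow> (nat \<Rightarrow> nat) \<Rightarrow> nat \<Rightarrow> wpoint set \<Rightarrow>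
   ('g \<Rightarrow> wpoint \<Rightarrow> wpoint) \<Rightarrow> bool" where
  "algebraic_action G a N X \<phi> \<longleftrightarrow>
     group_action G X \<phi> \<and> (\<forall>g\<in>carrier G. self_morphism a N X (\<phi> g))"

definition free_in_codim_one ::
  "('g, 'm) monoid_scheme \<Rightarrow> 'a topology \<Rightarrow> ('g \<Rightarrow> 'a \<Rightarrow> 'a) \<Rightarrow> bool" where
  "free_in_codim_one G T \<phi> \<longleftrightarrow>
     (\<exists>Z. closedin T Z \<and> 2 \<le> codim T Z \<and>
        (\<forall>g\<in>carrier G. \<forall>P\<in>topspace T - Z. \<phi> g P = P \<longrightarrow> g = \<one>\<^bsub>G\<^esub>))"

section \<open>The numbers\<close>

fun sylvester :: "nat \<Rightarrow> int" where
  "sylvester 0 = 2"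
| "sylvester (Suc j) = sylvester j * (sylvester j - 1) + 1"

text \<open>\<open>altB [b\<^sub>1, \<dots>, b\<^sub>k] = b\<^sub>1\<cdots>b\<^sub>k - b\<^sub>1\<cdots>b\<^bsub>k-1\<^esub> + \<dots> + (-1)\<^sup>k\<close>.\<close>

definition altB :: "int list \<Rightarrow> int" where
  "altB xs = (\<Sum>j\<le>length xs. (- 1) ^ (length xs - j) * prod_list (take j xs))"

text \<open>The alternating sum of \<open>altB\<close>, where each term drops the first remaining entry.\<close>

definition altBB :: "int list \<Rightarrow> int" where
  "altBB xs = (\<Sum>j\<le>length xs. (- 1) ^ j * altB (drop j xs))"

text \<open>\<open>zigzag_up r k\<close> is \<open>r+1, r, r+2, r-1, \<dots>, r+k, r+1-k\<close>, and \<open>zigzag_in r k\<close> is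
  \<open>k, 2r+1-k, k+1, 2r-k, \<dots>, r, r+1\<close>.\<close>

definition zigzag_up :: "nat \<Rightarrow> nat \<Rightarrow> nat list" where
  "zigzag_up r k = concat (map (\<lambda>j. [r + j, r + 1 - j]) [1..<k + 1])"

definition zigzag_in :: "nat \<Rightarrow> nat \<Rightarrow> nat list" where
  "zigzag_in r k = concat (map (\<lambda>j. [j, 2 * r + 1 - j]) [k..<r + 1])"

text \<open>The case \<open>r < i \<le> 2 * r\<close> is the recursion for \<open>b\<^bsub>r+k\<^esub>\<close> with \<open>k = i - r\<close>.\<close>

function bseq :: "nat \<Rightarrow> nat \<Rightarrow> int" where
  "bseq r i =
     (if i \<le> r then sylvester i
      else if i \<le> 2 * r then
        1 + (bseq r (2 * r + 1 - i) - 1)\<^sup>2 * altB (map (bseq r) (zigzag_up r (i - r - 1)))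
      else 0)"
  by auto
termination
  by (relation "Wellfounded.measure snd") (auto simp: zigzag_up_def)

declare bseq.simps [simp del]

text \<open>Below, \<open>n\<close> is \<open>2r+1\<close> or \<open>2r\<close>, so that \<open>r = n div 2\<close>.  The divisions in \<open>b_top\<close> are
  exact, see \<open>b_top_odd\<close> and \<open>b_top_even\<close>.\<close>

definition b_top :: "nat \<Rightarrow> int" where
  "b_top n = (let r = n div 2; b = bseq r; s = sylvester in
     if odd n then
       (1 + (\<Prod>i=1..2*r. b i) + (s 1 - 1) * altB (map b (zigzag_up r r))) div 2
     else
       (1 + 2 * (s 1 - 1)\<^sup>2 * (\<Prod>i=2..2*r-1. b i)
          + 2 * (s 2 - 1) * altB (map b (zigzag_up r (r - 1)))) div 3)"

definition v_top :: "nat \<Rightarrow> int" where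
  "v_top n = (let r = n div 2; b = bseq r; s = sylvester in
     if odd n then
       altB (map b (zigzag_in r 1)) + (s 1 - 1) * altBB (map b (zigzag_up r r)) - 1
     else
       (s 1 - 1)\<^sup>2 * altB (map b (zigzag_in r 2))
         + (s 2 - 1) * altBB (map b (zigzag_up r (r - 1))) - 1)"

definition u_val :: "nat \<Rightarrow> int" where
  "u_val n = (let r = n div 2; b = bseq r; s = sylvester in
     if odd n then
       (\<Prod>i=1..2*r. b i) + (s 1 - 1) * altB (map b (zigzag_up r r))
     else
       (s 1 - 1) * (\<Prod>i=2..2*r-1. b i) + s 1 * altB (map b (zigzag_up r (r - 1))))"

definition m_val :: "nat \<Rightarrow> int" where
  "m_val n = (let r = n div 2; b = bseq r in
     if odd n then b 0 * b_top n * altB (map b (zigzag_in r 1)) - b 0 + 1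
     else b 1 * b_top n * altB (map b (zigzag_in r 2)) - b 1 + 1)"

subsection \<open>Integrality and positivity\<close>

lemma sylvester_1_2: "sylvester 1 = 3" "sylvester (Suc 0) = 3" "sylvester 2 = 7"
  by (simp_all add: numeral_2_eq_2)

lemma sylvester_ge_2: "sylvester j \<ge> 2"
proof (induction j)
  case (Suc j)
  have "2 * 1 \<le> sylvester j * (sylvester j - 1)"
    using Suc by (intro mult_mono) auto
  then show ?case by simp
qed simp

lemma sylvester_odd: "1 \<le> j \<Longrightarrow> odd (sylvester j)"
  by (cases j) auto

lemma sylvester_mod_3: "2 \<le> j \<Longrightarrow> sylvester j mod 3 = 1"
proof (induction j rule: dec_induct)
  case base
  show ?case by (simp add: sylvester_1_2)
next
  case (step j)
  have "sylvester j = 3 * (sylvester j div 3) + 1"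
    using step.IH by presburger
  then obtain k where "sylvester j = 3 * k + 1" ..
  then have "sylvester (Suc j) = 1 + 3 * (k * (3 * k + 1))"
    by (simp add: algebra_simps)
  then show ?case by (simp del: sylvester.simps)
qed

lemma altB_snoc: "altB (xs @ [x]) = prod_list xs * x - altB xs"
proof -
  have "(\<Sum>j\<le>length xs. (- 1) ^ (Suc (length xs) - j) * prod_list (take j (xs @ [x])))
      = (\<Sum>j\<le>length xs. - ((- 1) ^ (length xs - j) * prod_list (take j xs)))"
    by (intro sum.cong) (auto simp: Suc_diff_le)
  then show ?thesis
    by (simp add: altB_def sum_negf)
qed

lemma altB_Cons: "altB (x # xs) = x * altB xs - (- 1) ^ length xs"
  by (simp add: altB_def sum.atMost_Suc_shift sum_distrib_left mult_ac del: sum.atMost_Suc)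

lemma altB_Nil [simp]: "altB [] = 1"
  by (simp add: altB_def)

lemma altB_bounds:
  assumes "\<forall>x\<in>set xs. x \<ge> 2"
  shows "1 \<le> altB xs \<and> altB xs \<le> prod_list xs"
  using assms
proof (induction xs rule: rev_induct)
  case (snoc x xs)
  then have IH: "1 \<le> altB xs" "altB xs \<le> prod_list xs" and "x \<ge> 2" by auto
  have "prod_list xs * 2 \<le> prod_list xs * x"
    using IH \<open>x \<ge> 2\<close> by (intro mult_left_mono) auto
  moreover have "prod_list (xs @ [x]) = prod_list xs * x" by simp
  ultimately show ?case using IH unfolding altB_snoc by linarith
qed simp

lemma altBB_Cons: "altBB (x # xs) = altB (x # xs) - altBB xs"
  by (simp add: altBB_def sum.atMost_Suc_shift sum_negf del: sum.atMost_Suc)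

lemma altBB_bounds:
  assumes "\<forall>x\<in>set xs. x \<ge> 2"
  shows "0 \<le> altBB xs \<and> altBB xs \<le> altB xs"
  using assms
proof (induction xs)
  case Nil
  show ?case by (simp add: altBB_def)
next
  case (Cons x xs)
  then have IH: "0 \<le> altBB xs" "altBB xs \<le> altB xs" and x: "x \<ge> 2" by auto
  have B: "1 \<le> altB xs" using Cons.prems altB_bounds by simp
  then have "2 * altB xs \<le> x * altB xs" using x by (intro mult_right_mono) auto
  moreover have "(- 1 :: int) ^ length xs \<le> 1" by (cases "even (length xs)") auto
  ultimately have "altB xs \<le> altB (x # xs)" using B unfolding altB_Cons by linarith
  then show ?case using IH by (simp add: altBB_Cons)
qed

lemma set_zigzag_up: "k \<le> r \<Longrightarrow> i \<in> set (zigzag_up r k) \<Longrightarrow> 1 \<le> i \<and> i \<le> r + k"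
  by (auto simp: zigzag_up_def)

lemma set_zigzag_in: "1 \<le> k \<Longrightarrow> i \<in> set (zigzag_in r k) \<Longrightarrow> 1 \<le> i \<and> i \<le> 2 * r"
  by (auto simp: zigzag_in_def)

lemma bseq_ge_2: "i \<le> 2 * r \<Longrightarrow> bseq r i \<ge> 2"
proof (induction i rule: less_induct)
  case (less i)
  show ?case
  proof (cases "i \<le> r")
    case True
    then show ?thesis by (simp add: bseq.simps sylvester_ge_2)
  next
    case False
    have "\<forall>x\<in>set (map (bseq r) (zigzag_up r (i - r - 1))). x \<ge> 2"
    proof (unfold set_map, intro ballI, elim imageE, hypsubst)
      fix j assume "j \<in> set (zigzag_up r (i - r - 1))"
      then have "j \<le> r + (i - r - 1)" using less.prems set_zigzag_up[of "i - r - 1" r j] by auto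
      then show "2 \<le> bseq r j" using less False by auto
    qed
    then have B: "1 \<le> altB (map (bseq r) (zigzag_up r (i - r - 1)))"
      using altB_bounds by blast
    have "2 \<le> bseq r (2 * r + 1 - i)" using less False by auto
    then have "1 \<le> (bseq r (2 * r + 1 - i) - 1)\<^sup>2"
      by (intro one_le_power) auto
    then have "1 * 1 \<le> (bseq r (2 * r + 1 - i) - 1)\<^sup>2 *
        altB (map (bseq r) (zigzag_up r (i - r - 1)))"
      using B by (intro mult_mono) auto
    then show ?thesis using False less.prems by (simp add: bseq.simps[of r i])
  qed
qed

lemma bseq_odd:
  assumes "1 \<le> i" "i \<le> 2 * r"
  shows "odd (bseq r i)"
proof (cases "i \<le> r")
  case True
  then show ?thesis using assms by (simp add: bseq.simps sylvester_odd)
next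
  case False
  then have "bseq r (2 * r + 1 - i) = sylvester (2 * r + 1 - i)" by (simp add: bseq.simps)
  then show ?thesis using False assms sylvester_odd[of "2 * r + 1 - i"]
    by (simp add: bseq.simps[of r i])
qed

lemma bseq_mod_3:
  assumes "2 \<le> i" "i \<le> 2 * r - 1"
  shows "bseq r i mod 3 = 1"
proof (cases "i \<le> r")
  case True
  then show ?thesis using assms by (simp add: bseq.simps sylvester_mod_3)
next
  case False
  then have "bseq r (2 * r + 1 - i) = sylvester (2 * r + 1 - i)" by (simp add: bseq.simps)
  moreover have "sylvester (2 * r + 1 - i) mod 3 = 1" using False assms by (intro sylvester_mod_3) auto
  ultimately have "3 dvd bseq r (2 * r + 1 - i) - 1" by (simp add: mod_eq_dvd_iff[symmetric])
  then have "3 dvd (bseq r (2 * r + 1 - i) - 1)\<^sup>2 * altB (map (bseq r) (zigzag_up r (i - r - 1)))"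
    by (simp add: power2_eq_square)
  then have "3 dvd bseq r i - 1" using False assms by (simp add: bseq.simps[of r i])
  then have "bseq r i mod 3 = 1 mod 3" using mod_eq_dvd_iff by blast
  then show ?thesis by simp
qed

lemma altB_zigzag_pos:
  "k \<le> r \<Longrightarrow> 1 \<le> altB (map (bseq r) (zigzag_up r k))"
  "k \<le> r \<Longrightarrow> 0 \<le> altBB (map (bseq r) (zigzag_up r k))"
  "1 \<le> l \<Longrightarrow> 1 \<le> altB (map (bseq r) (zigzag_in r l))"
proof -
  have up: "\<forall>x\<in>set (map (bseq r) (zigzag_up r k)). x \<ge> 2" if "k \<le> r"
  proof (unfold set_map, intro ballI, elim imageE, hypsubst)
    fix i assume "i \<in> set (zigzag_up r k)"
    then show "2 \<le> bseq r i" using that set_zigzag_up[of k r i] by (intro bseq_ge_2) auto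
  qed
  show "k \<le> r \<Longrightarrow> 1 \<le> altB (map (bseq r) (zigzag_up r k))"
    "k \<le> r \<Longrightarrow> 0 \<le> altBB (map (bseq r) (zigzag_up r k))"
    using up altB_bounds altBB_bounds by blast+
  have "\<forall>x\<in>set (map (bseq r) (zigzag_in r l)). x \<ge> 2" if "1 \<le> l"
  proof (unfold set_map, intro ballI, elim imageE, hypsubst)
    fix i assume "i \<in> set (zigzag_in r l)"
    then show "2 \<le> bseq r i" using that set_zigzag_in[of l i r] by (intro bseq_ge_2) auto
  qed
  then show "1 \<le> l \<Longrightarrow> 1 \<le> altB (map (bseq r) (zigzag_in r l))"
    using altB_bounds by blast
qed

lemma b_top_odd:
  assumes "r \<ge> 1"
  shows "2 * b_top (2 * r + 1) = 1 + (\<Prod>i=1..2*r. bseq r i)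
    + (sylvester 1 - 1) * altB (map (bseq r) (zigzag_up r r))"
proof -
  have "odd (\<Prod>i=1..2*r. bseq r i)"
    using bseq_odd by (subst even_prod_iff) auto
  then have "2 dvd 1 + (\<Prod>i=1..2*r. bseq r i)
    + (sylvester 1 - 1) * altB (map (bseq r) (zigzag_up r r))"
    by simp
  then show ?thesis by (simp add: b_top_def Let_def)
qed

lemma b_top_even:
  assumes "r \<ge> 1"
  shows "3 * b_top (2 * r) = 1 + 2 * (sylvester 1 - 1)\<^sup>2 * (\<Prod>i=2..2*r-1. bseq r i)
    + 2 * (sylvester 2 - 1) * altB (map (bseq r) (zigzag_up r (r - 1)))" (is "_ = ?R")
proof -
  have "(\<Prod>i=2..2*r-1. bseq r i) mod 3 = (\<Prod>i=2..2*r-1. bseq r i mod 3) mod 3"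
    by (simp add: mod_prod_eq)
  also have "(\<Prod>i=2..2*r-1. bseq r i mod 3) = 1"
    using bseq_mod_3 by (intro prod.neutral) auto
  finally have P: "(\<Prod>i=2..2*r-1. bseq r i) mod 3 = 1" by simp
  define B where "B = altB (map (bseq r) (zigzag_up r (r - 1)))"
  have "?R = 1 + 8 * (\<Prod>i=2..2*r-1. bseq r i) + 12 * B"
    by (simp add: sylvester_1_2 B_def)
  then have "3 dvd ?R" using P by presburger
  then show ?thesis by (simp add: b_top_def Let_def)
qed

lemma b_top_pos:
  assumes "n \<ge> 2"
  shows "b_top n > 0"
proof (cases "odd n")
  case True
  define r where "r = n div 2"
  have n: "n = 2 * r + 1" "r \<ge> 1" using True assms by (auto simp: r_def)
  have "0 < (\<Prod>i=1..2*r. bseq r i)"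
  proof (intro prod_pos ballI)
    fix i assume "i \<in> {1..2*r}"
    then have "i \<le> 2 * r" by auto
    then show "0 < bseq r i" using bseq_ge_2[of i r] by auto
  qed
  then show ?thesis using b_top_odd[OF n(2)] altB_zigzag_pos(1)[of r r]
    unfolding n(1) sylvester_1_2 by simp
next
  case False
  define r where "r = n div 2"
  have n: "n = 2 * r" "r \<ge> 1" using False assms by (auto simp: r_def)
  have "0 < (\<Prod>i=2..2*r-1. bseq r i)"
  proof (intro prod_pos ballI)
    fix i assume "i \<in> {2..2*r-1}"
    then have "i \<le> 2 * r" by auto
    then show "0 < bseq r i" using bseq_ge_2[of i r] by auto
  qed
  then show ?thesis using b_top_even[OF n(2)] altB_zigzag_pos(1)[of "r - 1" r]
    unfolding n(1) sylvester_1_2 by simp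
qed

lemma m_val_pos:
  assumes "n \<ge> 2"
  shows "m_val n > 0"
proof -
  define r where "r = n div 2"
  have b: "bseq r 0 = 2" "bseq r 1 = 3" using assms by (simp_all add: bseq.simps r_def)
  have "1 * 1 \<le> b_top n * altB (map (bseq r) (zigzag_in r l))" if "1 \<le> l" for l
    using b_top_pos[OF assms] altB_zigzag_pos(3)[OF that] by (intro mult_mono) auto
  from this[of 1] this[of 2] show ?thesis
    unfolding m_val_def r_def[symmetric] Let_def b mult.assoc by (cases "odd n") simp_all
qed

lemma v_top_nonneg: "v_top n \<ge> 0"
  using altB_zigzag_pos(2)[of "n div 2" "n div 2"] altB_zigzag_pos(2)[of "n div 2 - 1" "n div 2"]
    altB_zigzag_pos(3)[of 1 "n div 2"] altB_zigzag_pos(3)[of 2 "n div 2"]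
  by (simp add: v_top_def Let_def sylvester_1_2)

section \<open>The hypersurface\<close>

text \<open>The integer exponents are nonnegative for \<open>n \<ge> 2\<close>: see \<open>bseq_ge_2\<close>, \<open>b_top_pos\<close> and
  \<open>v_top_nonneg\<close>.\<close>

definition V_poly :: "nat \<Rightarrow> cpoly" where
  "V_poly n = (let r = n div 2; b = bseq r in
     if odd n then
       (\<Sum>i=0..r. xpow i (nat (b i)) * xpow (2*r+2-i) 1)
       + (\<Sum>j=1..r. xpow (r+j) (nat (b (r+j))) * xpow (r+1-j) 1)
       + xpow (2*r+1) (nat (b_top n)) * xpow 0 1
       + xpow (2*r+2) (nat (v_top n)) * xpow (r+1) 1
     else
       xpow 0 (nat (b 0))
       + (\<Sum>i=1..r. xpow i (nat (b i)) * xpow (2*r+2-i) 1)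
       + (\<Sum>j=1..r-1. xpow (r+j) (nat (b (r+j))) * xpow (r+1-j) 1)
       + xpow (2*r) (nat (b_top n)) * xpow 1 1
       + xpow (2*r+1) (nat (v_top n)) * xpow (r+1) 1)"

text \<open>\<open>a\<close> and \<open>D\<close> are the weights \<open>a'\<^sub>0, \<dots>, a'\<^bsub>n+1\<^esub>\<close> and the degree \<open>D'\<close>; entries of \<open>a\<close>
  above \<open>n + 1\<close> are set to \<open>0\<close>.\<close>

definition V_weights :: "nat \<Rightarrow> (nat \<Rightarrow> nat) \<Rightarrow> nat \<Rightarrow> bool" where
  "V_weights n a D \<longleftrightarrow> (\<forall>i\<le>n+1. 0 < a i) \<and> (\<forall>i>n+1. a i = 0) \<and>
     Gcd (a ` {..n+1}) = 1 \<and> whomogeneous a (n+1) D (V_poly n)"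

end

theory Submission
  imports Defs
begin

text \<open>
  Apart from \<open>x\<^sub>0\<^sup>2\<close>, which occurs for even \<open>n\<close>, the polynomial of \<open>V'\<close> is a loop: its monomials
  are \<open>x\<^sub>j\<close> to a power \<open>e\<^sub>j\<close> times \<open>x\<^bsub>j'\<^esub>\<close>, where \<open>j \<mapsto> j'\<close> is a cyclic permutation.  With
  \<open>z = 0\<close> for odd and \<open>z = 1\<close> for even \<open>n\<close> the cycle is \<open>n+1, r+1, r, r+2, r-1, \<dots>, n, z\<close>, and both
  parities are treated at once.

  Numbers.  The weights solve \<open>e\<^sub>j a\<^sub>j + a\<^bsub>j'\<^esub> = D'\<close>.  Starting with \<open>a\<^bsub>n+1\<^esub> = 1\<close> and following
  the cycle expresses them by the product \<open>P\<close> of the exponents passed so far and their alternating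
  sums \<open>U, W, B\<close>.  That the cycle closes with \<open>a\<^sub>n = 1\<close>, and that the weights add up to \<open>D'\<close>, both
  come from one identity between \<open>P, U, W, B\<close> (\<open>z_identity\<close>), an induction over the pairs
  \<open>r+i, r+1-i\<close> that uses the recursions of the \<open>b\<^sub>i\<close> and of the Sylvester numbers.  Uniqueness of the
  weights and quasi-smoothness have a common reason: a quantity that is multiplied by \<open>e\<^sub>j \<ge> 2\<close> in
  each step of a cycle is zero (\<open>expanding_permutation_zero\<close>).

  Geometry.  Since \<open>a\<^sub>n = a\<^bsub>n+1\<^esub> = 1\<close>, the charts \<open>x\<^sub>n \<noteq> 0\<close> and \<open>x\<^bsub>n+1\<^esub> \<noteq> 0\<close> are affine spaces, so
  the ambient space is smooth there (\<open>smooth_point_weight_one\<close>).  A bound \<open>\<ge> 2\<close> on a codimension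
  in \<open>V'\<close> only asks for one irreducible closed set strictly between \<open>W\<close> and \<open>V'\<close>, for each
  irreducible \<open>W\<close> in question, and the sections of \<open>V'\<close> by \<open>x\<^sub>n = 0\<close> and by \<open>x\<^bsub>n+1\<^esub> = 0\<close> serve for
  this.  Their irreducibility and that of \<open>V'\<close> are proved with polynomial functions.  On the
  section \<open>x\<^sub>c = 0\<close> the polynomial is linear in the variable preceding \<open>x\<^sub>c\<close>, with a power of a single
  variable as coefficient (\<open>prime_zeros_linear\<close>).  The polynomial of \<open>V'\<close> itself is quadratic in
  \<open>x\<^sub>0\<close>, and its discriminant has degree three in \<open>x\<^sub>1\<close> because \<open>b\<^sub>1 = 3\<close>; being of odd degree, it is
  not a square (\<open>prime_zeros_quadratic\<close>).

  Group action.  A generator multiplies \<open>x\<^sub>j\<close> by the \<open>d\<^sub>j\<close>-th power of a primitive \<open>m'\<close>-th root of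
  unity, where \<open>e\<^sub>j d\<^sub>j + d\<^bsub>j'\<^esub> \<equiv> 1\<close> modulo \<open>m'\<close> and \<open>d\<^bsub>n+1\<^esub> = 0\<close>.  The number \<open>m'\<close> is exactly what makes
  this system close up around the cycle, and \<open>D' m' - 1\<close> is the product of all exponents in it.
  A point with nontrivial stabilizer has at least two vanishing coordinates among \<open>x\<^sub>n, x\<^bsub>n+1\<^esub>, x\<^sub>z\<close>,
  because \<open>d\<^sub>n\<close>, \<open>d\<^sub>z\<close> and \<open>d\<^sub>z - a\<^sub>z d\<^sub>n\<close> are prime to \<open>m'\<close> (\<open>coprime_dexp\<close>).
\<close>

section \<open>Polynomials as functions\<close>

text \<open>The value of the monomial with exponent vector \<open>m\<close>.\<close>

definition monom_eval :: "(nat \<Rightarrow>\<^sub>0 nat) \<Rightarrow> (nat \<Rightarrow> complex) \<Rightarrow> complex" where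
  "monom_eval m x = (\<Prod>i\<in>Poly_Mapping.keys m. x i ^ Poly_Mapping.lookup m i)"

lemma monom_eval_superset:
  assumes "finite S" "Poly_Mapping.keys m \<subseteq> S"
  shows "monom_eval m x = (\<Prod>i\<in>S. x i ^ Poly_Mapping.lookup m i)"
  unfolding monom_eval_def using assms by (intro prod.mono_neutral_left) (auto simp: in_keys_iff)

lemma monom_eval_add: "monom_eval (m + m') x = monom_eval m x * monom_eval m' x"
proof -
  let ?S = "Poly_Mapping.keys m \<union> Poly_Mapping.keys m'"
  have "monom_eval (m + m') x = (\<Prod>i\<in>?S. x i ^ Poly_Mapping.lookup (m + m') i)"
    by (intro monom_eval_superset keys_add) auto
  also have "\<dots> = (\<Prod>i\<in>?S. x i ^ Poly_Mapping.lookup m i) * (\<Prod>i\<in>?S. x i ^ Poly_Mapping.lookup m' i)"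
    by (simp add: lookup_add power_add prod.distrib)
  also have "\<dots> = monom_eval m x * monom_eval m' x"
    by (simp add: monom_eval_superset[of ?S m] monom_eval_superset[of ?S m'])
  finally show ?thesis .
qed

lemma monom_eval_single: "monom_eval (Poly_Mapping.single i e) x = x i ^ e"
  by (simp add: monom_eval_def)

lemma monom_eval_zero [simp]: "monom_eval 0 x = 1"
  by (simp add: monom_eval_def)

lemma peval_superset:
  assumes "finite S" "Poly_Mapping.keys p \<subseteq> S"
  shows "peval p x = (\<Sum>m\<in>S. Poly_Mapping.lookup p m * monom_eval m x)"
  unfolding peval_def monom_eval_def[symmetric] using assms
  by (intro sum.mono_neutral_left) (auto simp: in_keys_iff)

lemma peval_monom_eval: "peval p x = (\<Sum>m\<in>Poly_Mapping.keys p. Poly_Mapping.lookup p m * monom_eval m x)"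
  by (intro peval_superset) auto

lemma peval_add: "peval (p + q) x = peval p x + peval q x"
proof -
  let ?S = "Poly_Mapping.keys p \<union> Poly_Mapping.keys q"
  have "peval (p + q) x = (\<Sum>m\<in>?S. Poly_Mapping.lookup (p + q) m * monom_eval m x)"
    by (intro peval_superset keys_add) auto
  then show ?thesis
    by (simp add: lookup_add algebra_simps sum.distrib peval_superset[of ?S p] peval_superset[of ?S q])
qed

lemma peval_zero [simp]: "peval 0 x = 0"
  by (simp add: peval_def)

lemma peval_sum: "peval (sum f A) x = (\<Sum>i\<in>A. peval (f i) x)"
  by (induction A rule: infinite_finite_induct) (auto simp: peval_add)

lemma peval_single: "peval (Poly_Mapping.single m c) x = c * monom_eval m x"
  by (simp add: peval_monom_eval)

lemma peval_mult: "peval (p * q) x = peval p x * peval q x"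
proof -
  have exp: "f = (\<Sum>m\<in>Poly_Mapping.keys f. Poly_Mapping.single m (Poly_Mapping.lookup f m))" for f :: cpoly
    by (rule poly_mapping_eqI) (auto simp: lookup_sum lookup_single when_def in_keys_iff)
  have "p * q = (\<Sum>m\<in>Poly_Mapping.keys p. \<Sum>m'\<in>Poly_Mapping.keys q.
      Poly_Mapping.single (m + m') (Poly_Mapping.lookup p m * Poly_Mapping.lookup q m'))"
    by (subst exp[of p], subst exp[of q]) (simp add: sum_product mult_single)
  then show ?thesis
    by (simp add: peval_sum peval_single monom_eval_add)
      (simp add: peval_monom_eval sum_product mult_ac)
qed

lemma peval_xpow: "peval (xpow i e) x = x i ^ e"
  by (simp add: xpow_def peval_single monom_eval_single)

lemma peval_one [simp]: "peval 1 x = 1"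
  by (simp flip: single_one add: peval_single)

text \<open>Polynomial functions in the variables with index in \<open>I\<close>.  Over the infinite field of complex
  numbers nothing is lost by passing from polynomials to functions, and no normal form has to be
  maintained.\<close>

inductive_set polyfuns :: "nat set \<Rightarrow> ((nat \<Rightarrow> complex) \<Rightarrow> complex) set" for I :: "nat set" where
  const: "(\<lambda>_. c) \<in> polyfuns I"
| var: "i \<in> I \<Longrightarrow> (\<lambda>x. x i) \<in> polyfuns I"
| add: "g \<in> polyfuns I \<Longrightarrow> h \<in> polyfuns I \<Longrightarrow> (\<lambda>x. g x + h x) \<in> polyfuns I"
| mult: "g \<in> polyfuns I \<Longrightarrow> h \<in> polyfuns I \<Longrightarrow> (\<lambda>x. g x * h x) \<in> polyfuns I"

lemma polyfuns_mono: "g \<in> polyfuns I \<Longrightarrow> I \<subseteq> J \<Longrightarrow> g \<in> polyfuns J"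
  by (induction rule: polyfuns.induct) (auto intro: polyfuns.intros)

lemma polyfuns_cong: "g \<in> polyfuns I \<Longrightarrow> (\<And>i. i \<in> I \<Longrightarrow> x i = y i) \<Longrightarrow> g x = g y"
  by (induction rule: polyfuns.induct) auto

lemma polyfuns_upd: "g \<in> polyfuns I \<Longrightarrow> i \<notin> I \<Longrightarrow> g (x(i := z)) = g x"
  by (rule polyfuns_cong) auto

lemma polyfuns_uminus: "g \<in> polyfuns I \<Longrightarrow> (\<lambda>x. - g x) \<in> polyfuns I"
  using polyfuns.mult[OF polyfuns.const[of "- 1"]] by simp

lemma polyfuns_diff: "g \<in> polyfuns I \<Longrightarrow> h \<in> polyfuns I \<Longrightarrow> (\<lambda>x. g x - h x) \<in> polyfuns I"
  using polyfuns.add[OF _ polyfuns_uminus] by simp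

lemma polyfuns_power: "g \<in> polyfuns I \<Longrightarrow> (\<lambda>x. g x ^ k) \<in> polyfuns I"
  by (induction k) (auto intro: polyfuns.intros)

lemma polyfuns_sum: "(\<And>a. a \<in> A \<Longrightarrow> g a \<in> polyfuns I) \<Longrightarrow> (\<lambda>x. \<Sum>a\<in>A. g a x) \<in> polyfuns I"
  by (induction A rule: infinite_finite_induct) (auto intro: polyfuns.intros)

lemma polyfuns_prod: "(\<And>a. a \<in> A \<Longrightarrow> g a \<in> polyfuns I) \<Longrightarrow> (\<lambda>x. \<Prod>a\<in>A. g a x) \<in> polyfuns I"
  by (induction A rule: infinite_finite_induct) (auto intro: polyfuns.intros)

lemmas polyfuns_intros = polyfuns.intros polyfuns_uminus polyfuns_diff polyfuns_power polyfuns_sum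
  polyfuns_prod

lemma polyfuns_subst:
  "g \<in> polyfuns I \<Longrightarrow> (\<And>i. i \<in> I \<Longrightarrow> (\<lambda>x. u x i) \<in> polyfuns J) \<Longrightarrow> (\<lambda>x. g (u x)) \<in> polyfuns J"
  by (induction rule: polyfuns.induct) (auto intro: polyfuns.intros)

lemma peval_polyfuns:
  assumes "\<And>m. m \<in> Poly_Mapping.keys p \<Longrightarrow> Poly_Mapping.keys m \<subseteq> I"
  shows "peval p \<in> polyfuns I"
proof -
  have "(\<lambda>x. peval p x) \<in> polyfuns I"
    unfolding peval_def using assms by (intro polyfuns_intros) auto
  then show ?thesis by simp
qed

text \<open>Along a polynomial curve, a polynomial function becomes a polynomial in one variable.\<close>

lemma polyfuns_curve:
  assumes "g \<in> polyfuns I"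
  shows "\<exists>q. \<forall>z. g (\<lambda>i. poly (U i) z) = poly q z"
  using assms
proof (induction rule: polyfuns.induct)
  case (const c)
  show ?case by (rule exI[of _ "[:c:]"]) simp
next
  case (var i)
  show ?case by blast
next
  case (add g h)
  then obtain p q where "\<forall>z. g (\<lambda>i. poly (U i) z) = poly p z" "\<forall>z. h (\<lambda>i. poly (U i) z) = poly q z"
    by blast
  then show ?case by (intro exI[of _ "p + q"]) simp
next
  case (mult g h)
  then obtain p q where "\<forall>z. g (\<lambda>i. poly (U i) z) = poly p z" "\<forall>z. h (\<lambda>i. poly (U i) z) = poly q z"
    by blast
  then show ?case by (intro exI[of _ "p * q"]) simp
qed

lemma polyfuns_slice:
  assumes "g \<in> polyfuns I"
  obtains q where "\<And>z. g (x(i := z)) = poly q z"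
proof -
  obtain q where "\<forall>z. g (\<lambda>j. poly (if j = i then [:0, 1:] else [:x j:]) z) = poly q z"
    using polyfuns_curve[OF assms, of "\<lambda>j. if j = i then [:0, 1:] else [:x j:]"] by blast
  moreover have "(\<lambda>j. poly (if j = i then [:0, 1:] else [:x j:]) z) = x(i := z)" for z
    by auto
  ultimately show ?thesis by (intro that[of q]) auto
qed

lemma polyfuns_no_zero_divisors:
  assumes "g \<in> polyfuns I" "h \<in> polyfuns J" "\<And>x. g x * h x = 0"
  shows "(\<forall>x. g x = 0) \<or> (\<forall>x. h x = 0)"
proof (rule ccontr)
  assume "\<not> ?thesis"
  then obtain a b where a: "g a \<noteq> 0" and b: "h b \<noteq> 0" by blast
  \<comment> \<open>restrict both functions to the line through \<open>a\<close> and \<open>b\<close>\<close>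
  define U where "U = (\<lambda>i. [:a i, b i - a i:])"
  obtain p where p: "\<And>z. g (\<lambda>i. poly (U i) z) = poly p z" using polyfuns_curve[OF assms(1)] by blast
  obtain q where q: "\<And>z. h (\<lambda>i. poly (U i) z) = poly q z" using polyfuns_curve[OF assms(2)] by blast
  have "poly p 0 \<noteq> 0" using p[of 0] a by (simp add: U_def)
  moreover have "poly q 1 \<noteq> 0" using q[of 1] b by (simp add: U_def)
  moreover have "poly (p * q) z = 0" for z using assms(3) by (simp flip: p q)
  then have "p * q = 0" using poly_all_0_iff_0 by blast
  ultimately show False by auto
qed

lemma polyfuns_zero_subst:
  assumes "g \<in> polyfuns I"
  shows "(\<lambda>x. g (x(p := 0))) \<in> polyfuns UNIV"
proof (rule polyfuns_subst[OF assms])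
  fix i
  show "(\<lambda>x. (x(p := 0)) i) \<in> polyfuns UNIV"
    by (cases "i = p") (auto intro: polyfuns.intros)
qed

lemma polyfuns_split_var:
  assumes "g \<in> polyfuns I"
  shows "\<exists>h\<in>polyfuns UNIV. \<forall>x. g x = g (x(p := 0)) + x p * h x"
  using assms
proof (induction rule: polyfuns.induct)
  case (const c)
  show ?case by (rule bexI[of _ "\<lambda>_. 0"]) (auto intro: polyfuns.intros)
next
  case (var i)
  show ?case
    by (rule bexI[of _ "\<lambda>_. if i = p then 1 else 0"]) (auto intro: polyfuns.intros)
next
  case (add g h)
  then obtain g' h' where gh: "g' \<in> polyfuns UNIV" "\<And>x. g x = g (x(p := 0)) + x p * g' x"
    "h' \<in> polyfuns UNIV" "\<And>x. h x = h (x(p := 0)) + x p * h' x" by blast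
  have "\<forall>x. g x + h x = g (x(p := 0)) + h (x(p := 0)) + x p * (g' x + h' x)"
  proof
    fix x
    show "g x + h x = g (x(p := 0)) + h (x(p := 0)) + x p * (g' x + h' x)"
      by (subst gh(2)[of x], subst gh(4)[of x]) (simp add: algebra_simps)
  qed
  then show ?case by (rule bexI[OF _ polyfuns.add[OF gh(1,3)]])
next
  case (mult g h)
  then obtain g' h' where gh: "g' \<in> polyfuns UNIV" "\<And>x. g x = g (x(p := 0)) + x p * g' x"
    "h' \<in> polyfuns UNIV" "\<And>x. h x = h (x(p := 0)) + x p * h' x" by blast
  have u: "(\<lambda>x. h (x(p := 0))) \<in> polyfuns UNIV"
    if "h \<in> polyfuns I" for h using that by (rule polyfuns_zero_subst)
  define k where "k = (\<lambda>x. g' x * h (x(p := 0)) + g x * h' x)"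
  have "k \<in> polyfuns UNIV" unfolding k_def using gh(1,3) mult.hyps u polyfuns_mono[of g I UNIV]
    by (intro polyfuns.intros) auto
  moreover have "g x * h x = g (x(p := 0)) * h (x(p := 0)) + x p * k x" for x
  proof -
    have "g x * h x = g x * h (x(p := 0)) + x p * (g x * h' x)"
      by (subst gh(4)[of x]) (simp add: algebra_simps)
    also have "g x * h (x(p := 0)) = g (x(p := 0)) * h (x(p := 0)) + x p * (g' x * h (x(p := 0)))"
      by (subst gh(2)[of x]) (simp add: algebra_simps)
    finally show ?thesis by (simp add: k_def algebra_simps)
  qed
  ultimately show ?case by blast
qed

section \<open>Irreducible zero sets\<close>

text \<open>The coordinate function \<open>x\<^sub>p\<close> is a prime element: if it does not divide \<open>f\<close>, it can be
  cancelled from a multiple of \<open>f\<close>.\<close>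

lemma polyfuns_cancel_var:
  assumes "f \<in> polyfuns UNIV" "g \<in> polyfuns UNIV" "q \<in> polyfuns UNIV"
    and "\<And>x. x p ^ k * g x = q x * f x" and nz: "f x0 \<noteq> 0" "x0 p = 0"
  shows "\<exists>q\<in>polyfuns UNIV. \<forall>x. g x = q x * f x"
  using assms(3,4)
proof (induction k arbitrary: q)
  case 0
  then show ?case by auto
next
  case (Suc k)
  have sub: "(\<lambda>x. h (x(p := 0))) \<in> polyfuns UNIV" if "h \<in> polyfuns UNIV" for h
    using that by (rule polyfuns_zero_subst)
  have "q (x(p := 0)) * f (x(p := 0)) = 0" for x
    using Suc.prems(2)[of "x(p := 0)"] by (simp del: fun_upd_apply add: fun_upd_same)
  moreover have "f (x0(p := 0)) \<noteq> 0" using nz by (metis fun_upd_triv)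
  ultimately have q0: "q (x(p := 0)) = 0" for x
    using polyfuns_no_zero_divisors[OF sub[OF Suc.prems(1)] sub[OF assms(1)]] by blast
  obtain q' where q': "q' \<in> polyfuns UNIV" "\<And>x. q x = q (x(p := 0)) + x p * q' x"
    using polyfuns_split_var[OF Suc.prems(1)] by blast
  have "x p * (x p ^ k * g x - q' x * f x) = 0" for x
    using Suc.prems(2)[of x] q'(2)[of x] q0[of x] by (simp add: algebra_simps)
  then have "(\<forall>x::nat\<Rightarrow>complex. x p = 0) \<or> (\<forall>x. x p ^ k * g x - q' x * f x = 0)"
    by (intro polyfuns_no_zero_divisors[of _ UNIV _ UNIV])
      (auto intro!: polyfuns_intros assms(1,2) q'(1))
  moreover have "\<not> (\<forall>x::nat\<Rightarrow>complex. x p = 0)" by (auto intro: exI[of _ "\<lambda>_. 1"])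
  ultimately have "\<And>x. x p ^ k * g x = q' x * f x" by auto
  then show ?case by (rule Suc.IH[OF q'(1)])
qed

text \<open>Irreducibility of the zero set of \<open>f\<close>: a product of two polynomial functions vanishes on it
  only if one of the factors does.\<close>

definition prime_zeros :: "((nat \<Rightarrow> complex) \<Rightarrow> complex) \<Rightarrow> bool" where
  "prime_zeros f \<longleftrightarrow> (\<forall>g\<in>polyfuns UNIV. \<forall>h\<in>polyfuns UNIV.
     (\<forall>x. f x = 0 \<longrightarrow> g x * h x = 0) \<longrightarrow> (\<forall>x. f x = 0 \<longrightarrow> g x = 0) \<or> (\<forall>x. f x = 0 \<longrightarrow> h x = 0))"

text \<open>Division by a polynomial that is linear in the variable with index \<open>y\<close>.\<close>

lemma linear_pseudo_division:
  assumes f: "f \<in> polyfuns UNIV" and A: "A \<in> polyfuns (- {y})" and B: "B \<in> polyfuns (- {y})"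
    and f_eq: "\<And>x. f x = A x * x y + B x" and g: "g \<in> polyfuns UNIV"
  shows "\<exists>k. \<exists>q\<in>polyfuns UNIV. \<exists>\<alpha>\<in>polyfuns (- {y}). \<forall>x. A x ^ k * g x = q x * f x + \<alpha> x"
  using g
proof (induction rule: polyfuns.induct)
  case (const c)
  show ?case
    by (rule exI[of _ 0], rule bexI[of _ "\<lambda>_. 0"], rule bexI[of _ "\<lambda>_. c"]) (auto intro: polyfuns.intros)
next
  case (var i)
  show ?case
  proof (cases "i = y")
    case True
    show ?thesis
      by (rule exI[of _ 1], rule bexI[of _ "\<lambda>_. 1"], rule bexI[of _ "\<lambda>x. - B x"])
        (auto simp: f_eq True intro!: polyfuns_intros B)
  next
    case False
    then show ?thesis
      by (intro exI[of _ 0] bexI[of _ "\<lambda>_. 0"] bexI[of _ "\<lambda>x. x i"]) (auto intro: polyfuns.intros)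
  qed
next
  case (add g h)
  then obtain k q a k' q' a' where
    1: "q \<in> polyfuns UNIV" "a \<in> polyfuns (- {y})" "\<And>x. A x ^ k * g x = q x * f x + a x" and
    2: "q' \<in> polyfuns UNIV" "a' \<in> polyfuns (- {y})" "\<And>x. A x ^ k' * h x = q' x * f x + a' x" by metis
  have "A x ^ (k + k') * (g x + h x) = (A x ^ k' * q x + A x ^ k * q' x) * f x + (A x ^ k' * a x + A x ^ k * a' x)" for x
  proof -
    have "A x ^ (k + k') * (g x + h x) = A x ^ k' * (A x ^ k * g x) + A x ^ k * (A x ^ k' * h x)"
      by (simp add: power_add algebra_simps)
    then show ?thesis unfolding 1 2 by (simp add: algebra_simps)
  qed
  then show ?case using 1 2 polyfuns_mono[OF A, of UNIV] A
    by (intro exI[of _ "k + k'"] bexI[of _ "\<lambda>x. A x ^ k' * q x + A x ^ k * q' x"]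
        bexI[of _ "\<lambda>x. A x ^ k' * a x + A x ^ k * a' x"]) (auto intro!: polyfuns_intros)
next
  case (mult g h)
  then obtain k q a k' q' a' where
    1: "q \<in> polyfuns UNIV" "a \<in> polyfuns (- {y})" "\<And>x. A x ^ k * g x = q x * f x + a x" and
    2: "q' \<in> polyfuns UNIV" "a' \<in> polyfuns (- {y})" "\<And>x. A x ^ k' * h x = q' x * f x + a' x" by metis
  have "A x ^ (k + k') * (g x * h x) = (q x * (q' x * f x + a' x) + a x * q' x) * f x + a x * a' x" for x
  proof -
    have "A x ^ (k + k') * (g x * h x) = (A x ^ k * g x) * (A x ^ k' * h x)"
      by (simp add: power_add algebra_simps)
    then show ?thesis unfolding 1 2 by (simp add: algebra_simps)
  qed
  then show ?case using 1 2 f polyfuns_mono[of a "- {y}" UNIV] polyfuns_mono[of a' "- {y}" UNIV]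
    by (intro exI[of _ "k + k'"] bexI[of _ "\<lambda>x. q x * (q' x * f x + a' x) + a x * q' x"]
        bexI[of _ "\<lambda>x. a x * a' x"]) (auto intro!: polyfuns_intros)
qed

text \<open>The zeros of \<open>f\<close> with \<open>x\<^sub>p \<noteq> 0\<close> form a graph over the other coordinates, and no component
  of the zero set lies in \<open>x\<^sub>p = 0\<close>, because \<open>f\<close> does not vanish there.\<close>

lemma prime_zeros_linear:
  assumes B: "B \<in> polyfuns (- {y})" and py: "p \<noteq> y"
    and f_eq: "\<And>x. f x = x p ^ e * x y + B x" and nz: "f x0 \<noteq> 0" "x0 p = 0"
  shows "prime_zeros f"
proof -
  define A :: "(nat \<Rightarrow> complex) \<Rightarrow> complex" where "A = (\<lambda>x. x p ^ e)"
  have A: "A \<in> polyfuns (- {y})" unfolding A_def using py by (intro polyfuns_intros) auto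
  have fA: "f x = A x * x y + B x" for x by (simp add: A_def f_eq)
  have f: "f \<in> polyfuns UNIV"
    unfolding fA[abs_def] using polyfuns_mono[OF A] polyfuns_mono[OF B] by (intro polyfuns_intros) auto
  have van: "\<forall>x. f x = 0 \<longrightarrow> g x = 0"
    if g: "g \<in> polyfuns UNIV" "q \<in> polyfuns UNIV" "\<And>x. A x ^ k * g x = q x * f x" for g q k
  proof -
    have "x p ^ (e * k) * g x = q x * f x" for x using g(3)[of x] by (simp add: A_def power_mult)
    then obtain q' where "\<And>x. g x = q' x * f x"
      using polyfuns_cancel_var[OF f g(1,2) _ nz] by blast
    then show ?thesis by simp
  qed
  show ?thesis
    unfolding prime_zeros_def
  proof (intro ballI impI)
    fix g h assume g: "g \<in> polyfuns UNIV" and h: "h \<in> polyfuns UNIV" and gh: "\<forall>x. f x = 0 \<longrightarrow> g x * h x = 0"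
    obtain k q a where 1: "q \<in> polyfuns UNIV" "a \<in> polyfuns (- {y})" "\<And>x. A x ^ k * g x = q x * f x + a x"
      using linear_pseudo_division[OF f A B fA g] by blast
    obtain k' q' a' where 2: "q' \<in> polyfuns UNIV" "a' \<in> polyfuns (- {y})" "\<And>x. A x ^ k' * h x = q' x * f x + a' x"
      using linear_pseudo_division[OF f A B fA h] by blast
    have "x p * (a x * a' x) = 0" for x
    proof (cases "x p = 0")
      case False
      define x' where "x' = x(y := - B x / A x)"
      have [simp]: "A x' = A x" "B x' = B x" "a x' = a x" "a' x' = a' x"
        unfolding x'_def using A B 1(2) 2(2) by (simp_all add: polyfuns_upd)
      have "f x' = 0" using False by (simp add: fA) (simp add: x'_def A_def)
      then have "g x' * h x' = 0" using gh by blast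
        then have "(A x ^ k * g x') * (A x ^ k' * h x') = 0" by (metis mult_eq_0_iff)
      moreover have "A x ^ k * g x' = a x" "A x ^ k' * h x' = a' x"
        using 1(3)[of x'] 2(3)[of x'] \<open>f x' = 0\<close> by simp_all
      ultimately show ?thesis by auto
    qed simp
    then have "(\<forall>x::nat\<Rightarrow>complex. x p = 0) \<or> (\<forall>x. a x * a' x = 0)"
      by (intro polyfuns_no_zero_divisors[of _ UNIV _ "- {y}"]) (auto intro!: polyfuns_intros 1 2)
    moreover have "\<not> (\<forall>x::nat\<Rightarrow>complex. x p = 0)" by (auto intro: exI[of _ "\<lambda>_. 1"])
    ultimately have "(\<forall>x. a x = 0) \<or> (\<forall>x. a' x = 0)"
      using polyfuns_no_zero_divisors[OF 1(2) 2(2)] by blast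
    then show "(\<forall>x. f x = 0 \<longrightarrow> g x = 0) \<or> (\<forall>x. f x = 0 \<longrightarrow> h x = 0)"
    proof
      assume "\<forall>x. a x = 0"
      then show ?thesis using van[OF g 1(1), of k] 1(3) by simp
    next
      assume "\<forall>x. a' x = 0"
      then show ?thesis using van[OF h 2(1), of k'] 2(3) by simp
    qed
  qed
qed

text \<open>Division by a polynomial that is quadratic in the variable with index \<open>y\<close>.\<close>

lemma quadratic_pseudo_division:
  assumes f: "f \<in> polyfuns UNIV" and A: "A \<in> polyfuns (- {y})" and E: "E \<in> polyfuns (- {y})"
    and R: "R \<in> polyfuns (- {y})"
    and f_eq: "\<And>x. f x = A x * x y ^ 2 + E x * x y + R x" and g: "g \<in> polyfuns UNIV"
  shows "\<exists>k. \<exists>q\<in>polyfuns UNIV. \<exists>\<alpha>\<in>polyfuns (- {y}). \<exists>\<beta>\<in>polyfuns (- {y}).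
    \<forall>x. A x ^ k * g x = q x * f x + \<alpha> x + \<beta> x * x y"
  using g
proof (induction rule: polyfuns.induct)
  case (const c)
  show ?case
    by (rule exI[of _ 0], rule bexI[of _ "\<lambda>_. 0"], rule bexI[of _ "\<lambda>_. c"], rule bexI[of _ "\<lambda>_. 0"])
      (auto intro: polyfuns.intros)
next
  case (var i)
  show ?case
  proof (cases "i = y")
    case True
    show ?thesis
      by (rule exI[of _ 0], rule bexI[of _ "\<lambda>_. 0"], rule bexI[of _ "\<lambda>x. 0"], rule bexI[of _ "\<lambda>x. 1"])
        (auto simp: True intro!: polyfuns_intros)
  next
    case False
    then show ?thesis
      by (intro exI[of _ 0] bexI[of _ "\<lambda>_. 0"] bexI[of _ "\<lambda>x. x i"]) (auto intro: polyfuns.intros)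
  qed
next
  case (add g h)
  then obtain k q a b k' q' a' b' where
    1: "q \<in> polyfuns UNIV" "a \<in> polyfuns (- {y})" "b \<in> polyfuns (- {y})"
       "\<And>x. A x ^ k * g x = q x * f x + a x + b x * x y" and
    2: "q' \<in> polyfuns UNIV" "a' \<in> polyfuns (- {y})" "b' \<in> polyfuns (- {y})"
       "\<And>x. A x ^ k' * h x = q' x * f x + a' x + b' x * x y" by metis
  have "A x ^ (k + k') * (g x + h x) = (A x ^ k' * q x + A x ^ k * q' x) * f x + (A x ^ k' * a x + A x ^ k * a' x)
     + (A x ^ k' * b x + A x ^ k * b' x) * x y" for x
  proof -
    have "A x ^ (k + k') * (g x + h x) = A x ^ k' * (A x ^ k * g x) + A x ^ k * (A x ^ k' * h x)"
      by (simp add: power_add algebra_simps)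
    then show ?thesis unfolding 1 2 by (simp add: algebra_simps)
  qed
  then show ?case using 1 2 polyfuns_mono[OF A, of UNIV] A
    by (intro exI[of _ "k + k'"] bexI[of _ "\<lambda>x. A x ^ k' * q x + A x ^ k * q' x"]
        bexI[of _ "\<lambda>x. A x ^ k' * a x + A x ^ k * a' x"] bexI[of _ "\<lambda>x. A x ^ k' * b x + A x ^ k * b' x"])
      (auto intro!: polyfuns_intros)
next
  case (mult g h)
  then obtain k q a b k' q' a' b' where
    1: "q \<in> polyfuns UNIV" "a \<in> polyfuns (- {y})" "b \<in> polyfuns (- {y})"
       "\<And>x. A x ^ k * g x = q x * f x + a x + b x * x y" and
    2: "q' \<in> polyfuns UNIV" "a' \<in> polyfuns (- {y})" "b' \<in> polyfuns (- {y})"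
       "\<And>x. A x ^ k' * h x = q' x * f x + a' x + b' x * x y" by metis
  define u where "u = (\<lambda>x. a x * a' x * A x - b x * b' x * R x)"
  define v where "v = (\<lambda>x. A x * (a x * b' x + a' x * b x) - b x * b' x * E x)"
  define w where "w = (\<lambda>x. A x * (q x * (q' x * f x + a' x + b' x * x y) + q' x * (a x + b x * x y)) + b x * b' x)"
  have "A x ^ Suc (k + k') * (g x * h x) = w x * f x + u x + v x * x y" for x
  proof -
    have "A x ^ Suc (k + k') * (g x * h x) = A x * ((A x ^ k * g x) * (A x ^ k' * h x))"
      by (simp add: power_add algebra_simps)
    also have "\<dots> = A x * ((q x * f x + a x + b x * x y) * (q' x * f x + a' x + b' x * x y))"
      unfolding 1 2 ..
    also have "\<dots> = A x * (q x * (q' x * f x + a' x + b' x * x y) + q' x * (a x + b x * x y)) * f x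
       + a x * a' x * A x + A x * (a x * b' x + a' x * b x) * x y + b x * b' x * (A x * x y ^ 2)"
      by (simp add: algebra_simps power2_eq_square)
    also have "A x * x y ^ 2 = f x - E x * x y - R x" by (simp add: f_eq)
    finally show ?thesis by (simp add: u_def v_def w_def algebra_simps)
  qed
  moreover have "u \<in> polyfuns (- {y})" "v \<in> polyfuns (- {y})"
    unfolding u_def v_def using 1 2 A E R by (auto intro!: polyfuns_intros)
  moreover have "w \<in> polyfuns UNIV"
    unfolding w_def using 1(1) 2(1) f
      A[THEN polyfuns_mono[of _ _ UNIV]] 1(2,3)[THEN polyfuns_mono[of _ _ UNIV]] 2(2,3)[THEN polyfuns_mono[of _ _ UNIV]]
    by (auto intro!: polyfuns_intros)
  ultimately show ?case by blast
qed

lemma complex_quadratic_roots: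
  fixes a b c :: complex
  assumes "a \<noteq> 0"
  obtains u v where "u + v = - b / a" "u * v = c / a"
proof
  define w where "w = csqrt (b\<^sup>2 - 4 * a * c)"
  have w: "w\<^sup>2 = b\<^sup>2 - 4 * a * c" by (simp add: w_def)
  let ?u = "(- b + w) / (2 * a)" and ?v = "(- b - w) / (2 * a)"
  show "?u + ?v = - b / a" using assms by (simp add: field_simps)
  have "?u * ?v = (b\<^sup>2 - w\<^sup>2) / (4 * a\<^sup>2)" using assms by (simp add: field_simps power2_eq_square)
  also have "\<dots> = c / a" unfolding w using assms by (simp add: field_simps power2_eq_square)
  finally show "?u * ?v = c / a" .
qed

text \<open>Here \<open>f\<close> is quadratic in the variable with index \<open>y\<close>.  Let \<open>\<alpha> + \<beta> y\<close> be the remainder of \<open>g\<close>.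
  Up to a power of the leading coefficient, the product of the values of \<open>g\<close> at the two roots is a
  polynomial \<open>M\<close> in the other variables, and \<open>gh = 0\<close> on the zeros of \<open>f\<close> forces \<open>M = 0\<close> for \<open>g\<close>
  or for \<open>h\<close>.  If \<open>M = 0\<close> for \<open>g\<close>, then \<open>\<beta>\<^sup>2\<close> times the discriminant is a square; comparing degrees
  in \<open>x\<^sub>v\<close>, where the discriminant has odd degree at every point with \<open>T \<noteq> 0\<close>, gives \<open>\<beta> = 0\<close>,
  so \<open>\<alpha> = 0\<close> and \<open>g\<close> vanishes on the zeros of \<open>f\<close>.\<close>

lemma prime_zeros_quadratic:
  assumes E: "E \<in> polyfuns (- {y})" and R: "R \<in> polyfuns (- {y})" and py: "p \<noteq> y"
    and f_eq: "\<And>x. f x = x p ^ e * x y ^ 2 + E x * x y + R x" and nz: "f x0 \<noteq> 0" "x0 p = 0"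
    and T: "T \<in> polyfuns J" "T x1 \<noteq> 0"
    and odd_disc: "\<And>x. T x \<noteq> 0 \<Longrightarrow> \<exists>d. odd (degree d) \<and>
      (\<forall>z. poly d z = (E (x(v := z)))\<^sup>2 - 4 * (x(v := z)) p ^ e * R (x(v := z)))"
  shows "prime_zeros f"
proof -
  define A :: "(nat \<Rightarrow> complex) \<Rightarrow> complex" where "A = (\<lambda>x. x p ^ e)"
  have A: "A \<in> polyfuns (- {y})" unfolding A_def using py by (intro polyfuns_intros) auto
  have fA: "f x = A x * x y ^ 2 + E x * x y + R x" for x by (simp add: A_def f_eq)
  have f: "f \<in> polyfuns UNIV"
    unfolding fA[abs_def] using polyfuns_mono[OF A] polyfuns_mono[OF E] polyfuns_mono[OF R]
    by (intro polyfuns_intros) auto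
  define \<Delta> where "\<Delta> = (\<lambda>x. (E x)\<^sup>2 - 4 * A x * R x)"
  have A_nz: "\<not> (\<forall>x. A x = 0)" by (auto simp: A_def intro: exI[of _ "\<lambda>_. 1"])
  have van: "\<forall>x. f x = 0 \<longrightarrow> g x = 0"
    if g: "g \<in> polyfuns UNIV" "q \<in> polyfuns UNIV" "a \<in> polyfuns (- {y})" "b \<in> polyfuns (- {y})"
      "\<And>x. A x ^ k * g x = q x * f x + a x + b x * x y"
      and N: "\<And>x. (a x)\<^sup>2 * A x - a x * b x * E x + (b x)\<^sup>2 * R x = 0" for g q a b k
  proof -
    define c where "c = (\<lambda>x. 2 * A x * a x - b x * E x)"
    have c: "c \<in> polyfuns (- {y})" unfolding c_def using A E g by (intro polyfuns_intros) auto
    have sq: "(c x)\<^sup>2 = (b x)\<^sup>2 * \<Delta> x" for x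
    proof -
      have "(c x)\<^sup>2 - (b x)\<^sup>2 * \<Delta> x = 4 * A x * ((a x)\<^sup>2 * A x - a x * b x * E x + (b x)\<^sup>2 * R x)"
        by (simp add: c_def \<Delta>_def algebra_simps power2_eq_square)
      then show ?thesis using N by simp
    qed
    have b0: "b x = 0" for x
    proof (rule ccontr)
      assume "b x \<noteq> 0"
      then obtain w where w: "b w \<noteq> 0" "T w \<noteq> 0"
        using polyfuns_no_zero_divisors[OF g(4) T(1)] T(2) by (metis mult_eq_0_iff)
      obtain d where d: "odd (degree d)" "\<And>z. poly d z = \<Delta> (w(v := z))"
        using odd_disc[OF w(2)] by (auto simp: \<Delta>_def A_def)
      obtain pb where pb: "\<And>z. b (w(v := z)) = poly pb z" using polyfuns_slice[OF g(4)] by metis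
      obtain pc where pc: "\<And>z. c (w(v := z)) = poly pc z" using polyfuns_slice[OF c] by metis
      have "poly (pc\<^sup>2) z = poly (pb\<^sup>2 * d) z" for z using sq[of "w(v := z)"] by (simp add: pb pc d)
      then have eq: "pc\<^sup>2 = pb\<^sup>2 * d" using poly_eq_poly_eq_iff by blast
      have "pb \<noteq> 0" using pb[of "w v"] w by auto
      moreover have "d \<noteq> 0" using d(1) by auto
      ultimately have "degree (pb\<^sup>2 * d) = 2 * degree pb + degree d"
        by (simp add: degree_mult_eq degree_power_eq)
      moreover have "degree (pc\<^sup>2) = 2 * degree pc"
        by (cases "pc = 0") (simp_all add: degree_power_eq)
      ultimately show False using eq d(1) by (metis even_add even_mult_iff even_numeral)
    qed
    have "A x * a x = 0" for x using sq[of x] b0 by (simp add: c_def)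
    then have a0: "a x = 0" for x using polyfuns_no_zero_divisors[OF A g(3)] A_nz by blast
    have "x p ^ (e * k) * g x = q x * f x" for x using g(5)[of x] by (simp add: A_def a0 b0 power_mult)
    then obtain q' where "\<And>x. g x = q' x * f x"
      using polyfuns_cancel_var[OF f g(1,2) _ nz] by blast
    then show ?thesis by simp
  qed
  show ?thesis
    unfolding prime_zeros_def
  proof (intro ballI impI)
    fix g h assume g: "g \<in> polyfuns UNIV" and h: "h \<in> polyfuns UNIV" and gh: "\<forall>x. f x = 0 \<longrightarrow> g x * h x = 0"
    obtain k q a b where 1: "q \<in> polyfuns UNIV" "a \<in> polyfuns (- {y})" "b \<in> polyfuns (- {y})"
        "\<And>x. A x ^ k * g x = q x * f x + a x + b x * x y"
      using quadratic_pseudo_division[OF f A E R fA g] by blast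
    obtain k' q' a' b' where 2: "q' \<in> polyfuns UNIV" "a' \<in> polyfuns (- {y})" "b' \<in> polyfuns (- {y})"
        "\<And>x. A x ^ k' * h x = q' x * f x + a' x + b' x * x y"
      using quadratic_pseudo_division[OF f A E R fA h] by blast
    define M where "M = (\<lambda>x. (a x)\<^sup>2 * A x - a x * b x * E x + (b x)\<^sup>2 * R x)"
    define M' where "M' = (\<lambda>x. (a' x)\<^sup>2 * A x - a' x * b' x * E x + (b' x)\<^sup>2 * R x)"
    have M: "M \<in> polyfuns (- {y})" "M' \<in> polyfuns (- {y})"
      unfolding M_def M'_def using 1 2 A E R by (auto intro!: polyfuns_intros)
    have "A x * (M x * M' x) = 0" for x
    proof (cases "A x = 0")
      case False
      obtain s t where st: "s + t = - E x / A x" "s * t = R x / A x"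
        using complex_quadratic_roots[OF False] by metis
      have ER: "E x = - A x * (s + t)" "R x = A x * (s * t)" using False st by (simp_all add: field_simps)
      have root: "(a x + b x * r) * (a' x + b' x * r) = 0" if "r = s \<or> r = t" for r
      proof -
        define x' where "x' = x(y := r)"
        have [simp]: "A x' = A x" "E x' = E x" "R x' = R x" "a x' = a x" "a' x' = a' x"
          "b x' = b x" "b' x' = b' x" "x' y = r"
          unfolding x'_def using A E R 1(2,3) 2(2,3) by (simp_all add: polyfuns_upd)
        have "f x' = A x * (r - s) * (r - t)" unfolding fA by (simp add: ER algebra_simps power2_eq_square)
        then have "f x' = 0" using that by auto
        then have "g x' * h x' = 0" using gh by blast
        then have "(A x ^ k * g x') * (A x ^ k' * h x') = 0" by (metis mult_eq_0_iff)
        moreover have "A x ^ k * g x' = a x + b x * r" "A x ^ k' * h x' = a' x + b' x * r"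
          using 1(4)[of x'] 2(4)[of x'] \<open>f x' = 0\<close> by simp_all
        ultimately show ?thesis by auto
      qed
      have Meq: "M x = A x * ((a x + b x * s) * (a x + b x * t))"
         "M' x = A x * ((a' x + b' x * s) * (a' x + b' x * t))"
        by (simp_all add: M_def M'_def ER algebra_simps power2_eq_square)
      have "M x * M' x = (A x)\<^sup>2 * ((a x + b x * s) * (a' x + b' x * s)) * ((a x + b x * t) * (a' x + b' x * t))"
        by (simp only: Meq power2_eq_square mult_ac)
      then show ?thesis using root[of s] by simp
    qed simp
    then have "(\<forall>x. A x = 0) \<or> (\<forall>x. M x * M' x = 0)"
      by (intro polyfuns_no_zero_divisors[of _ "- {y}" _ "- {y}"] A) (auto intro!: polyfuns_intros M)
    then have "(\<forall>x. M x = 0) \<or> (\<forall>x. M' x = 0)"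
      using polyfuns_no_zero_divisors[OF M] A_nz by blast
    then show "(\<forall>x. f x = 0 \<longrightarrow> g x = 0) \<or> (\<forall>x. f x = 0 \<longrightarrow> h x = 0)"
    proof
      assume "\<forall>x. M x = 0"
      then show ?thesis using van[OF g 1] unfolding M_def by blast
    next
      assume "\<forall>x. M' x = 0"
      then show ?thesis using van[OF h 2] unfolding M'_def by blast
    qed
  qed
qed

section \<open>Homogeneous polynomials and the Zariski topology\<close>

lemma monom_eval_mult: "monom_eval m (\<lambda>i. c i * x i) = monom_eval m c * monom_eval m x"
  by (simp add: monom_eval_def power_mult_distrib prod.distrib)

lemma monom_eval_weights:
  "monom_eval m (\<lambda>i. t ^ a i) = t ^ (\<Sum>i\<in>Poly_Mapping.keys m. a i * Poly_Mapping.lookup m i)"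
  by (simp add: monom_eval_def power_sum power_mult)

lemma whomogeneous_eval:
  assumes "whomogeneous a N d g"
  shows "peval g (\<lambda>i. t ^ a i * x i) = t ^ d * peval g x"
  using assms unfolding peval_monom_eval sum_distrib_left
  by (intro sum.cong) (auto simp: monom_eval_mult monom_eval_weights whomogeneous_def)

lemma whomogeneous_polyfuns: "whomogeneous a N d g \<Longrightarrow> peval g \<in> polyfuns {..N}"
  by (rule peval_polyfuns) (auto simp: whomogeneous_def)

lemma weight_superset:
  fixes a :: "nat \<Rightarrow> nat"
  assumes "finite S" "Poly_Mapping.keys m \<subseteq> S"
  shows "(\<Sum>i\<in>Poly_Mapping.keys m. a i * Poly_Mapping.lookup m i) = (\<Sum>i\<in>S. a i * Poly_Mapping.lookup m i)"
  using assms by (intro sum.mono_neutral_left) (auto simp: in_keys_iff)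

lemma weight_add:
  fixes a :: "nat \<Rightarrow> nat"
  shows "(\<Sum>i\<in>Poly_Mapping.keys (m + m'). a i * Poly_Mapping.lookup (m + m') i) =
    (\<Sum>i\<in>Poly_Mapping.keys m. a i * Poly_Mapping.lookup m i) +
    (\<Sum>i\<in>Poly_Mapping.keys m'. a i * Poly_Mapping.lookup m' i)"
proof -
  let ?S = "Poly_Mapping.keys m \<union> Poly_Mapping.keys m'"
  have "(\<Sum>i\<in>Poly_Mapping.keys (m + m'). a i * Poly_Mapping.lookup (m + m') i)
    = (\<Sum>i\<in>?S. a i * Poly_Mapping.lookup (m + m') i)"
    by (intro weight_superset keys_add) auto
  then show ?thesis
    by (simp add: lookup_add algebra_simps sum.distrib weight_superset[of ?S m] weight_superset[of ?S m'])
qed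

lemma whomogeneous_mult:
  assumes "whomogeneous a N d g" "whomogeneous a N d' h"
  shows "whomogeneous a N (d + d') (g * h)"
  unfolding whomogeneous_def
proof (intro ballI)
  fix m assume "m \<in> Poly_Mapping.keys (g * h)"
  then obtain u v where m: "m = u + v" "u \<in> Poly_Mapping.keys g" "v \<in> Poly_Mapping.keys h"
    using keys_mult by blast
  have u: "Poly_Mapping.keys u \<subseteq> {..N}" "(\<Sum>i\<in>Poly_Mapping.keys u. a i * Poly_Mapping.lookup u i) = d"
    and v: "Poly_Mapping.keys v \<subseteq> {..N}" "(\<Sum>i\<in>Poly_Mapping.keys v. a i * Poly_Mapping.lookup v i) = d'"
    using assms m by (auto simp: whomogeneous_def)
  show "Poly_Mapping.keys m \<subseteq> {..N} \<and>
     (\<Sum>i\<in>Poly_Mapping.keys m. a i * Poly_Mapping.lookup m i) = d + d'"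
    using keys_add[of u v] u(1) v(1) unfolding m(1) weight_add u(2) v(2) by blast
qed

lemma whomogeneous_one: "whomogeneous a N 0 1"
  by (simp add: whomogeneous_def)

lemma whomogeneous_xpow: "i \<le> N \<Longrightarrow> whomogeneous a N (a i * e) (xpow i e)"
  by (auto simp: whomogeneous_def xpow_def)

lemma Gm_orbit_self: "x \<in> Gm_orbit a x"
  unfolding Gm_orbit_def by (auto intro: exI[of _ 1])

lemma Gm_orbit_eq:
  assumes "y \<in> Gm_orbit a x"
  shows "Gm_orbit a y = Gm_orbit a x"
proof -
  obtain t where t: "t \<noteq> 0" "y = (\<lambda>i. t ^ a i * x i)" using assms by (auto simp: Gm_orbit_def)
  have "(\<lambda>i. s ^ a i * y i) = (\<lambda>i. (s * t) ^ a i * x i)" for s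
    by (simp add: t power_mult_distrib mult_ac)
  moreover have "(\<lambda>i. s ^ a i * x i) = (\<lambda>i. (s / t) ^ a i * y i)" for s
    using t by (simp add: power_divide)
  ultimately show ?thesis
    unfolding Gm_orbit_def using t(1) by (intro equalityI subsetI; clarify)
      (metis mult_eq_0_iff, metis divide_eq_0_iff)
qed

lemma wproj_rep:
  assumes "P \<in> wproj a N" "x \<in> P"
  shows "P = Gm_orbit a x" "x \<in> affine_space N" "x \<noteq> (\<lambda>_. 0)"
proof -
  obtain y where y: "P = Gm_orbit a y" "y \<in> affine_space N" "y \<noteq> (\<lambda>_. 0)"
    using assms(1) by (auto simp: wproj_def)
  then obtain t where t: "t \<noteq> 0" "x = (\<lambda>i. t ^ a i * y i)" using assms(2) by (auto simp: Gm_orbit_def)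
  show "P = Gm_orbit a x" using Gm_orbit_eq y(1) assms(2) by blast
  show "x \<in> affine_space N" using y t by (auto simp: affine_space_def)
  show "x \<noteq> (\<lambda>_. 0)" using y(3) t by (auto simp: fun_eq_iff)
qed

lemma wproj_nonempty: "P \<in> wproj a N \<Longrightarrow> \<exists>x. x \<in> P"
  unfolding wproj_def using Gm_orbit_self by auto

lemma wprojI: "x \<in> affine_space N \<Longrightarrow> x \<noteq> (\<lambda>_. 0) \<Longrightarrow> Gm_orbit a x \<in> wproj a N"
  by (auto simp: wproj_def)

lemma wproj_scale:
  assumes "P \<in> wproj a N" "x \<in> P" "y \<in> P"
  obtains t where "t \<noteq> 0" "y = (\<lambda>i. t ^ a i * x i)"
  using assms wproj_rep(1)[OF assms(1,2)] by (auto simp: Gm_orbit_def)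

lemma peval_zero_rep_indep:
  assumes "whomogeneous a N d g" "P \<in> wproj a N" "x \<in> P" "y \<in> P"
  shows "peval g y = 0 \<longleftrightarrow> peval g x = 0"
  by (rule wproj_scale[OF assms(2-4)]) (simp add: whomogeneous_eval[OF assms(1)])

lemma quotient_rep_indep:
  assumes "whomogeneous a N d f" "whomogeneous a N d g" "P \<in> wproj a N" "x \<in> P" "y \<in> P"
  shows "peval f y / peval g y = peval f x / peval g x"
  by (rule wproj_scale[OF assms(3-5)])
    (simp add: whomogeneous_eval[OF assms(1)] whomogeneous_eval[OF assms(2)])

text \<open>The basic open set \<open>g \<noteq> 0\<close>.\<close>

definition basic_open :: "(nat \<Rightarrow> nat) \<Rightarrow> nat \<Rightarrow> cpoly \<Rightarrow> wpoint set" where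
  "basic_open a N g = {P \<in> wproj a N. \<forall>x\<in>P. peval g x \<noteq> 0}"

lemma basic_open_mult: "basic_open a N (g * h) = basic_open a N g \<inter> basic_open a N h"
  by (auto simp: basic_open_def peval_mult)

lemma openin_basic_open: "whomogeneous a N d g \<Longrightarrow> openin (zariski a N) (basic_open a N g)"
  unfolding zariski_def basic_open_def by (rule topology_generated_by_Basis) auto

lemma topspace_zariski [simp]: "topspace (zariski a N) = wproj a N"
proof -
  have "wproj a N \<in> {{P \<in> wproj a N. \<forall>x\<in>P. peval g x \<noteq> 0} | g. \<exists>d. whomogeneous a N d g}"
    using whomogeneous_one[of a N] by (intro CollectI exI[of _ 1]) auto
  then show ?thesis unfolding zariski_def topology_generated_by_topspace by blast
qed

lemma zariski_on_wproj: "zariski_on a N (wproj a N) = zariski a N"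
  using subtopology_topspace[of "zariski a N"] by simp

text \<open>The basic open sets form a basis and not only a subbasis, because products of homogeneous
  polynomials are homogeneous.\<close>

lemma openin_zariski:
  "openin (zariski a N) U \<longleftrightarrow> U \<subseteq> wproj a N \<and>
     (\<forall>P\<in>U. \<exists>g d. whomogeneous a N d g \<and> P \<in> basic_open a N g \<and> basic_open a N g \<subseteq> U)"
  (is "_ \<longleftrightarrow> _ \<and> ?R U")
proof
  assume U: "openin (zariski a N) U"
  then have "generate_topology_on {{P \<in> wproj a N. \<forall>x\<in>P. peval g x \<noteq> 0} | g. \<exists>d. whomogeneous a N d g} U"
    by (simp add: zariski_def openin_topology_generated_by_iff)
  then have "?R U"
  proof (induction rule: generate_topology_on.induct)
    case (Int A B)
    show ?case
    proof
      fix P assume "P \<in> A \<inter> B"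
      then obtain g d h d' where "whomogeneous a N d g" "P \<in> basic_open a N g" "basic_open a N g \<subseteq> A"
        "whomogeneous a N d' h" "P \<in> basic_open a N h" "basic_open a N h \<subseteq> B"
        using Int.IH by (metis IntD1 IntD2)
      then show "\<exists>g d. whomogeneous a N d g \<and> P \<in> basic_open a N g \<and> basic_open a N g \<subseteq> A \<inter> B"
        using whomogeneous_mult by (intro exI[of _ "g * h"] exI[of _ "d + d'"]) (auto simp: basic_open_mult)
    qed
  next
    case (UN K)
    show ?case
    proof
      fix P assume "P \<in> \<Union>K"
      then obtain k where k: "k \<in> K" "P \<in> k" by blast
      then obtain g d where "whomogeneous a N d g" "P \<in> basic_open a N g" "basic_open a N g \<subseteq> k"
        using UN.IH by metis
      then show "\<exists>g d. whomogeneous a N d g \<and> P \<in> basic_open a N g \<and> basic_open a N g \<subseteq> \<Union>K"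
        using k(1) by blast
    qed
  next
    case (Basis s)
    then show ?case unfolding basic_open_def by blast
  qed simp
  then show "U \<subseteq> wproj a N \<and> ?R U" using openin_subset[OF U] by simp
next
  assume R: "U \<subseteq> wproj a N \<and> ?R U"
  have "U = \<Union>{B. openin (zariski a N) B \<and> B \<subseteq> U}"
  proof (intro equalityI subsetI)
    fix P assume "P \<in> U"
    then show "P \<in> \<Union>{B. openin (zariski a N) B \<and> B \<subseteq> U}" using R openin_basic_open by blast
  qed blast
  moreover have "openin (zariski a N) (\<Union>{B. openin (zariski a N) B \<and> B \<subseteq> U})"
    by (rule openin_Union) blast
  ultimately show "openin (zariski a N) U" by simp
qed

lemma closedin_hypersurface:
  assumes "whomogeneous a N d f"
  shows "closedin (zariski a N) (hypersurface a N f)"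
proof -
  have "wproj a N - hypersurface a N f = basic_open a N f"
  proof (intro equalityI subsetI)
    fix P assume P: "P \<in> wproj a N - hypersurface a N f"
    then obtain x where "x \<in> P" "peval f x \<noteq> 0" by (auto simp: hypersurface_def)
    then show "P \<in> basic_open a N f"
      using P peval_zero_rep_indep[OF assms] unfolding basic_open_def by blast
  next
    fix P assume "P \<in> basic_open a N f"
    then show "P \<in> wproj a N - hypersurface a N f"
      using wproj_nonempty unfolding basic_open_def hypersurface_def by fastforce
  qed
  then show ?thesis
    using openin_basic_open[OF assms] by (auto simp: closedin_def hypersurface_def)
qed

text \<open>Irreducibility only has to be tested on basic closed sets.\<close>

lemma irreducible_closedin_zariskiI:
  assumes X: "closedin (zariski a N) X" "X \<noteq> {}"
    and prime: "\<And>g h d d'. whomogeneous a N d g \<Longrightarrow> whomogeneous a N d' h \<Longrightarrow>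
      (\<forall>P\<in>X. \<forall>x\<in>P. peval g x * peval h x = 0) \<Longrightarrow>
      (\<forall>P\<in>X. \<forall>x\<in>P. peval g x = 0) \<or> (\<forall>P\<in>X. \<forall>x\<in>P. peval h x = 0)"
  shows "irreducible_closedin (zariski a N) X"
  unfolding irreducible_closedin_def
proof (intro conjI X allI impI)
  fix A B assume AB: "closedin (zariski a N) A \<and> closedin (zariski a N) B \<and> X \<subseteq> A \<union> B"
  show "X \<subseteq> A \<or> X \<subseteq> B"
  proof (rule ccontr)
    assume "\<not> (X \<subseteq> A \<or> X \<subseteq> B)"
    then obtain P Q where PQ: "P \<in> X" "P \<notin> A" "Q \<in> X" "Q \<notin> B" by blast
    have Xw: "X \<subseteq> wproj a N" using closedin_subset[OF X(1)] by simp
    have open_AB: "openin (zariski a N) (wproj a N - A)" "openin (zariski a N) (wproj a N - B)"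
      using AB by (simp_all add: closedin_def)
    obtain g d where g: "whomogeneous a N d g" "P \<in> basic_open a N g" "basic_open a N g \<subseteq> wproj a N - A"
      using open_AB(1) PQ Xw unfolding openin_zariski by (metis DiffI subsetD)
    obtain h d' where h: "whomogeneous a N d' h" "Q \<in> basic_open a N h" "basic_open a N h \<subseteq> wproj a N - B"
      using open_AB(2) PQ Xw unfolding openin_zariski by (metis DiffI subsetD)
    have "peval g x * peval h x = 0" if "R \<in> X" "x \<in> R" for R x
    proof (rule ccontr)
      assume "peval g x * peval h x \<noteq> 0"
      then have nz: "peval g x \<noteq> 0" "peval h x \<noteq> 0" by auto
      have R: "R \<in> wproj a N" using that(1) Xw by blast
      have "R \<in> basic_open a N g" "R \<in> basic_open a N h"
        unfolding basic_open_def
        using R nz peval_zero_rep_indep[OF g(1) R that(2)] peval_zero_rep_indep[OF h(1) R that(2)] by simp_all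
      then show False using g(3) h(3) AB that by blast
    qed
    then have "(\<forall>P\<in>X. \<forall>x\<in>P. peval g x = 0) \<or> (\<forall>P\<in>X. \<forall>x\<in>P. peval h x = 0)"
      using prime[OF g(1) h(1)] by blast
    moreover have "\<exists>x\<in>P. peval g x \<noteq> 0" "\<exists>x\<in>Q. peval h x \<noteq> 0"
      using g(2) h(2) wproj_nonempty[of P a N] wproj_nonempty[of Q a N] by (auto simp: basic_open_def)
    ultimately show False using PQ(1,3) by blast
  qed
qed

lemma irreducible_closedin_subtopology:
  assumes "irreducible_closedin T C" "C \<subseteq> V" "closedin T V"
  shows "irreducible_closedin (subtopology T V) C"
  using assms unfolding irreducible_closedin_def closedin_closed_subtopology[OF assms(3)] by blast

text \<open>One irreducible closed set between \<open>W\<close> and \<open>V\<close> gives a chain of length two that starts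
  with \<open>W\<close>, which bounds the codimension from below without any dimension theory.\<close>

lemma codim_ge_2I:
  assumes V: "irreducible_closedin T V"
    and mid: "\<And>W. irreducible_closedin T W \<Longrightarrow> W \<subseteq> Z \<Longrightarrow> \<exists>C. irreducible_closedin T C \<and> W \<subset> C \<and> C \<subset> V"
  shows "2 \<le> codim T Z"
  unfolding codim_def
proof (rule INF_greatest)
  fix W assume "W \<in> {W. irreducible_closedin T W \<and> W \<subseteq> Z}"
  then have W: "irreducible_closedin T W" "W \<subseteq> Z" by auto
  obtain C where C: "irreducible_closedin T C" "W \<subset> C" "C \<subset> V"
    using mid[OF W] by blast
  define K where "K = (\<lambda>i::nat. if i = 0 then W else if i = 1 then C else V)"
  have "K 0 = W \<and> (\<forall>i\<le>2. irreducible_closedin T (K i)) \<and> (\<forall>i<2. K i \<subset> K (Suc i))"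
    using W C V by (auto simp: K_def less_Suc_eq numeral_2_eq_2)
  then have "enat 2 \<in> {enat k | k. \<exists>C. C 0 = W \<and> (\<forall>i\<le>k. irreducible_closedin T (C i)) \<and>
      (\<forall>i<k. C i \<subset> C (Suc i))}" by blast
  then have "enat 2 \<le> codim_irreducible T W" unfolding codim_irreducible_def by (rule Sup_upper)
  then show "2 \<le> codim_irreducible T W" by (simp add: numeral_eq_enat)
qed

section \<open>Regular functions and smooth points\<close>

lemma regular_on_open: "regular_on a N X U h \<Longrightarrow> openin (zariski_on a N X) U"
  by (simp add: regular_on_def)

lemma regular_on_quotient:
  assumes "openin (zariski_on a N X) U" "whomogeneous a N d f" "whomogeneous a N d g"
    and "\<And>Q x. Q \<in> U \<Longrightarrow> x \<in> Q \<Longrightarrow> peval g x \<noteq> 0 \<and> h Q = peval f x / peval g x"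
  shows "regular_on a N X U h"
  unfolding regular_on_def using assms by blast

lemma regular_on_subset:
  assumes h: "regular_on a N X U h" and U': "openin (zariski_on a N X) U'" "U' \<subseteq> U"
  shows "regular_on a N X U' h"
  unfolding regular_on_def
proof (intro conjI ballI U')
  fix P assume "P \<in> U'"
  then obtain W f g d where W: "openin (zariski_on a N X) W" "P \<in> W"
    "whomogeneous a N d f" "whomogeneous a N d g" "\<forall>Q\<in>W. \<forall>x\<in>Q. peval g x \<noteq> 0 \<and> h Q = peval f x / peval g x"
    using h U'(2) unfolding regular_on_def by blast
  have "openin (zariski_on a N X) (W \<inter> U')" "P \<in> W \<inter> U'" "W \<inter> U' \<subseteq> U'"
    using W U' \<open>P \<in> U'\<close> by auto
  moreover have "\<forall>Q\<in>W \<inter> U'. \<forall>x\<in>Q. peval g x \<noteq> 0 \<and> h Q = peval f x / peval g x" using W(5) by blast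
  ultimately show "\<exists>U'' f g d. openin (zariski_on a N X) U'' \<and> P \<in> U'' \<and> U'' \<subseteq> U' \<and>
        whomogeneous a N d f \<and> whomogeneous a N d g \<and>
        (\<forall>Q\<in>U''. \<forall>x\<in>Q. peval g x \<noteq> 0 \<and> h Q = peval f x / peval g x)"
    using W(3,4) by blast
qed

lemma whomogeneous_add: "whomogeneous a N d f \<Longrightarrow> whomogeneous a N d g \<Longrightarrow> whomogeneous a N d (f + g)"
  using keys_add[of f g] unfolding whomogeneous_def by blast

lemma whomogeneous_const: "whomogeneous a N 0 (Poly_Mapping.single 0 c)"
  by (simp add: whomogeneous_def)

lemma regular_on_const:
  assumes "openin (zariski_on a N X) U"
  shows "regular_on a N X U (\<lambda>_. c)"
  by (rule regular_on_quotient[OF assms whomogeneous_const[of a N c] whomogeneous_one])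
    (simp add: peval_single)

text \<open>The common part of the closure of regular functions under sums and products: locally both
  arguments are quotients, and \<open>g g'\<close> is a common denominator.\<close>

lemma regular_on_binop:
  assumes h: "regular_on a N X U h" and k: "regular_on a N X U k"
    and op: "\<And>d d' f g f' g'. whomogeneous a N d f \<Longrightarrow> whomogeneous a N d g \<Longrightarrow>
      whomogeneous a N d' f' \<Longrightarrow> whomogeneous a N d' g' \<Longrightarrow>
      \<exists>F. whomogeneous a N (d + d') F \<and> (\<forall>x. peval g x \<noteq> 0 \<longrightarrow> peval g' x \<noteq> 0 \<longrightarrow>
        op (peval f x / peval g x) (peval f' x / peval g' x) = peval F x / (peval g x * peval g' x))"
  shows "regular_on a N X U (\<lambda>Q. op (h Q) (k Q))"
  unfolding regular_on_def
proof (intro conjI ballI regular_on_open[OF h])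
  fix P assume P: "P \<in> U"
  obtain W f g d where W: "openin (zariski_on a N X) W" "P \<in> W" "W \<subseteq> U"
    "whomogeneous a N d f" "whomogeneous a N d g" "\<forall>Q\<in>W. \<forall>x\<in>Q. peval g x \<noteq> 0 \<and> h Q = peval f x / peval g x"
    using h P unfolding regular_on_def by blast
  obtain W' f' g' d' where W': "openin (zariski_on a N X) W'" "P \<in> W'" "W' \<subseteq> U"
    "whomogeneous a N d' f'" "whomogeneous a N d' g'" "\<forall>Q\<in>W'. \<forall>x\<in>Q. peval g' x \<noteq> 0 \<and> k Q = peval f' x / peval g' x"
    using k P unfolding regular_on_def by blast
  obtain F where F: "whomogeneous a N (d + d') F" "\<forall>x. peval g x \<noteq> 0 \<longrightarrow> peval g' x \<noteq> 0 \<longrightarrow>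
        op (peval f x / peval g x) (peval f' x / peval g' x) = peval F x / (peval g x * peval g' x)"
    using op[OF W(4,5) W'(4,5)] by blast
  have "openin (zariski_on a N X) (W \<inter> W')" "P \<in> W \<inter> W'" "W \<inter> W' \<subseteq> U"
    using W W' by auto
  moreover have "\<forall>Q\<in>W \<inter> W'. \<forall>x\<in>Q. peval (g * g') x \<noteq> 0 \<and> op (h Q) (k Q) = peval F x / peval (g * g') x"
  proof (intro ballI)
    fix Q x assume "Q \<in> W \<inter> W'" "x \<in> Q"
    then have "peval g x \<noteq> 0" "h Q = peval f x / peval g x" "peval g' x \<noteq> 0" "k Q = peval f' x / peval g' x"
      using W(6) W'(6) by blast+
    then show "peval (g * g') x \<noteq> 0 \<and> op (h Q) (k Q) = peval F x / peval (g * g') x"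
      using F(2) by (simp add: peval_mult)
  qed
  ultimately show "\<exists>U' f g d. openin (zariski_on a N X) U' \<and> P \<in> U' \<and> U' \<subseteq> U \<and>
        whomogeneous a N d f \<and> whomogeneous a N d g \<and>
        (\<forall>Q\<in>U'. \<forall>x\<in>Q. peval g x \<noteq> 0 \<and> op (h Q) (k Q) = peval f x / peval g x)"
    using F(1) whomogeneous_mult[OF W(5) W'(5)] by blast
qed

lemma regular_on_add:
  assumes "regular_on a N X U h" "regular_on a N X U k"
  shows "regular_on a N X U (\<lambda>Q. h Q + k Q)"
proof (rule regular_on_binop[OF assms])
  fix d d' f g f' g' assume "whomogeneous a N d f" "whomogeneous a N d g"
      "whomogeneous a N d' f'" "whomogeneous a N d' g'"
  then have "whomogeneous a N (d + d') (f * g' + g * f')" by (intro whomogeneous_add whomogeneous_mult)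
  then show "\<exists>F. whomogeneous a N (d + d') F \<and> (\<forall>x. peval g x \<noteq> 0 \<longrightarrow> peval g' x \<noteq> 0 \<longrightarrow>
        peval f x / peval g x + peval f' x / peval g' x = peval F x / (peval g x * peval g' x))"
    by (intro exI[of _ "f * g' + g * f'"]) (auto simp: peval_add peval_mult field_simps)
qed

lemma regular_on_mult:
  assumes "regular_on a N X U h" "regular_on a N X U k"
  shows "regular_on a N X U (\<lambda>Q. h Q * k Q)"
proof (rule regular_on_binop[OF assms])
  fix d d' f g f' g' assume "whomogeneous a N d f" "whomogeneous a N d g"
      "whomogeneous a N d' f'" "whomogeneous a N d' g'"
  then have "whomogeneous a N (d + d') (f * f')" by (intro whomogeneous_mult)
  then show "\<exists>F. whomogeneous a N (d + d') F \<and> (\<forall>x. peval g x \<noteq> 0 \<longrightarrow> peval g' x \<noteq> 0 \<longrightarrow>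
        peval f x / peval g x * (peval f' x / peval g' x) = peval F x / (peval g x * peval g' x))"
    by (intro exI[of _ "f * f'"]) (auto simp: peval_mult)
qed

text \<open>On the open set \<open>x\<^sub>j \<noteq> 0\<close>, where \<open>x\<^sub>j\<close> has weight one, the functions
  \<open>x\<^sub>i / x\<^sub>j\<^sup>a\<close> with \<open>a = a\<^sub>i\<close> are affine coordinates.\<close>

definition affine_coord :: "(nat \<Rightarrow> nat) \<Rightarrow> nat \<Rightarrow> wpoint \<Rightarrow> nat \<Rightarrow> complex" where
  "affine_coord a j Q i = (let x = (SOME x. x \<in> Q) in x i / x j ^ a i)"

lemma affine_coord:
  assumes "a j = 1" "Q \<in> wproj a N" "x \<in> Q" "x j \<noteq> 0"
  shows "affine_coord a j Q i = x i / x j ^ a i"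
proof -
  define y where "y = (SOME x. x \<in> Q)"
  have "y \<in> Q" unfolding y_def by (rule someI[of "\<lambda>x. x \<in> Q", OF assms(3)])
  then obtain t where t: "t \<noteq> 0" "y = (\<lambda>i. t ^ a i * x i)" using wproj_scale[OF assms(2,3)] by blast
  then have "y i / y j ^ a i = x i / x j ^ a i"
    using assms(1) by (simp add: power_mult_distrib)
  then show ?thesis by (simp add: affine_coord_def y_def[symmetric])
qed

lemma peval_affine_coord:
  assumes "whomogeneous a N d f" "a j = 1" "Q \<in> wproj a N" "x \<in> Q" "x j \<noteq> 0"
  shows "peval f x = x j ^ d * peval f (affine_coord a j Q)"
proof -
  have "x = (\<lambda>i. x j ^ a i * affine_coord a j Q i)"
    using assms(5) by (simp add: affine_coord[OF assms(2-5)])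
  then have "peval f x = peval f (\<lambda>i. x j ^ a i * affine_coord a j Q i)" by simp
  then show ?thesis by (simp add: whomogeneous_eval[OF assms(1)])
qed

text \<open>A polynomial \<open>g\<close> in the affine coordinates is regular, and \<open>g - g(P)\<close> is a combination of
  the functions \<open>y\<^sub>i - y\<^sub>i(P)\<close> with regular coefficients.  Both statements are proved by one induction
  because the coefficients for a product involve the factors.\<close>

lemma polyfuns_affine_coord:
  assumes j: "j \<le> N" "a j = 1" and P: "P \<in> U" and U: "U = basic_open a N (xpow j 1)"
    and g: "g \<in> polyfuns {..N}"
  defines "y \<equiv> affine_coord a j"
  shows "regular_on a N (wproj a N) U (\<lambda>Q. g (y Q)) \<and>
    (\<exists>c. (\<forall>i\<in>{..N} - {j}. regular_on a N (wproj a N) U (c i)) \<and>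
      (\<forall>Q\<in>U. g (y Q) = g (y P) + (\<Sum>i\<in>{..N} - {j}. c i Q * (y Q i - y P i))))"
proof -
  have openU: "openin (zariski_on a N (wproj a N)) U"
    unfolding zariski_on_wproj U by (rule openin_basic_open[OF whomogeneous_xpow[OF j(1)]])
  have yU: "y Q i = x i / x j ^ a i" and nz: "x j \<noteq> 0" if "Q \<in> U" "x \<in> Q" for Q x i
    using that affine_coord[of a j Q N x i] j(2) by (auto simp: y_def U basic_open_def peval_xpow)
  note reg = regular_on_const[OF openU] regular_on_add regular_on_mult
  from g show ?thesis
  proof (induction rule: polyfuns.induct)
    case (const c)
    then show ?case using reg by (intro conjI exI[of _ "\<lambda>_ _. 0"]) auto
  next
    case (var i)
    have "regular_on a N (wproj a N) U (\<lambda>Q. y Q i)"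
      using whomogeneous_xpow[of i N a 1] whomogeneous_xpow[of j N a "a i"] j var
      by (intro regular_on_quotient[OF openU, of "a i" "xpow i 1" "xpow j (a i)"])
        (auto simp: peval_xpow yU nz)
    moreover have "\<exists>c. (\<forall>k\<in>{..N} - {j}. regular_on a N (wproj a N) U (c k)) \<and>
      (\<forall>Q\<in>U. y Q i = y P i + (\<Sum>k\<in>{..N} - {j}. c k Q * (y Q k - y P k)))"
    proof (cases "i = j")
      case True
      have "y Q j = 1" if "Q \<in> U" for Q
      proof -
        have "Q \<in> wproj a N" using that by (auto simp: U basic_open_def)
        then obtain x where "x \<in> Q" using wproj_nonempty by blast
        then show ?thesis using yU[OF that, of x j] nz[OF that, of x] j by simp
      qed
      then show ?thesis using reg P True by (intro exI[of _ "\<lambda>_ _. 0"]) auto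
    next
      case False
      show ?thesis
      proof (intro exI[of _ "\<lambda>k _. if k = i then 1 else 0"] conjI ballI)
        fix Q assume "Q \<in> U"
        have "(\<Sum>k\<in>{..N} - {j}. (if k = i then 1 else 0) * (y Q k - y P k))
          = (\<Sum>k\<in>{..N} - {j}. if k = i then y Q k - y P k else 0)" by (intro sum.cong) auto
        also have "\<dots> = y Q i - y P i" using False var by simp
        finally show "y Q i = y P i + (\<Sum>k\<in>{..N} - {j}. (if k = i then 1 else 0) * (y Q k - y P k))" by simp
      qed (auto intro: reg)
    qed
    ultimately show ?case ..
  next
    case (add g h)
    then obtain c c' where c: "\<forall>i\<in>{..N} - {j}. regular_on a N (wproj a N) U (c i)"
      "\<forall>i\<in>{..N} - {j}. regular_on a N (wproj a N) U (c' i)"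
      "\<And>Q. Q \<in> U \<Longrightarrow> g (y Q) = g (y P) + (\<Sum>i\<in>{..N} - {j}. c i Q * (y Q i - y P i))"
      "\<And>Q. Q \<in> U \<Longrightarrow> h (y Q) = h (y P) + (\<Sum>i\<in>{..N} - {j}. c' i Q * (y Q i - y P i))" by blast
    have "g (y Q) + h (y Q) = g (y P) + h (y P) + (\<Sum>i\<in>{..N} - {j}. (c i Q + c' i Q) * (y Q i - y P i))"
      if "Q \<in> U" for Q
      unfolding c(3)[OF that] c(4)[OF that] by (simp add: distrib_right sum.distrib)
    moreover have "\<forall>i\<in>{..N} - {j}. regular_on a N (wproj a N) U (\<lambda>Q. c i Q + c' i Q)"
      using c(1,2) reg(2) by blast
    ultimately have "\<exists>c. (\<forall>i\<in>{..N} - {j}. regular_on a N (wproj a N) U (c i)) \<and>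
      (\<forall>Q\<in>U. g (y Q) + h (y Q) = g (y P) + h (y P) + (\<Sum>i\<in>{..N} - {j}. c i Q * (y Q i - y P i)))"
      by (intro exI[of _ "\<lambda>i Q. c i Q + c' i Q"]) blast
    then show ?case using add.IH reg(2) by blast
  next
    case (mult g h)
    then obtain c c' where c: "\<forall>i\<in>{..N} - {j}. regular_on a N (wproj a N) U (c i)"
      "\<forall>i\<in>{..N} - {j}. regular_on a N (wproj a N) U (c' i)"
      "\<And>Q. Q \<in> U \<Longrightarrow> g (y Q) = g (y P) + (\<Sum>i\<in>{..N} - {j}. c i Q * (y Q i - y P i))"
      "\<And>Q. Q \<in> U \<Longrightarrow> h (y Q) = h (y P) + (\<Sum>i\<in>{..N} - {j}. c' i Q * (y Q i - y P i))" by blast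
    have "g (y Q) * h (y Q) = g (y P) * h (y P) +
      (\<Sum>i\<in>{..N} - {j}. (g (y Q) * c' i Q + h (y P) * c i Q) * (y Q i - y P i))" if "Q \<in> U" for Q
    proof -
      have "(\<Sum>i\<in>{..N} - {j}. (g (y Q) * c' i Q + h (y P) * c i Q) * (y Q i - y P i))
        = g (y Q) * (\<Sum>i\<in>{..N} - {j}. c' i Q * (y Q i - y P i))
          + h (y P) * (\<Sum>i\<in>{..N} - {j}. c i Q * (y Q i - y P i))"
        by (simp add: sum_distrib_left sum.distrib distrib_right mult.assoc)
      also have "\<dots> = g (y Q) * (h (y Q) - h (y P)) + h (y P) * (g (y Q) - g (y P))"
        using c(3)[OF that] c(4)[OF that] by simp
      finally show ?thesis by (simp add: algebra_simps)
    qed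
    moreover have "\<forall>i\<in>{..N} - {j}. regular_on a N (wproj a N) U (\<lambda>Q. g (y Q) * c' i Q + h (y P) * c i Q)"
      using c(1,2) mult.IH by (auto intro!: reg)
    ultimately have "\<exists>c. (\<forall>i\<in>{..N} - {j}. regular_on a N (wproj a N) U (c i)) \<and>
      (\<forall>Q\<in>U. g (y Q) * h (y Q) = g (y P) * h (y P) + (\<Sum>i\<in>{..N} - {j}. c i Q * (y Q i - y P i)))"
      by (intro exI[of _ "\<lambda>i Q. g (y Q) * c' i Q + h (y P) * c i Q"]) blast
    then show ?case using mult.IH reg(3) by blast
  qed
qed

lemma smooth_point_weight_one:
  assumes j: "j \<le> N" "a j = 1" and P: "P \<in> wproj a N" "p \<in> P" "p j \<noteq> 0"
  shows "max_ideal_generated_by a N (wproj a N) P N"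
proof -
  define X where "X = wproj a N"
  define U where "U = basic_open a N (xpow j 1)"
  define y where "y = affine_coord a j"
  \<comment> \<open>\<open>\<rho>\<close> enumerates the indices other than \<open>j\<close>\<close>
  define \<rho> where "\<rho> = (\<lambda>i. if i < j then i else Suc i)"
  have \<rho>: "bij_betw \<rho> {..<N} ({..N} - {j})"
    by (rule bij_betw_byWitness[of _ "\<lambda>i. if i < j then i else i - 1"]) (use j in \<open>auto simp: \<rho>_def\<close>)
  have reindex: "(\<Sum>i\<in>{..N} - {j}. F i) = (\<Sum>i<N. F (\<rho> i))" for F :: "nat \<Rightarrow> complex"
    by (rule sum.reindex_bij_betw[OF \<rho>, symmetric])
  have xj: "whomogeneous a N 1 (xpow j 1)" using whomogeneous_xpow[OF j(1), of a 1] j by simp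
  have T: "zariski_on a N X = zariski a N" by (simp add: X_def zariski_on_wproj)
  have openU: "openin (zariski_on a N X) U" unfolding T U_def by (rule openin_basic_open[OF xj])
  have PU: "P \<in> U"
    using P peval_zero_rep_indep[OF xj P(1,2)] by (auto simp: U_def basic_open_def peval_xpow)
  have nz: "x j \<noteq> 0" "Q \<in> wproj a N" if "Q \<in> U" "x \<in> Q" for Q x
    using that by (auto simp: U_def basic_open_def peval_xpow)
  note coord = polyfuns_affine_coord[OF j PU U_def, folded X_def y_def]
  define t where "t = (\<lambda>i Q. y Q (\<rho> i) - y P (\<rho> i))"
  have \<rho>_in: "\<rho> i \<in> {..N} - {j}" if "i < N" for i using \<rho> that by (auto simp: bij_betw_def)
  have reg_t: "regular_on a N X U (t i)" if "i < N" for i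
  proof -
    have "(\<lambda>x. x (\<rho> i) - y P (\<rho> i)) \<in> polyfuns {..N}"
      using \<rho>_in[OF that] by (intro polyfuns_intros) auto
    from coord[OF this] show ?thesis unfolding t_def by blast
  qed
  show ?thesis
    unfolding max_ideal_generated_by_def X_def[symmetric]
  proof (rule exI[of _ U], rule exI[of _ t], intro conjI allI impI PU openU)
    show "regular_on a N X U (t i)" "t i P = 0" if "i < N" for i using reg_t[OF that] by (simp_all add: t_def)
  next
    fix U' h assume h: "P \<in> U' \<and> regular_on a N X U' h \<and> h P = 0"
    then obtain W f g d where W: "openin (zariski_on a N X) W" "P \<in> W" "W \<subseteq> U'"
        "whomogeneous a N d f" "whomogeneous a N d g"
        "\<And>Q x. Q \<in> W \<Longrightarrow> x \<in> Q \<Longrightarrow> peval g x \<noteq> 0 \<and> h Q = peval f x / peval g x"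
      unfolding regular_on_def by metis
    define U'' where "U'' = U \<inter> W"
    have openU'': "openin (zariski_on a N X) U''" unfolding U''_def using openU W(1) by auto
    define \<kappa> where "\<kappa> = (\<lambda>Q. let x = (SOME x. x \<in> Q) in peval (xpow j d) x / peval g x)"
    have xjd: "whomogeneous a N d (xpow j d)" using whomogeneous_xpow[OF j(1), of a d] j by simp
    have \<kappa>: "peval g x \<noteq> 0 \<and> \<kappa> Q = peval (xpow j d) x / peval g x" if "Q \<in> U''" "x \<in> Q" for Q x
    proof -
      have "(SOME x. x \<in> Q) \<in> Q" by (rule someI[of "\<lambda>x. x \<in> Q", OF that(2)])
      moreover have "Q \<in> U" "Q \<in> W" using that(1) by (auto simp: U''_def)
      ultimately show ?thesis
        unfolding \<kappa>_def Let_def using W(6)[of Q x] nz(2)[of Q x] that(2) quotient_rep_indep[OF xjd W(5), of Q x]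
        by blast
    qed
    have reg_\<kappa>: "regular_on a N X U'' \<kappa>" by (rule regular_on_quotient[OF openU'' xjd W(5) \<kappa>])
    have f: "peval f \<in> polyfuns {..N}" by (rule whomogeneous_polyfuns[OF W(4)])
    obtain c where c: "\<forall>i\<in>{..N} - {j}. regular_on a N X U (c i)"
      "\<And>Q. Q \<in> U \<Longrightarrow> peval f (y Q) = peval f (y P) + (\<Sum>i\<in>{..N} - {j}. c i Q * (y Q i - y P i))"
      using coord[OF f] by blast
    have "peval f p = 0" using W(6)[OF W(2) P(2)] h by auto
    then have f0: "peval f (y P) = 0"
      using peval_affine_coord[OF W(4) j(2) P] P(3) by (simp add: y_def)
    show "\<exists>U'' c. P \<in> U'' \<and> U'' \<subseteq> U \<inter> U' \<and> openin (zariski_on a N X) U'' \<and>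
        (\<forall>i<N. regular_on a N X U'' (c i)) \<and> (\<forall>Q\<in>U''. h Q = (\<Sum>i<N. c i Q * t i Q))"
    proof (intro exI[of _ U''] exI[of _ "\<lambda>i Q. \<kappa> Q * c (\<rho> i) Q"] conjI allI impI ballI openU'')
      show "P \<in> U''" "U'' \<subseteq> U \<inter> U'" using PU W by (auto simp: U''_def)
      show "regular_on a N X U'' (\<lambda>Q. \<kappa> Q * c (\<rho> i) Q)" if "i < N" for i
      proof -
        have "U'' \<subseteq> U" by (simp add: U''_def)
        moreover have "regular_on a N X U (c (\<rho> i))" using c(1) \<rho>_in[OF that] by blast
        ultimately show ?thesis using regular_on_mult[OF reg_\<kappa>] regular_on_subset[OF _ openU''] by blast
      qed
      fix Q assume Q: "Q \<in> U''"
      have QU: "Q \<in> U" and QW: "Q \<in> W" using Q by (auto simp: U''_def)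
      have "Q \<in> wproj a N" using QU by (auto simp: U_def basic_open_def)
      then obtain x where x: "x \<in> Q" using wproj_nonempty by blast
      have "h Q = peval f x / peval g x" using W(6)[OF QW x] by simp
      also have "\<dots> = \<kappa> Q * peval f (y Q)"
        using \<kappa>[OF Q x] peval_affine_coord[OF W(4) j(2) nz(2)[OF QU x] x nz(1)[OF QU x]]
        by (simp add: peval_xpow y_def)
      also have "\<dots> = (\<Sum>i<N. \<kappa> Q * c (\<rho> i) Q * t i Q)"
        unfolding c(2)[OF QU] f0 reindex by (simp add: t_def sum_distrib_left mult.assoc)
      finally show "h Q = (\<Sum>i<N. \<kappa> Q * c (\<rho> i) Q * t i Q)" .
    qed
  qed
qed

section \<open>Diagonal automorphisms\<close>

text \<open>The map induced by multiplying the \<open>i\<close>-th coordinate by \<open>c i\<close>.\<close>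

definition diag_map :: "(nat \<Rightarrow> complex) \<Rightarrow> wpoint \<Rightarrow> wpoint" where
  "diag_map c P = (\<lambda>x i. c i * x i) ` P"

lemma diag_map_orbit: "diag_map c (Gm_orbit a x) = Gm_orbit a (\<lambda>i. c i * x i)"
  unfolding diag_map_def Gm_orbit_def by (auto simp: image_iff mult_ac)

lemma diag_map_wproj:
  assumes "P \<in> wproj a N" "\<And>i. c i \<noteq> 0"
  shows "diag_map c P \<in> wproj a N"
proof -
  obtain x where x: "P = Gm_orbit a x" "x \<in> affine_space N" "x \<noteq> (\<lambda>_. 0)"
    using assms(1) by (auto simp: wproj_def)
  have "(\<lambda>i. c i * x i) \<in> affine_space N" using x(2) by (auto simp: affine_space_def)
  moreover have "(\<lambda>i. c i * x i) \<noteq> (\<lambda>_. 0)" using x(3) assms(2) by (auto simp: fun_eq_iff)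
  ultimately show ?thesis unfolding x(1) diag_map_orbit by (rule wprojI)
qed

lemma whomogeneous_diag:
  assumes "whomogeneous a N d g"
  obtains g' where "whomogeneous a N d g'" "\<And>x. peval g' x = peval g (\<lambda>i. c i * x i)"
proof
  define g' where "g' = (\<Sum>m\<in>Poly_Mapping.keys g. Poly_Mapping.single m (Poly_Mapping.lookup g m * monom_eval m c))"
  have "Poly_Mapping.keys g' \<subseteq> Poly_Mapping.keys g"
    unfolding g'_def using keys_sum by (fastforce split: if_splits)
  then show "whomogeneous a N d g'" using assms unfolding whomogeneous_def by blast
  show "peval g' x = peval g (\<lambda>i. c i * x i)" for x
    by (simp add: g'_def peval_sum peval_single) (simp add: peval_monom_eval monom_eval_mult mult_ac)
qed

lemma basic_open_diag:
  assumes "\<And>x. peval g' x = peval g (\<lambda>i. c i * x i)" "P \<in> wproj a N" "\<And>i. c i \<noteq> 0"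
  shows "P \<in> basic_open a N g' \<longleftrightarrow> diag_map c P \<in> basic_open a N g"
  using diag_map_wproj[OF assms(2,3)] assms(1,2) by (auto simp: basic_open_def diag_map_def)

lemma self_morphism_diag:
  assumes X: "X \<subseteq> wproj a N" and c: "\<And>i. c i \<noteq> 0" and inv: "\<And>P. P \<in> X \<Longrightarrow> diag_map c P \<in> X"
  shows "self_morphism a N X (restrict (diag_map c) X)"
proof -
  have pre: "openin (zariski_on a N X) {P \<in> X. diag_map c P \<in> U}"
    if U: "openin (zariski_on a N X) U" for U
  proof -
    obtain T where T: "openin (zariski a N) T" "U = T \<inter> X" using U by (auto simp: openin_subtopology)
    have "openin (zariski a N) {P \<in> wproj a N. diag_map c P \<in> T}"
      unfolding openin_zariski
    proof (intro conjI ballI)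
      fix P assume P: "P \<in> {P \<in> wproj a N. diag_map c P \<in> T}"
      then obtain g d where g: "whomogeneous a N d g" "diag_map c P \<in> basic_open a N g" "basic_open a N g \<subseteq> T"
        using T(1) unfolding openin_zariski by blast
      obtain g' where g': "whomogeneous a N d g'" "\<And>x. peval g' x = peval g (\<lambda>i. c i * x i)"
        using whomogeneous_diag[OF g(1), of c] by blast
      have "P \<in> basic_open a N g'" using P g(2) basic_open_diag[OF g'(2) _ c] by auto
      moreover have "basic_open a N g' \<subseteq> {P \<in> wproj a N. diag_map c P \<in> T}"
      proof
        fix Q assume Q: "Q \<in> basic_open a N g'"
        then have "Q \<in> wproj a N" by (simp add: basic_open_def)
        then show "Q \<in> {P \<in> wproj a N. diag_map c P \<in> T}"
          using Q basic_open_diag[OF g'(2) _ c] g(3) by blast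
      qed
      ultimately show "\<exists>g d. whomogeneous a N d g \<and> P \<in> basic_open a N g \<and>
          basic_open a N g \<subseteq> {P \<in> wproj a N. diag_map c P \<in> T}" using g'(1) by blast
    qed auto
    moreover have "{P \<in> X. diag_map c P \<in> U} = {P \<in> wproj a N. diag_map c P \<in> T} \<inter> X"
      using X inv T(2) by auto
    ultimately show ?thesis by (auto simp: openin_subtopology)
  qed
  have pre': "{P \<in> X. restrict (diag_map c) X P \<in> U} = {P \<in> X. diag_map c P \<in> U}" for U by auto
  show ?thesis
    unfolding self_morphism_def
  proof (intro conjI allI impI)
    show "continuous_map (zariski_on a N X) (zariski_on a N X) (restrict (diag_map c) X)"
    proof -
      have T: "topspace (zariski_on a N X) = X" using X by auto
      show ?thesis
        unfolding continuous_map_def T pre' using inv pre by auto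
    qed
  next
    fix U h assume h: "regular_on a N X U h"
    show "regular_on a N X {P \<in> X. restrict (diag_map c) X P \<in> U} (h \<circ> restrict (diag_map c) X)"
      unfolding pre' regular_on_def
    proof (intro conjI ballI pre[OF regular_on_open[OF h]])
      fix P assume P: "P \<in> {P \<in> X. diag_map c P \<in> U}"
      then obtain W f g d where W: "openin (zariski_on a N X) W" "diag_map c P \<in> W" "W \<subseteq> U"
        "whomogeneous a N d f" "whomogeneous a N d g"
        "\<And>Q x. Q \<in> W \<Longrightarrow> x \<in> Q \<Longrightarrow> peval g x \<noteq> 0 \<and> h Q = peval f x / peval g x"
        using h unfolding regular_on_def by (metis (no_types, lifting) mem_Collect_eq)
      obtain f' where f': "whomogeneous a N d f'" "\<And>x. peval f' x = peval f (\<lambda>i. c i * x i)"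
        using whomogeneous_diag[OF W(4), of c] by blast
      obtain g' where g': "whomogeneous a N d g'" "\<And>x. peval g' x = peval g (\<lambda>i. c i * x i)"
        using whomogeneous_diag[OF W(5), of c] by blast
      have "\<forall>Q\<in>{P \<in> X. diag_map c P \<in> W}. \<forall>x\<in>Q. peval g' x \<noteq> 0 \<and>
          (h \<circ> restrict (diag_map c) X) Q = peval f' x / peval g' x"
        using W(6) by (auto simp: f'(2) g'(2) diag_map_def)
      moreover have "{P \<in> X. diag_map c P \<in> W} \<subseteq> {P \<in> X. diag_map c P \<in> U}" using W(3) by auto
      ultimately show "\<exists>U' f g d. openin (zariski_on a N X) U' \<and> P \<in> U' \<and>
          U' \<subseteq> {P \<in> X. diag_map c P \<in> U} \<and> whomogeneous a N d f \<and> whomogeneous a N d g \<and>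
          (\<forall>Q\<in>U'. \<forall>x\<in>Q. peval g x \<noteq> 0 \<and> (h \<circ> restrict (diag_map c) X) Q = peval f x / peval g x)"
        using pre[OF W(1)] f'(1) g'(1) W(2) P by blast
    qed
  qed
qed

section \<open>The exponents and the weights\<close>

lemma zigzag_up_Suc: "zigzag_up r (Suc i) = zigzag_up r i @ [r + 1 + i, r - i]"
  by (simp add: zigzag_up_def)

lemma zigzag_up_0 [simp]: "zigzag_up r 0 = []"
  by (simp add: zigzag_up_def)

lemma even_length_zigzag_up: "even (length (zigzag_up r i))"
  by (induction i) (simp_all add: zigzag_up_Suc)

text \<open>The inward list is the outward list read backwards.\<close>

lemma zigzag_in_eq_rev:
  assumes "i \<le> r"
  shows "zigzag_in r (r + 1 - i) = rev (zigzag_up r i)"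
  using assms
proof (induction i)
  case 0
  then show ?case by (simp add: zigzag_in_def)
next
  case (Suc i)
  have "[r - i..<r + 1] = (r - i) # [r + 1 - i..<r + 1]"
    using Suc.prems upt_conv_Cons[of "r - i" "r + 1"] by (simp add: Suc_diff_le)
  then have "zigzag_in r (r - i) = [r - i, 2 * r + 1 - (r - i)] @ zigzag_in r (r + 1 - i)"
    unfolding zigzag_in_def by simp
  moreover have "2 * r + 1 - (r - i) = r + 1 + i" using Suc.prems by simp
  ultimately show ?case using Suc by (simp add: zigzag_up_Suc)
qed

lemma prod_list_zigzag_up:
  fixes f :: "nat \<Rightarrow> int"
  assumes "i \<le> r"
  shows "prod_list (map f (zigzag_up r i)) = (\<Prod>j=r + 1 - i..r + i. f j)"
  using assms
proof (induction i)
  case (Suc i)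
  have "{r + 1 - Suc i..r + Suc i} = insert (r - i) (insert (r + 1 + i) {r + 1 - i..r + i})"
    using Suc.prems by auto
  moreover have "r - i \<notin> insert (r + 1 + i) {r + 1 - i..r + i}" "r + 1 + i \<notin> {r + 1 - i..r + i}"
    using Suc.prems by auto
  ultimately have "(\<Prod>j=r + 1 - Suc i..r + Suc i. f j) = f (r - i) * (f (r + 1 + i) * (\<Prod>j=r + 1 - i..r + i. f j))"
    by (simp del: One_nat_def)
  then show ?case using Suc by (simp add: zigzag_up_Suc mult_ac)
qed simp

lemma altB_append2: "altB (xs @ [y, t]) = prod_list xs * y * (t - 1) + altB xs"
proof -
  have "altB (xs @ [y, t]) = altB ((xs @ [y]) @ [t])" by simp
  then show ?thesis unfolding altB_snoc by (simp add: algebra_simps)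
qed

lemma altB_rev_append2:
  assumes "even (length xs)"
  shows "altB (rev (xs @ [y, t])) = t * y * altB (rev xs) - (t - 1)"
  using assms by (simp add: altB_Cons algebra_simps)

lemma altBB_append2:
  "altBB (xs @ [y, t]) = altBB xs + y * (t - 1) * altB (rev xs) + (- 1) ^ length xs * (2 - t)"
proof (induction xs)
  case Nil
  show ?case by (simp add: altBB_Cons altB_Cons altBB_def[of "[]"] algebra_simps)
next
  case (Cons x xs)
  then show ?case
    using altB_append2[of "x # xs" y t] by (simp add: altBB_Cons altB_snoc algebra_simps)
qed

text \<open>The product of the exponents along \<open>r+1, r, \<dots>, r+i, r+1-i\<close>, their alternating sum, that of
  the reversed list, and the alternating sum of the alternating sums.\<close>

definition zP :: "nat \<Rightarrow> nat \<Rightarrow> int" where "zP r i = prod_list (map (bseq r) (zigzag_up r i))"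
definition zU :: "nat \<Rightarrow> nat \<Rightarrow> int" where "zU r i = altB (map (bseq r) (zigzag_up r i))"
definition zW :: "nat \<Rightarrow> nat \<Rightarrow> int" where "zW r i = altB (rev (map (bseq r) (zigzag_up r i)))"
definition zB :: "nat \<Rightarrow> nat \<Rightarrow> int" where "zB r i = altBB (map (bseq r) (zigzag_up r i))"

lemma z_0 [simp]: "zP r 0 = 1" "zU r 0 = 1" "zW r 0 = 1" "zB r 0 = 1"
  by (simp_all add: zP_def zU_def zW_def zB_def altBB_def)

lemma z_Suc:
  fixes r i
  defines "y \<equiv> bseq r (r + 1 + i)" and "t \<equiv> bseq r (r - i)"
  shows "zP r (Suc i) = zP r i * y * t" "zU r (Suc i) = zP r i * y * (t - 1) + zU r i"
    "zW r (Suc i) = t * y * zW r i - (t - 1)" "zB r (Suc i) = zB r i + y * (t - 1) * zW r i + 2 - t"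
proof -
  let ?xs = "map (bseq r) (zigzag_up r i)"
  have m: "map (bseq r) (zigzag_up r (Suc i)) = ?xs @ [y, t]" by (simp add: zigzag_up_Suc y_def t_def)
  have ev: "even (length ?xs)" using even_length_zigzag_up by simp
  show "zP r (Suc i) = zP r i * y * t" unfolding zP_def m by simp
  show "zU r (Suc i) = zP r i * y * (t - 1) + zU r i" unfolding zU_def zP_def m altB_append2 ..
  show "zW r (Suc i) = t * y * zW r i - (t - 1)" unfolding zW_def m altB_rev_append2[OF ev] ..
  show "zB r (Suc i) = zB r i + y * (t - 1) * zW r i + 2 - t"
    unfolding zB_def zW_def m altBB_append2 using ev by simp
qed

lemma bseq_low: "i \<le> r \<Longrightarrow> bseq r i = sylvester i"
  by (simp add: bseq.simps)

lemma bseq_high: "i < r \<Longrightarrow> bseq r (r + 1 + i) = 1 + (sylvester (r - i) - 1)\<^sup>2 * zU r i"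
  by (subst bseq.simps) (simp add: zU_def bseq_low)

text \<open>The identity behind the weights, \<open>P - 1 = c (P B - U W)\<close> with \<open>c + 1 = s\<^bsub>r+1-i\<^esub>\<close>; the induction
  uses \<open>s\<^bsub>j+1\<^esub> - 1 = s\<^sub>j (s\<^sub>j - 1)\<close>.\<close>

lemma z_identity:
  assumes "i \<le> r"
  shows "zP r i - 1 = (sylvester (r + 1 - i) - 1) * (zP r i * zB r i - zU r i * zW r i)"
  using assms
proof (induction i)
  case (Suc i)
  define t where "t = sylvester (r - i)"
  define y where "y = bseq r (r + 1 + i)"
  have y: "y = 1 + (t - 1)\<^sup>2 * zU r i" unfolding y_def t_def using Suc.prems by (intro bseq_high) simp
  have t: "bseq r (r - i) = t" by (simp add: t_def bseq_low)
  have "sylvester (r + 1 - i) = t * (t - 1) + 1" using Suc.prems by (simp add: Suc_diff_le t_def)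
  then have IH: "zP r i - 1 = t * (t - 1) * (zP r i * zB r i - zU r i * zW r i)" using Suc by simp
  have "zP r i * y * t - 1 = (t - 1) * (zP r i * y * t * (zB r i + y * (t - 1) * zW r i + 2 - t)
      - (zP r i * y * (t - 1) + zU r i) * (t * y * zW r i - (t - 1)))"
    using IH y by algebra
  moreover have "sylvester (r + 1 - Suc i) = t" by (simp add: t_def)
  ultimately show ?case unfolding z_Suc t y_def[symmetric] by simp
qed simp

lemma z_bounds:
  assumes "i \<le> r"
  shows "1 \<le> zP r i" "1 \<le> zU r i" "1 \<le> zW r i" "1 \<le> zB r i"
proof -
  have "1 \<le> zP r i \<and> 1 \<le> zU r i \<and> 1 \<le> zW r i \<and> 1 \<le> zB r i"
    using assms
  proof (induction i)
    case (Suc i)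
    define t where "t = bseq r (r - i)"
    define y where "y = bseq r (r + 1 + i)"
    have t: "t \<ge> 2" unfolding t_def by (rule bseq_ge_2) simp
    have y: "y \<ge> 2" unfolding y_def using Suc.prems by (intro bseq_ge_2) simp
    have IH: "1 \<le> zP r i" "1 \<le> zU r i" "1 \<le> zW r i" "1 \<le> zB r i" using Suc by auto
    have P: "1 \<le> zP r i * y" using mult_mono[of 1 "zP r i" 1 y] IH y by simp
    have W: "2 \<le> y * zW r i" using mult_mono[of 2 y 1 "zW r i"] IH y by simp
    have "1 \<le> zP r i * y * t" using mult_mono[of 1 "zP r i * y" 1 t] P t by simp
    moreover have "0 \<le> zP r i * y * (t - 1)" using mult_nonneg_nonneg[of "zP r i * y" "t - 1"] P t by simp
    moreover have "0 \<le> t * (y * zW r i - 1)" using W t by (intro mult_nonneg_nonneg) auto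
    moreover have "0 \<le> (t - 1) * (y * zW r i - 1)" using W t by (intro mult_nonneg_nonneg) auto
    ultimately show ?case
      unfolding z_Suc t_def[symmetric] y_def[symmetric] using IH by (simp add: algebra_simps)
  qed simp
  then show "1 \<le> zP r i" "1 \<le> zU r i" "1 \<le> zW r i" "1 \<le> zB r i" by auto
qed

lemma odd_zW: "i \<le> r \<Longrightarrow> odd (zW r i)"
proof (induction i)
  case (Suc i)
  then have "odd (bseq r (r - i))" "odd (bseq r (r + 1 + i))" by (intro bseq_odd; simp)+
  then show ?case using Suc by (simp add: z_Suc)
qed simp

text \<open>Both parities of \<open>n\<close> are treated together: \<open>z = 0\<close> for odd \<open>n\<close> and \<open>z = 1\<close> for even
  \<open>n\<close>, and \<open>r = k + z\<close>.  Every monomial but \<open>x\<^sub>0\<^sup>2\<close> (which only occurs for \<open>z = 1\<close>) is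
  \<open>x\<^sub>j\<close> to the power \<open>loop_expo n r j\<close> times the variable with index \<open>loop_succ n r j\<close>, where
  \<open>z \<le> j \<le> n + 1\<close>.  The map \<open>loop_succ n r\<close> is the cyclic permutation
  \<open>n+1, r+1, r, r+2, r-1, \<dots>, n, z\<close> with inverse \<open>loop_pred n r z\<close>.\<close>

definition loop_expo :: "nat \<Rightarrow> nat \<Rightarrow> nat \<Rightarrow> int" where
  "loop_expo n r j = (if j < n then bseq r j else if j = n then b_top n else v_top n)"

definition loop_succ :: "nat \<Rightarrow> nat \<Rightarrow> nat \<Rightarrow> nat" where
  "loop_succ n r j = (if j \<le> r then 2 * r + 2 - j else if j \<le> n then 2 * r + 1 - j else r + 1)"

definition loop_pred :: "nat \<Rightarrow> nat \<Rightarrow> nat \<Rightarrow> nat \<Rightarrow> nat" where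
  "loop_pred n r z j = (if j = n + 1 then z else if j = z then n else if j = r + 1 then n + 1
     else if j \<le> r then 2 * r + 1 - j else 2 * r + 2 - j)"

text \<open>The degree \<open>D'\<close>.\<close>

definition loop_deg :: "nat \<Rightarrow> nat \<Rightarrow> nat \<Rightarrow> int" where
  "loop_deg r k z = (sylvester z - 1)\<^sup>2 * zP r k + sylvester z * (sylvester z - 1) * zU r k"

text \<open>The solution of \<open>e\<^sub>j x\<^sub>j + x\<^bsub>j'\<^esub> = d\<close> along the cycle that starts with
  \<open>x\<^bsub>n+1\<^esub> = w\<close>, where \<open>e\<^sub>j\<close> is the exponent and \<open>j'\<close> the successor of \<open>j\<close>; the equation
  at \<open>j = z\<close> is left out.\<close>

definition loop_sol :: "nat \<Rightarrow> nat \<Rightarrow> nat \<Rightarrow> nat \<Rightarrow> int \<Rightarrow> int \<Rightarrow> nat \<Rightarrow> int" where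
  "loop_sol n r k z d w j =
     (if j = n + 1 then w
      else if r < j then d * zW r (j - r - 1) - v_top n * w * zP r (j - r - 1)
      else if z < j then d - bseq r (2 * r + 1 - j) * (d * zW r (r - j) - v_top n * w * zP r (r - j))
      else d - b_top n * (d * zW r k - v_top n * w * zP r k))"

text \<open>The weights \<open>a'\<^sub>j\<close>.\<close>

definition loop_weight :: "nat \<Rightarrow> nat \<Rightarrow> nat \<Rightarrow> nat \<Rightarrow> nat \<Rightarrow> int" where
  "loop_weight n r k z j = (if j > n + 1 then 0 else if j < z then loop_deg r k z div 2
     else loop_sol n r k z (loop_deg r k z) 1 j)"

text \<open>A generator of the group acts on \<open>x\<^sub>j\<close> by the \<open>act_exp n r k z j\<close>-th power of a
  primitive root of unity of order \<open>m'\<close>.  For even \<open>n\<close> the number \<open>m'\<close> is odd, and the exponent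
  of \<open>x\<^sub>0\<close> is the half of \<open>1\<close> modulo \<open>m'\<close>.\<close>

definition act_exp :: "nat \<Rightarrow> nat \<Rightarrow> nat \<Rightarrow> nat \<Rightarrow> nat \<Rightarrow> int" where
  "act_exp n r k z j = (if j > n + 1 then 0 else if j < z then (m_val n + 1) div 2
     else loop_sol n r k z 1 0 j)"

text \<open>The numbers \<open>r, k, z\<close> attached to \<open>n\<close>; the condition \<open>n \<ge> 2\<close> amounts to \<open>r \<ge> 1\<close>.\<close>

locale loop_hypersurface =
  fixes n r k z :: nat
  assumes n_eq: "n = 2 * k + 1 + z" and r_eq: "r = k + z" and z_le: "z \<le> 1" and r_pos: "1 \<le> r"
begin

abbreviation "s \<equiv> sylvester z"
abbreviation "deg \<equiv> loop_deg r k z"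
abbreviation "expo \<equiv> loop_expo n r"
abbreviation "succ_ix \<equiv> loop_succ n r"
abbreviation "pred_ix \<equiv> loop_pred n r z"
abbreviation "sol \<equiv> loop_sol n r k z"
abbreviation "weight \<equiv> loop_weight n r k z"
abbreviation "dexp \<equiv> act_exp n r k z"

lemma z_cases: "z = 0 \<or> z = 1"
  using z_le by auto

lemma n_div_2: "n div 2 = r"
  using z_cases by (auto simp: n_eq r_eq)

lemma odd_n_iff: "odd n \<longleftrightarrow> z = 0"
  using z_cases by (auto simp: n_eq)

lemma k_le_r: "k \<le> r"
  by (simp add: r_eq)

lemma s_bounds: "2 \<le> s"
  by (rule sylvester_ge_2)

lemma v_top_eq: "v_top n = (s - 1)\<^sup>2 * zW r k + s * (s - 1) * zB r k - 1"
  using z_cases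
proof
  assume "z = 0"
  then show ?thesis using zigzag_in_eq_rev[of r r]
    by (simp add: v_top_def n_div_2 odd_n_iff Let_def sylvester_1_2 zW_def zB_def r_eq rev_map)
next
  assume z: "z = 1"
  have "r - 1 = k" using z r_eq by simp
  then show ?thesis using zigzag_in_eq_rev[of k r] z r_eq
    by (simp add: v_top_def n_div_2 odd_n_iff Let_def sylvester_1_2 zW_def zB_def rev_map)
qed

lemma b_top_eq: "s * b_top n = 1 + (s - 1) * deg"
  using z_cases
proof
  assume z: "z = 0"
  have n: "n = 2 * r + 1" using z n_eq r_eq by simp
  have k: "k = r" "r + 1 - r = 1" "r + r = 2 * r" using z r_eq by simp_all
  have "zP r r = (\<Prod>i=1..2 * r. bseq r i)"
    using prod_list_zigzag_up[of r r "bseq r"] unfolding zP_def k by simp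
  then have "2 * b_top n = 1 + zP r r + 2 * zU r r"
    using b_top_odd[OF r_pos] unfolding n sylvester_1_2 zU_def by simp
  then show ?thesis unfolding loop_deg_def k z by simp
next
  assume z: "z = 1"
  have n: "n = 2 * r" using z n_eq r_eq by simp
  have k: "r - 1 = k" "r + 1 - k = 2" "r + k = 2 * r - 1" using z r_eq by simp_all
  have "zP r k = (\<Prod>i=2..2 * r - 1. bseq r i)"
    using prod_list_zigzag_up[OF k_le_r, of "bseq r"] unfolding zP_def k by simp
  then have "3 * b_top n = 1 + 8 * zP r k + 12 * zU r k"
    using b_top_even[OF r_pos] unfolding n sylvester_1_2 zU_def k by simp
  then show ?thesis unfolding loop_deg_def z sylvester_1_2 by simp
qed

lemma u_val_eq: "deg = (if odd n then u_val n else 2 * u_val n)"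
  using z_cases
proof
  assume z: "z = 0"
  then have k: "k = r" "r + 1 - r = 1" "r + r = 2 * r" using r_eq by simp_all
  have "zP r r = (\<Prod>i=1..2 * r. bseq r i)"
    using prod_list_zigzag_up[of r r "bseq r"] unfolding zP_def k by simp
  then have "u_val n = zP r r + 2 * zU r r"
    using odd_n_iff z unfolding u_val_def n_div_2 Let_def sylvester_1_2 zU_def by simp
  then show ?thesis using odd_n_iff z unfolding loop_deg_def k z by simp
next
  assume z: "z = 1"
  have k: "r - 1 = k" "r + 1 - k = 2" "r + k = 2 * r - 1" using z r_eq by simp_all
  have "zP r k = (\<Prod>i=2..2 * r - 1. bseq r i)"
    using prod_list_zigzag_up[OF k_le_r, of "bseq r"] unfolding zP_def k by simp
  then have "u_val n = 2 * zP r k + 3 * zU r k"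
    using odd_n_iff z unfolding u_val_def n_div_2 Let_def sylvester_1_2 zU_def k by simp
  then show ?thesis using odd_n_iff z unfolding loop_deg_def z sylvester_1_2 by simp
qed

lemma m_val_eq: "m_val n = s * b_top n * zW r k - s + 1"
  using z_cases
proof
  assume "z = 0"
  then show ?thesis using zigzag_in_eq_rev[of r r]
    by (simp add: m_val_def n_div_2 odd_n_iff Let_def zW_def r_eq rev_map bseq_low)
next
  assume z: "z = 1"
  have "r - 1 = k" using z r_eq by simp
  then show ?thesis using zigzag_in_eq_rev[of k r] z r_eq
    by (simp add: m_val_def n_div_2 odd_n_iff Let_def zW_def rev_map bseq_low)
qed

lemma zP_identity: "zP r k - 1 = s * (s - 1) * (zP r k * zB r k - zU r k * zW r k)"
proof -
  have "r + 1 - k = Suc z" by (simp add: r_eq)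
  then show ?thesis using z_identity[OF k_le_r] by simp
qed

lemma deg_zW: "deg * zW r k = 1 + zP r k * v_top n"
  using zP_identity unfolding v_top_eq loop_deg_def by algebra

text \<open>The product of all exponents along the cycle is \<open>D' m' - 1\<close>.\<close>

lemma deg_m_val: "deg * m_val n = 1 + zP r k * v_top n * (s * b_top n)"
  using deg_zW b_top_eq unfolding m_val_eq by algebra

lemma deg_gt_1: "1 < deg"
proof -
  have "1 * 1 \<le> (s - 1)\<^sup>2 * zP r k" using s_bounds z_bounds(1)[OF k_le_r]
    by (intro mult_mono) (auto simp: one_le_power)
  moreover have "1 * 1 \<le> (s * (s - 1)) * zU r k" using s_bounds z_bounds(2)[OF k_le_r]
    mult_mono[of 1 s 1 "s - 1"] by (intro mult_mono) auto
  ultimately show ?thesis by (simp add: loop_deg_def)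
qed

lemma v_top_ge_2: "2 \<le> v_top n"
proof -
  have "1 * 1 \<le> (s - 1)\<^sup>2 * zW r k" using s_bounds z_bounds(3)[OF k_le_r]
    by (intro mult_mono) (auto simp: one_le_power)
  moreover have "2 * 1 \<le> (s * (s - 1)) * zB r k" using s_bounds z_bounds(4)[OF k_le_r]
    mult_mono[of 2 s 1 "s - 1"] by (intro mult_mono) auto
  ultimately show ?thesis by (simp add: v_top_eq)
qed

lemma b_top_ge_2: "2 \<le> b_top n"
proof (rule ccontr)
  assume "\<not> ?thesis"
  then have "s * b_top n \<le> s * 1" using s_bounds by (intro mult_left_mono) auto
  moreover have "(s - 1) * 2 \<le> (s - 1) * deg" using deg_gt_1 s_bounds by (intro mult_left_mono) auto
  ultimately show False using b_top_eq s_bounds by simp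
qed

lemma expo_ge_2: "j \<le> n + 1 \<Longrightarrow> 2 \<le> expo j"
  using bseq_ge_2[of j r] v_top_ge_2 b_top_ge_2 z_le by (auto simp: loop_expo_def n_eq r_eq)

lemma succ_pred:
  assumes "j \<in> {z..n + 1}"
  shows "succ_ix j \<in> {z..n + 1}" "pred_ix j \<in> {z..n + 1}"
    "pred_ix (succ_ix j) = j" "succ_ix (pred_ix j) = j"
  using assms z_cases r_pos by (auto simp: loop_succ_def loop_pred_def n_eq r_eq)

lemma bij_succ_ix: "bij_betw succ_ix {z..n + 1} {z..n + 1}"
  by (rule bij_betw_byWitness[of _ pred_ix]) (use succ_pred in auto)

lemma sol_step:
  assumes j: "j \<in> {z..n + 1}" "j \<noteq> z"
  shows "expo j * sol d w j + sol d w (succ_ix j) = d"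
proof -
  consider "j = n + 1" | "j = n" | "r < j" "j < n" | "z < j" "j \<le> r"
    using j by fastforce
  then show ?thesis
  proof cases
    case 1
    have "r + 1 \<noteq> n + 1" "succ_ix (n + 1) = r + 1" using r_pos by (auto simp: loop_succ_def n_eq r_eq)
    then show ?thesis unfolding 1 by (simp add: loop_sol_def loop_expo_def)
  next
    case 2
    have "succ_ix n = z" "r < n" "n - r - 1 = k" "z \<noteq> n + 1" "z \<le> r"
      using r_pos z_cases by (auto simp: loop_succ_def n_eq r_eq)
    then show ?thesis unfolding 2 by (simp add: loop_sol_def loop_expo_def)
  next
    case 3
    define i where "i = j - r - 1"
    have i: "j = r + 1 + i" "i < k" "succ_ix j = r - i" using 3 by (auto simp: i_def loop_succ_def n_eq r_eq)
    have "z < r - i" "\<not> r < r - i" "r - i \<noteq> n + 1" "r - (r - i) = i" "2 * r + 1 - (r - i) = r + 1 + i" "j \<noteq> n + 1"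
      "r < j"
      using i 3 by (auto simp: r_eq n_eq)
    then show ?thesis using 3(2) i(1) unfolding i(3) by (simp add: loop_sol_def loop_expo_def)
  next
    case 4
    define i where "i = r - j"
    have i: "j = r - i" "i < k" using 4 by (auto simp: i_def r_eq)
    have ix: "succ_ix j = r + 1 + Suc i" "2 * r + 1 - j = r + 1 + i" "j < n" "j \<noteq> n + 1" "r + 1 + Suc i \<noteq> n + 1"
      "r + 1 + Suc i - r - 1 = Suc i" "r - j = i"
      using i 4 by (auto simp: loop_succ_def r_eq n_eq)
    have a: "sol d w j = d - bseq r (r + 1 + i) * (d * zW r i - v_top n * w * zP r i)"
      using 4 ix by (simp add: loop_sol_def)
    have b: "sol d w (succ_ix j) = d * zW r (Suc i) - v_top n * w * zP r (Suc i)"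
      unfolding ix(1) using ix(5,6) by (simp add: loop_sol_def)
    have e: "expo j = bseq r (r - i)" using ix(3) i by (simp add: loop_expo_def)
    show ?thesis unfolding a b e z_Suc by (simp add: algebra_simps)
  qed
qed

lemma sol_simps:
  "sol d w (n + 1) = w"
  "i \<le> k \<Longrightarrow> sol d w (r + 1 + i) = d * zW r i - v_top n * w * zP r i"
  "sol d w n = d * zW r k - v_top n * w * zP r k"
  "sol d w z = d - b_top n * (d * zW r k - v_top n * w * zP r k)"
proof -
  show 1: "sol d w (r + 1 + i) = d * zW r i - v_top n * w * zP r i" if "i \<le> k" for i
    using that by (simp add: loop_sol_def n_eq r_eq)
  have "n = r + 1 + k" by (simp add: n_eq r_eq)
  then show "sol d w n = d * zW r k - v_top n * w * zP r k" using 1[of k] by simp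
  show "sol d w (n + 1) = w" by (simp add: loop_sol_def)
  show "sol d w z = d - b_top n * (d * zW r k - v_top n * w * zP r k)"
    by (simp add: loop_sol_def n_eq r_eq)
qed

lemma expo_z: "expo z = s"
  using r_eq by (simp add: loop_expo_def n_eq bseq_low)

lemma succ_ix_z: "succ_ix z = n + 1"
  using z_cases by (auto simp: loop_succ_def n_eq r_eq)

subsection \<open>The weights\<close>

lemma weight_sol: "z \<le> j \<Longrightarrow> j \<le> n + 1 \<Longrightarrow> weight j = sol deg 1 j"
  by (simp add: loop_weight_def)

lemma weight_n: "weight n = 1" "weight (n + 1) = 1"
proof -
  have "z \<le> n" using n_eq by simp
  then show "weight n = 1" "weight (n + 1) = 1"
    using deg_zW weight_sol[of n] weight_sol[of "n + 1"] unfolding sol_simps by simp_all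
qed

lemma weight_z: "weight z = deg - b_top n"
proof -
  have "z \<le> n + 1" using n_eq by simp
  then show ?thesis using deg_zW weight_sol[of z] unfolding sol_simps by simp
qed

lemma weight_step:
  assumes "j \<in> {z..n + 1}"
  shows "expo j * weight j + weight (succ_ix j) = deg"
proof (cases "j = z")
  case True
  have "s * (deg - b_top n) + 1 = deg" using b_top_eq by (simp add: algebra_simps)
  then show ?thesis unfolding True expo_z succ_ix_z weight_z weight_n .
next
  case False
  then show ?thesis
    using sol_step[OF assms] succ_pred(1)[OF assms] assms by (simp add: loop_weight_def)
qed

lemma even_deg:
  assumes "z = 1"
  shows "even deg"
proof -
  have "even n" using odd_n_iff assms by simp
  then show ?thesis using u_val_eq by simp
qed

lemma weight_0:
  assumes "z = 1"
  shows "2 * weight 0 = deg"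
proof -
  have "0 < z" using assms by simp
  then have "weight 0 = deg div 2" by (simp add: loop_weight_def)
  then show ?thesis using even_deg[OF assms] by simp
qed

text \<open>Backwards along the cycle, starting with \<open>a\<^sub>n = 1\<close>: if the weight of the successor of \<open>j\<close> lies
  strictly between \<open>0\<close> and \<open>D'\<close>, then so does the weight of \<open>j\<close>.\<close>

lemma weight_pos_high:
  assumes "i \<le> k"
  shows "0 < weight (r + 1 + i) \<and> weight (r + 1 + i) < deg"
  using assms
proof (induction i rule: inc_induct)
  case base
  have "r + 1 + k = n" by (simp add: n_eq r_eq)
  then show ?case using weight_n(1) deg_gt_1 by simp
next
  case (step i)
  have w: "0 < weight (succ_ix j) \<Longrightarrow> weight (succ_ix j) < deg \<Longrightarrow> 0 < weight j \<and> weight j < deg"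
    if "j \<in> {z..n + 1}" for j
  proof -
    assume a: "0 < weight (succ_ix j)" "weight (succ_ix j) < deg"
    have e: "2 \<le> expo j" using that by (intro expo_ge_2) simp
    have "expo j * weight j = deg - weight (succ_ix j)" using weight_step[OF that] by simp
    then have p: "0 < expo j * weight j" "expo j * weight j < deg" using a by auto
    then have "0 < weight j" using e by (simp add: zero_less_mult_iff)
    then have "1 * weight j \<le> expo j * weight j" using e by (intro mult_right_mono) auto
    then show ?thesis using p \<open>0 < weight j\<close> by linarith
  qed
  have ix: "succ_ix (r - i) = r + 1 + Suc i" "succ_ix (r + 1 + i) = r - i"
    "r - i \<in> {z..n + 1}" "r + 1 + i \<in> {z..n + 1}"
    using step.hyps by (auto simp: loop_succ_def r_eq n_eq)
  show ?case using w[OF ix(3)] w[OF ix(4)] step.IH unfolding ix(1,2) by simp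
qed

lemma weight_pos:
  assumes "j \<le> n + 1"
  shows "0 < weight j"
proof -
  have pos: "0 < weight j" if "j \<in> {z..n + 1}" "weight (succ_ix j) < deg" for j
  proof -
    have "0 < expo j * weight j" using weight_step[OF that(1)] that(2) by simp
    moreover have "2 \<le> expo j" using that by (intro expo_ge_2) simp
    ultimately show ?thesis by (simp add: zero_less_mult_iff)
  qed
  consider "j = n + 1" | "j = z" | "j < z" | "z < j" "j \<le> r" | "r < j" "j \<le> n"
    using assms by linarith
  then show ?thesis
  proof cases
    case 1
    then show ?thesis using weight_n by simp
  next
    case 2
    have "weight (succ_ix z) < deg" using weight_n(2) deg_gt_1 by (simp add: succ_ix_z)
    then show ?thesis using pos[of z] 2 by (simp add: n_eq)
  next
    case 3
    then have "z = 1" "j = 0" using z_le by auto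
    then have "2 * weight j = deg" using weight_0 by blast
    then show ?thesis using deg_gt_1 by linarith
  next
    case 4
    then have "succ_ix j = r + 1 + (r - j + 1)" "r - j + 1 \<le> k" by (auto simp: loop_succ_def r_eq)
    then have "weight (succ_ix j) < deg" using weight_pos_high by metis
    then show ?thesis using pos[of j] 4 assms by simp
  next
    case 5
    then have "j = r + 1 + (j - r - 1)" "j - r - 1 \<le> k" by (auto simp: r_eq n_eq)
    then show ?thesis using weight_pos_high by metis
  qed
qed

lemma weight_partial_sum:
  assumes "i \<le> k"
  shows "(\<Sum>j=r + 1 - i..r + 1 + i. weight j) = deg * zB r i - v_top n * zU r i"
  using assms
proof (induction i)
  case 0
  then show ?case using sol_simps(2)[of 0 deg 1] by (simp add: loop_weight_def n_eq r_eq)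
next
  case (Suc i)
  have "{r + 1 - Suc i..r + 1 + Suc i} = insert (r - i) (insert (r + 1 + Suc i) {r + 1 - i..r + 1 + i})"
    using Suc.prems k_le_r by auto
  moreover have "r - i \<notin> insert (r + 1 + Suc i) {r + 1 - i..r + 1 + i}" "r + 1 + Suc i \<notin> {r + 1 - i..r + 1 + i}"
    using Suc.prems k_le_r by auto
  ultimately have sum: "(\<Sum>j=r + 1 - Suc i..r + 1 + Suc i. weight j)
    = weight (r - i) + (weight (r + 1 + Suc i) + (\<Sum>j=r + 1 - i..r + 1 + i. weight j))"
    by (simp del: One_nat_def)
  have ix: "succ_ix (r - i) = r + 1 + Suc i" "succ_ix (r + 1 + i) = r - i"
    "r - i \<in> {z..n + 1}" "r + 1 + i \<in> {z..n + 1}" "expo (r - i) = bseq r (r - i)"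
    "expo (r + 1 + i) = bseq r (r + 1 + i)"
    using Suc.prems by (auto simp: loop_succ_def loop_expo_def r_eq n_eq)
  have low: "weight (r - i) = deg - bseq r (r + 1 + i) * weight (r + 1 + i)"
    using weight_step[OF ix(4)] unfolding ix by simp
  have high: "weight (r + 1 + Suc i) = deg - bseq r (r - i) * weight (r - i)"
    using weight_step[OF ix(3)] unfolding ix by simp
  have w: "weight (r + 1 + i) = deg * zW r i - v_top n * zP r i"
    using sol_simps(2)[of i deg 1] Suc.prems by (simp add: loop_weight_def n_eq r_eq)
  have IH: "(\<Sum>j=r + 1 - i..r + 1 + i. weight j) = deg * zB r i - v_top n * zU r i" using Suc by simp
  show ?case unfolding sum high low w IH z_Suc by (simp add: algebra_simps)
qed

lemma weight_sum: "(\<Sum>j\<le>n + 1. weight j) = deg"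
proof -
  define S where "S = (\<Sum>j=z + 1..n. weight j)"
  have "r + 1 - k = z + 1" "r + 1 + k = n" by (simp_all add: r_eq n_eq)
  then have "S = deg * zB r k - v_top n * zU r k" unfolding S_def using weight_partial_sum[of k] by simp
  then have S: "s * (s - 1) * S = deg - (s - 1)\<^sup>2"
    using zP_identity unfolding v_top_eq loop_deg_def by algebra
  have split: "{..n + 1} = {..<z} \<union> {z, n + 1} \<union> {z + 1..n}" by (auto simp: n_eq)
  have "(\<Sum>j\<le>n + 1. weight j) = (\<Sum>j<z. weight j) + (\<Sum>j\<in>{z, n + 1}. weight j) + S"
    unfolding split S_def by (subst sum.union_disjoint; (subst sum.union_disjoint)?) (auto simp: n_eq)
  moreover have "(\<Sum>j\<in>{z, n + 1}. weight j) = deg - b_top n + 1"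
    using weight_z weight_n(2) by (simp add: n_eq)
  ultimately have sum: "(\<Sum>j\<le>n + 1. weight j) = (\<Sum>j<z. weight j) + (deg - b_top n + 1) + S" by simp
  show ?thesis using z_cases
  proof
    assume z: "z = 0"
    have s2: "s = 2" by (simp add: z)
    have "(\<Sum>j<z. weight j) = 0" by (simp add: z)
    then show ?thesis using S b_top_eq sum unfolding s2 by simp
  next
    assume z: "z = 1"
    have s3: "s = 3" by (simp add: z sylvester_1_2)
    have "{..<z} = {0}" using z by auto
    then have "(\<Sum>j<z. weight j) = weight 0" by simp
    then show ?thesis using S b_top_eq sum weight_0[OF z] unfolding s3 by simp
  qed
qed

subsection \<open>The exponents of the group action\<close>

lemma dexp_sol: "z \<le> j \<Longrightarrow> j \<le> n + 1 \<Longrightarrow> dexp j = sol 1 0 j"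
  by (simp add: act_exp_def)

lemma dexp_simps: "dexp (n + 1) = 0" "dexp n = zW r k" "dexp z = 1 - b_top n * zW r k"
proof -
  have "z \<le> n" using n_eq by simp
  then show "dexp (n + 1) = 0" "dexp n = zW r k" "dexp z = 1 - b_top n * zW r k"
    using dexp_sol[of "n + 1"] dexp_sol[of n] dexp_sol[of z] unfolding sol_simps by simp_all
qed

text \<open>At \<open>j = z\<close> the two sides of the equation differ by exactly \<open>m'\<close>; at the other indices they
  agree.\<close>

lemma dexp_step:
  assumes "j \<in> {z..n + 1}"
  shows "m_val n dvd expo j * dexp j + dexp (succ_ix j) - 1"
proof (cases "j = z")
  case True
  have "expo z * dexp z + dexp (succ_ix z) - 1 = - m_val n"
    unfolding expo_z succ_ix_z dexp_simps m_val_eq by (simp add: algebra_simps)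
  then show ?thesis unfolding True by simp
next
  case False
  then have "expo j * dexp j + dexp (succ_ix j) = 1"
    using sol_step[OF assms] succ_pred(1)[OF assms] assms by (simp add: act_exp_def)
  then show ?thesis by simp
qed

lemma odd_m_val: "z = 1 \<Longrightarrow> odd (m_val n)"
proof -
  assume z: "z = 1"
  have s: "s = 3" by (simp add: z sylvester_1_2)
  have "3 * b_top n = 1 + 2 * deg" using b_top_eq unfolding s by simp
  then have "odd (b_top n)" by presburger
  then show ?thesis unfolding m_val_eq using odd_zW[OF k_le_r] s by simp
qed

lemma dexp_0:
  assumes "z = 1"
  shows "2 * dexp 0 = m_val n + 1"
proof -
  have "0 < z" using assms by simp
  then have "dexp 0 = (m_val n + 1) div 2" by (simp add: act_exp_def)
  then show ?thesis using odd_m_val[OF assms] by presburger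
qed

lemma coprime_dexp:
  "coprime (zW r k) (m_val n)" "coprime (dexp z) (m_val n)" "coprime (zP r k * v_top n) (m_val n)"
proof -
  show "coprime (zW r k) (m_val n)"
  proof (rule coprimeI)
    fix c assume c: "c dvd zW r k" "c dvd m_val n"
    have "c dvd s * b_top n * zW r k - m_val n" using c by simp
    then have "c dvd s - 1" by (simp add: m_val_eq)
    show "is_unit c" using z_cases
    proof
      assume "z = 0"
      then show ?thesis using \<open>c dvd s - 1\<close> by simp
    next
      assume "z = 1"
      then have "c dvd 2" using \<open>c dvd s - 1\<close> by (simp add: sylvester_1_2)
      moreover have "coprime 2 (zW r k)" using odd_zW[OF k_le_r] by simp
      ultimately show ?thesis using c(1) by (meson coprime_common_divisor)
    qed
  qed
  show "coprime (dexp z) (m_val n)"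
  proof (rule coprimeI)
    fix c assume c: "c dvd dexp z" "c dvd m_val n"
    have "m_val n + s * dexp z = 1" unfolding dexp_simps m_val_eq by (simp add: algebra_simps)
    then show "is_unit c" using c by (metis dvd_add dvd_mult)
  qed
  show "coprime (zP r k * v_top n) (m_val n)"
  proof (rule coprimeI)
    fix c assume c: "c dvd zP r k * v_top n" "c dvd m_val n"
    have "c dvd deg * m_val n - zP r k * v_top n * (s * b_top n)" using c by simp
    then show "is_unit c" by (simp add: deg_m_val)
  qed
qed

end

section \<open>The defining polynomial\<close>

lemma keys_sum_single_one:
  fixes \<mu> :: "'i \<Rightarrow> 'm"
  assumes "finite K"
  shows "Poly_Mapping.keys (\<Sum>i\<in>K. Poly_Mapping.single (\<mu> i) (1 :: complex)) = \<mu> ` K"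
proof -
  have "Poly_Mapping.lookup (\<Sum>i\<in>K. Poly_Mapping.single (\<mu> i) (1 :: complex)) m = of_nat (card {i \<in> K. \<mu> i = m})" for m
    using assms by (simp add: lookup_sum lookup_single when_def sum.If_cases Int_def)
  then show ?thesis using assms by (auto simp: in_keys_iff card_eq_0_iff)
qed

lemma weight_single:
  fixes a :: "nat \<Rightarrow> nat"
  shows "(\<Sum>i\<in>Poly_Mapping.keys (Poly_Mapping.single j e). a i * Poly_Mapping.lookup (Poly_Mapping.single j e) i) = a j * e"
  by simp

text \<open>Along a permutation, a nonnegative quantity cannot be multiplied by at least \<open>2\<close> in every
  step unless it vanishes.\<close>

lemma expanding_permutation_zero:
  fixes g e :: "'i \<Rightarrow> 'a :: linordered_idom"
  assumes "finite I" "bij_betw \<pi> I I" and "\<And>i. i \<in> I \<Longrightarrow> 0 \<le> g i" "\<And>i. i \<in> I \<Longrightarrow> 2 \<le> e i"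
    and "\<And>i. i \<in> I \<Longrightarrow> g (\<pi> i) = e i * g i"
  shows "\<forall>i\<in>I. g i = 0"
proof -
  have "(\<Sum>i\<in>I. 2 * g i) \<le> (\<Sum>i\<in>I. e i * g i)"
    using assms by (intro sum_mono mult_right_mono) auto
  also have "\<dots> = (\<Sum>i\<in>I. g (\<pi> i))" using assms by simp
  also have "\<dots> = (\<Sum>i\<in>I. g i)" by (rule sum.reindex_bij_betw[OF assms(2)])
  finally have "2 * (\<Sum>i\<in>I. g i) \<le> (\<Sum>i\<in>I. g i)" by (simp add: sum_distrib_left)
  moreover have "0 \<le> (\<Sum>i\<in>I. g i)" using assms(3) by (rule sum_nonneg)
  ultimately have "(\<Sum>i\<in>I. g i) = 0" by linarith
  then show ?thesis using assms(1,3) by (simp add: sum_nonneg_eq_0_iff)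
qed

context loop_hypersurface
begin

abbreviation "nexp j \<equiv> nat (expo j)"

lemma nexp_ge_2: "j \<le> n + 1 \<Longrightarrow> 2 \<le> nexp j"
  using expo_ge_2[of j] by simp

lemma int_nexp: "j \<le> n + 1 \<Longrightarrow> int (nexp j) = expo j"
  using expo_ge_2[of j] by simp

text \<open>The exponent vectors of the monomials of the polynomial; an index \<open>j < z\<close> stands for the
  monomial \<open>x\<^sub>0\<^sup>2\<close>.\<close>

definition mono_ix :: "nat \<Rightarrow> (nat \<Rightarrow>\<^sub>0 nat)" where
  "mono_ix j = (if j < z then Poly_Mapping.single 0 2
     else Poly_Mapping.single j (nexp j) + Poly_Mapping.single (succ_ix j) 1)"

lemma V_poly_eq: "V_poly n = (\<Sum>j\<le>n + 1. Poly_Mapping.single (mono_ix j) 1)"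
proof -
  define t where "t = (\<lambda>j. xpow j (nexp j) * xpow (succ_ix j) 1)"
  have t: "Poly_Mapping.single (mono_ix j) 1 = t j" if "z \<le> j" for j
    using that by (simp add: mono_ix_def t_def xpow_def mult_single)
  have low: "xpow i (nat (bseq r i)) * xpow (2 * r + 2 - i) 1 = t i" if "i \<le> r" for i
    using that n_eq r_eq z_le by (simp add: t_def loop_expo_def loop_succ_def)
  have high: "xpow (r + j) (nat (bseq r (r + j))) * xpow (r + 1 - j) 1 = t (r + j)" if "1 \<le> j" "j \<le> k" for j
  proof -
    have "succ_ix (r + j) = r + 1 - j" "expo (r + j) = bseq r (r + j)"
      using that n_eq r_eq by (simp_all add: loop_expo_def loop_succ_def)
    then show ?thesis by (simp add: t_def)
  qed
  have shift: "(\<Sum>j=1..k. t (r + j)) = (\<Sum>j=r + 1..r + k. t j)"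
    using sum.shift_bounds_cl_nat_ivl[of t 1 r k] by (simp add: add.commute)
  have tn: "xpow n (nat (b_top n)) * xpow z 1 = t n"
    using n_eq r_eq z_le by (simp add: t_def loop_expo_def loop_succ_def)
  have tn1: "xpow (n + 1) (nat (v_top n)) * xpow (r + 1) 1 = t (n + 1)"
    using n_eq r_eq z_le by (simp add: t_def loop_expo_def loop_succ_def)
  have split: "{z..n + 1} = {z..r} \<union> {r + 1..r + k} \<union> {n, n + 1}" using n_eq r_eq by auto
  have loop: "(\<Sum>j=z..n + 1. t j) = (\<Sum>j=z..r. t j) + (\<Sum>j=r + 1..r + k. t j) + t n + t (n + 1)"
    unfolding split using n_eq r_eq by (subst sum.union_disjoint; (subst sum.union_disjoint)?) auto
  have all: "{..n + 1} = {..<z} \<union> {z..n + 1}" using n_eq by auto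
  have rhs: "(\<Sum>j\<le>n + 1. Poly_Mapping.single (mono_ix j) 1)
      = (\<Sum>j<z. Poly_Mapping.single (mono_ix j) 1) + (\<Sum>j=z..n + 1. t j)"
    unfolding all by (subst sum.union_disjoint) (auto simp: t)
  show ?thesis using z_cases
  proof
    assume z: "z = 0"
    have nr: "2 * r + 1 = n" "2 * r + 2 = n + 1" "k = r" using z n_eq r_eq by auto
    have "V_poly n = (\<Sum>j=0..r. t j) + (\<Sum>j=1..r. t (r + j)) + t n + t (n + 1)"
      unfolding V_poly_def Let_def n_div_2 using odd_n_iff z low high tn tn1 nr
      by (simp add: add.commute)
    then show ?thesis unfolding rhs loop shift[symmetric] using z nr by simp
  next
    assume z: "z = 1"
    have nr: "2 * r = n" "2 * r + 1 = n + 1" "r - 1 = k" using z n_eq r_eq by auto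
    have "V_poly n = xpow 0 2 + (\<Sum>j=1..r. t j) + (\<Sum>j=1..k. t (r + j)) + t n + t (n + 1)"
      unfolding V_poly_def Let_def n_div_2 using odd_n_iff z low high tn tn1 nr bseq_low[of 0 r]
      by simp
    moreover have "{..<z} = {0}" using z by auto
    moreover have "0 < z" using z by simp
    then have "Poly_Mapping.single (mono_ix 0) 1 = xpow 0 2" by (simp add: mono_ix_def xpow_def del: single_numeral)
    ultimately show ?thesis unfolding rhs loop shift[symmetric] using z by (simp add: add.assoc)
  qed
qed

lemma whomogeneous_V_iff:
  "whomogeneous a (n + 1) d (V_poly n) \<longleftrightarrow>
     (\<forall>j\<in>{z..n + 1}. a j * nexp j + a (succ_ix j) = d) \<and> (z = 1 \<longrightarrow> 2 * a 0 = d)"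
proof -
  have keys: "Poly_Mapping.keys (mono_ix j) \<subseteq> {..n + 1}" if "j \<le> n + 1" for j
  proof (cases "j < z")
    case False
    then have "succ_ix j \<le> n + 1" using succ_pred(1)[of j] that by auto
    then show ?thesis
      using False that keys_add[of "Poly_Mapping.single j (nexp j)" "Poly_Mapping.single (succ_ix j) (1::nat)"]
      by (auto simp: mono_ix_def split: if_splits)
  qed (simp add: mono_ix_def del: single_numeral)
  have w: "(\<Sum>i\<in>Poly_Mapping.keys (mono_ix j). a i * Poly_Mapping.lookup (mono_ix j) i) =
      (if j < z then a 0 * 2 else a j * nexp j + a (succ_ix j))" for j
  proof (cases "j < z")
    case True
    then have "mono_ix j = Poly_Mapping.single 0 2" by (simp add: mono_ix_def del: single_numeral)
    then show ?thesis using True weight_single[of a 0 2] by (simp only: if_True)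
  next
    case False
    then show ?thesis by (simp add: mono_ix_def weight_add)
  qed
  have "whomogeneous a (n + 1) d (V_poly n) \<longleftrightarrow>
      (\<forall>j\<le>n + 1. (if j < z then a 0 * 2 else a j * nexp j + a (succ_ix j)) = d)"
    unfolding whomogeneous_def V_poly_eq by (subst keys_sum_single_one) (use keys in \<open>auto simp: w\<close>)
  also have "\<dots> \<longleftrightarrow> (\<forall>j\<in>{z..n + 1}. a j * nexp j + a (succ_ix j) = d) \<and> (z = 1 \<longrightarrow> 2 * a 0 = d)"
    using z_cases by auto
  finally show ?thesis .
qed

text \<open>The value of the loop monomial with index \<open>j\<close>.\<close>

definition term_at :: "nat \<Rightarrow> (nat \<Rightarrow> complex) \<Rightarrow> complex" where
  "term_at j x = x j ^ nexp j * x (succ_ix j)"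

abbreviation F :: "(nat \<Rightarrow> complex) \<Rightarrow> complex" where "F \<equiv> peval (V_poly n)"

lemma peval_V: "F x = (\<Sum>j=z..n + 1. term_at j x) + (if z = 1 then x 0 ^ 2 else 0)"
proof -
  have all: "{..n + 1} = {..<z} \<union> {z..n + 1}" using n_eq by auto
  have m: "monom_eval (mono_ix j) x = (if j < z then x 0 ^ 2 else term_at j x)" for j
    by (simp add: mono_ix_def term_at_def monom_eval_add monom_eval_single del: single_numeral)
  have "F x = (\<Sum>j<z. monom_eval (mono_ix j) x) + (\<Sum>j=z..n + 1. monom_eval (mono_ix j) x)"
    unfolding V_poly_eq peval_sum peval_single all by (subst sum.union_disjoint) auto
  also have "(\<Sum>j<z. monom_eval (mono_ix j) x) = (if z = 1 then x 0 ^ 2 else 0)"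
    using z_cases by (auto simp: m)
  also have "(\<Sum>j=z..n + 1. monom_eval (mono_ix j) x) = (\<Sum>j=z..n + 1. term_at j x)"
    by (intro sum.cong) (auto simp: m)
  finally show ?thesis by simp
qed

lemma succ_ne: "j \<in> {z..n + 1} \<Longrightarrow> succ_ix j \<noteq> j"
  using n_eq r_eq z_cases r_pos by (auto simp: loop_succ_def)

lemma succ_succ_ne: "j \<in> {z..n + 1} \<Longrightarrow> succ_ix (succ_ix j) \<noteq> j"
  using n_eq r_eq z_cases r_pos by (auto simp: loop_succ_def)

lemma pred_ne: "j \<in> {z..n + 1} \<Longrightarrow> pred_ix j \<noteq> j"
  by (metis succ_ne succ_pred(4))

text \<open>The part of the polynomial that does not involve \<open>x\<^sub>i\<close>, for an index \<open>i\<close> of the cycle: only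
  the monomials of \<open>i\<close> and of its predecessor contain \<open>x\<^sub>i\<close>.\<close>

definition rest :: "nat \<Rightarrow> (nat \<Rightarrow> complex) \<Rightarrow> complex" where
  "rest i x = (\<Sum>j\<in>{z..n + 1} - {i, pred_ix i}. term_at j x) + (if z = 1 then x 0 ^ 2 else 0)"

lemma F_split:
  assumes "i \<in> {z..n + 1}"
  shows "F x = x i ^ nexp i * x (succ_ix i) + x (pred_ix i) ^ nexp (pred_ix i) * x i + rest i x"
proof -
  have "{z..n + 1} = insert i (insert (pred_ix i) ({z..n + 1} - {i, pred_ix i}))"
    using assms succ_pred(2)[OF assms] by blast
  then have "(\<Sum>j=z..n + 1. term_at j x) = (\<Sum>j\<in>insert i (insert (pred_ix i) ({z..n + 1} - {i, pred_ix i})). term_at j x)"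
    by metis
  also have "\<dots> = term_at i x + (term_at (pred_ix i) x + (\<Sum>j\<in>{z..n + 1} - {i, pred_ix i}. term_at j x))"
    using pred_ne[OF assms] by (subst sum.insert; (subst sum.insert)?) auto
  finally show ?thesis unfolding peval_V rest_def by (simp add: term_at_def succ_pred(4)[OF assms])
qed

lemma rest_polyfuns:
  assumes "i \<in> {z..n + 1}"
  shows "rest i \<in> polyfuns (- {i})"
proof -
  have terms: "(\<lambda>x. term_at j x) \<in> polyfuns (- {i})" if "j \<in> {z..n + 1} - {i, pred_ix i}" for j
  proof -
    have "j \<noteq> i" "succ_ix j \<noteq> i" using that succ_pred(3)[of j] by auto
    then show ?thesis unfolding term_at_def by (intro polyfuns_intros) auto
  qed
  have "(\<lambda>x. if z = 1 then x 0 ^ 2 else 0) \<in> polyfuns (- {i})"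
  proof (cases "z = 1")
    case True
    then show ?thesis using assms by (auto intro!: polyfuns_intros)
  qed (simp add: polyfuns.const)
  then have "(\<lambda>x. rest i x) \<in> polyfuns (- {i})"
    unfolding rest_def using terms by (intro polyfuns.add polyfuns_sum)
  then show ?thesis by simp
qed

lemma F_upd:
  assumes "i \<in> {z..n + 1}"
  shows "F (x(i := w)) = w ^ nexp i * x (succ_ix i) + x (pred_ix i) ^ nexp (pred_ix i) * w + rest i x"
  using F_split[OF assms, of "x(i := w)"] succ_ne[OF assms] pred_ne[OF assms]
    polyfuns_upd[OF rest_polyfuns[OF assms], of i x w] by simp

lemma loop_part_polyfuns: "(\<lambda>x. \<Sum>j=z..n + 1. term_at j x) \<in> polyfuns {z..n + 1}"
proof -
  have "succ_ix j \<in> {z..n + 1}" if "j \<in> {z..n + 1}" for j using succ_pred(1)[OF that] .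
  then show ?thesis unfolding term_at_def by (intro polyfuns_intros) auto
qed

subsection \<open>Uniqueness of the weights\<close>

abbreviation "nweight j \<equiv> nat (weight j)"
abbreviation "ndeg \<equiv> nat deg"

lemma int_nweight: "j \<le> n + 1 \<Longrightarrow> int (nweight j) = weight j"
  using weight_pos[of j] by simp

lemma int_ndeg: "int ndeg = deg"
  using deg_gt_1 by simp

lemma nweight_n: "nweight n = 1" "nweight (n + 1) = 1"
  using weight_n by simp_all

lemma whomogeneous_V: "whomogeneous nweight (n + 1) ndeg (V_poly n)"
  unfolding whomogeneous_V_iff
proof (intro conjI ballI impI)
  fix j assume j: "j \<in> {z..n + 1}"
  have "int (nweight j * nexp j + nweight (succ_ix j)) = int ndeg"
    using weight_step[OF j] int_nweight[of j] int_nweight[of "succ_ix j"] succ_pred(1)[OF j] int_nexp[of j] j int_ndeg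
    by (simp add: mult.commute del: int_nat_eq of_nat_nat)
  then show "nweight j * nexp j + nweight (succ_ix j) = ndeg" using of_nat_eq_iff by blast
next
  assume z: "z = 1"
  show "2 * nweight 0 = ndeg" using weight_0[OF z] by linarith
qed

lemma V_weights_iff: "V_weights n a d \<longleftrightarrow> a = nweight \<and> d = ndeg"
proof
  assume V: "V_weights n a d"
  then have a: "\<forall>j\<in>{z..n + 1}. a j * nexp j + a (succ_ix j) = d" "z = 1 \<Longrightarrow> 2 * a 0 = d"
    "Gcd (a ` {..n + 1}) = 1" "\<forall>i>n + 1. a i = 0"
    unfolding V_weights_def whomogeneous_V_iff by blast+
  \<comment> \<open>\<open>g\<close> measures how far \<open>a\<close> is from being proportional to the known solution\<close>
  define g where "g = (\<lambda>j. int (a j) * deg - weight j * int d)"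
  have g_step: "g (succ_ix j) = - expo j * g j" if j: "j \<in> {z..n + 1}" for j
  proof -
    have "a j * nexp j + a (succ_ix j) = d" using a(1) j by blast
    then have "int (a j * nexp j + a (succ_ix j)) = int d" by (rule arg_cong)
    then have "int (a j) * expo j + int (a (succ_ix j)) = int d" using int_nexp[of j] j by simp
    then have a1: "int (a (succ_ix j)) = int d - int (a j) * expo j" by simp
    have w1: "weight (succ_ix j) = deg - expo j * weight j" using weight_step[OF j] by simp
    show ?thesis unfolding g_def a1 w1 by (simp add: algebra_simps)
  qed
  have "\<forall>j\<in>{z..n + 1}. \<bar>g j\<bar> = 0"
  proof (rule expanding_permutation_zero[OF _ bij_succ_ix, where e = expo])
    fix j assume j: "j \<in> {z..n + 1}"
    show e: "2 \<le> expo j" using expo_ge_2 j by simp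
    show "\<bar>g (succ_ix j)\<bar> = expo j * \<bar>g j\<bar>" using e unfolding g_step[OF j] by (simp add: abs_mult)
  qed auto
  moreover have "g 0 = 0" if "z = 1"
  proof -
    have "2 * int (a 0) = int d" using a(2)[OF that] by linarith
    moreover have "2 * g 0 = (2 * int (a 0)) * deg - (2 * weight 0) * int d"
      by (simp add: g_def algebra_simps)
    ultimately show ?thesis unfolding weight_0[OF that] by simp
  qed
  ultimately have g0: "g j = 0" if "j \<le> n + 1" for j
    using that z_cases by (cases "j = 0") auto
  have "int d = int (a n) * deg" using g0[of n] weight_n(1) by (simp add: g_def)
  then have zero: "(int (a j) - weight j * int (a n)) * deg = 0" if "j \<le> n + 1" for j
    using g0[OF that] by (simp add: g_def algebra_simps)
  then have aj: "int (a j) = weight j * int (a n)" if "j \<le> n + 1" for j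
  proof -
    have "int (a j) - weight j * int (a n) = 0 \<or> deg = 0"
      using zero[OF that] by (simp only: mult_eq_0_iff)
    then show ?thesis using deg_gt_1 by linarith
  qed
  have "a n dvd a j" if "j \<le> n + 1" for j
  proof -
    have "int (a n) dvd int (a j)" unfolding aj[OF that] by simp
    then show ?thesis by simp
  qed
  then have "a n dvd Gcd (a ` {..n + 1})" by (intro Gcd_greatest) auto
  then have an: "a n = 1" using a(3) by simp
  have "a j = nweight j" for j
  proof (cases "j \<le> n + 1")
    case True
    then show ?thesis using aj[OF True] an by simp
  next
    case False
    then show ?thesis using a(4) by (simp add: loop_weight_def)
  qed
  moreover have "d = ndeg" using \<open>int d = int (a n) * deg\<close> an by simp
  ultimately show "a = nweight \<and> d = ndeg" by blast
next
  assume ad: "a = nweight \<and> d = ndeg"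
  have "Gcd (nweight ` {..n + 1}) dvd 1"
    using nweight_n(1) by (intro Gcd_dvd) (auto simp: image_iff intro!: bexI[of _ n])
  then show "V_weights n a d"
    using ad whomogeneous_V weight_pos by (auto simp: V_weights_def loop_weight_def)
qed

subsection \<open>Quasi-smoothness\<close>

lemma quasi_smooth: "quasi_smooth_hypersurface (n + 1) (V_poly n)"
  unfolding quasi_smooth_hypersurface_def
proof (intro ballI impI)
  fix x :: "nat \<Rightarrow> complex" assume x: "x \<in> affine_space (n + 1) - {\<lambda>_. 0}"
  show "\<exists>i\<le>n + 1. deriv (\<lambda>w. F (x(i := w))) (x i) \<noteq> 0"
  proof (rule ccontr)
    assume "\<not> ?thesis"
    then have crit: "deriv (\<lambda>w. F (x(i := w))) (x i) = 0" if "i \<le> n + 1" for i using that by blast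
    have eq: "of_nat (nexp i) * x i ^ (nexp i - 1) * x (succ_ix i) + x (pred_ix i) ^ nexp (pred_ix i) = 0"
      if i: "i \<in> {z..n + 1}" for i
    proof -
      have "((\<lambda>w. F (x(i := w))) has_field_derivative
          of_nat (nexp i) * x i ^ (nexp i - 1) * x (succ_ix i) + x (pred_ix i) ^ nexp (pred_ix i)) (at (x i))"
        unfolding F_upd[OF i] by (auto intro!: derivative_eq_intros)
      then show ?thesis using crit[of i] i DERIV_imp_deriv by fastforce
    qed
    \<comment> \<open>multiply the \<open>i\<close>-th partial derivative by \<open>x\<^sub>i\<close>\<close>
    have "term_at (pred_ix i) x = - of_nat (nexp i) * term_at i x" if i: "i \<in> {z..n + 1}" for i
    proof -
      have "nexp i = Suc (nexp i - 1)" using nexp_ge_2[of i] i by simp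
      then have "x i ^ nexp i = x i * x i ^ (nexp i - 1)" by (metis power_Suc)
      then have "of_nat (nexp i) * term_at i x + term_at (pred_ix i) x
          = x i * (of_nat (nexp i) * x i ^ (nexp i - 1) * x (succ_ix i) + x (pred_ix i) ^ nexp (pred_ix i))"
        by (simp add: term_at_def succ_pred(4)[OF i] algebra_simps)
      then show ?thesis unfolding eq[OF i] by (simp add: add_eq_0_iff)
    qed
    then have step: "norm (term_at (pred_ix i) x) = of_nat (nexp i) * norm (term_at i x)" if "i \<in> {z..n + 1}" for i
      using that by (simp add: norm_mult)
    have "bij_betw pred_ix {z..n + 1} {z..n + 1}"
      by (rule bij_betw_byWitness[of _ succ_ix]) (use succ_pred in auto)
    then have "\<forall>i\<in>{z..n + 1}. norm (term_at i x) = 0"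
    proof (rule expanding_permutation_zero[rotated, where e = "\<lambda>i. of_nat (nexp i)"])
      fix i assume "i \<in> {z..n + 1}"
      then have "real 2 \<le> real (nexp i)" using nexp_ge_2[of i] by (intro of_nat_mono) simp
      then show "2 \<le> real (nexp i)" by simp
    qed (use step in auto)
    then have zero: "term_at i x = 0" if "i \<in> {z..n + 1}" for i using that by simp
    have x0: "x i = 0" if i: "i \<in> {z..n + 1}" for i
    proof (rule ccontr)
      assume "x i \<noteq> 0"
      then have "x (succ_ix i) = 0" using zero[OF i] by (simp add: term_at_def)
      then have "x i ^ nexp i = 0"
        using eq[OF succ_pred(1)[OF i]] nexp_ge_2[of "succ_ix i"] succ_pred(1)[OF i] succ_pred(3)[OF i]
        by (simp add: power_0_left)
      then show False using \<open>x i \<noteq> 0\<close> by simp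
    qed
    have "x 0 = 0" if z: "z = 1"
    proof -
      have "F (x(0 := w)) = w ^ 2 + (\<Sum>j=z..n + 1. term_at j x)" for w
        using polyfuns_upd[OF loop_part_polyfuns, of 0 x w] z unfolding peval_V by simp
      then have "((\<lambda>w. F (x(0 := w))) has_field_derivative 2 * x 0) (at (x 0))"
        by (auto intro!: derivative_eq_intros)
      then show ?thesis using crit[of 0] DERIV_imp_deriv by fastforce
    qed
    then have "x i = 0" for i
      using x x0 z_cases by (cases "i = 0"; cases "i \<le> n + 1") (auto simp: affine_space_def)
    then show False using x by auto
  qed
qed

subsection \<open>Irreducibility of the cone and of two hyperplane sections\<close>

text \<open>The vector with coordinate \<open>1\<close> at the indices in \<open>S\<close> and \<open>0\<close> elsewhere.\<close>

definition indic :: "nat set \<Rightarrow> nat \<Rightarrow> complex" where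
  "indic S i = (if i \<in> S then 1 else 0)"

lemma F_indic:
  "F (indic S) = of_nat (card {j \<in> {z..n + 1}. j \<in> S \<and> succ_ix j \<in> S}) + (if z = 1 \<and> 0 \<in> S then 1 else 0)"
proof -
  have "term_at j (indic S) = (if j \<in> S \<and> succ_ix j \<in> S then 1 else 0)" if "j \<in> {z..n + 1}" for j
    using that nexp_ge_2[of j] by (auto simp: term_at_def indic_def power_0_left)
  then have "(\<Sum>j=z..n + 1. term_at j (indic S)) = (\<Sum>j=z..n + 1. if j \<in> S \<and> succ_ix j \<in> S then 1 else 0)"
    by (intro sum.cong) auto
  also have "\<dots> = of_nat (card {j \<in> {z..n + 1}. j \<in> S \<and> succ_ix j \<in> S})"
    by (subst sum.inter_filter[symmetric]) simp_all
  finally show ?thesis unfolding peval_V by (auto simp: indic_def)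
qed

lemma F_coordinate_point: "i \<in> {z..n + 1} \<Longrightarrow> F (indic {i}) = 0"
proof -
  assume i: "i \<in> {z..n + 1}"
  have "{j \<in> {z..n + 1}. j \<in> {i} \<and> succ_ix j \<in> {i}} = {}" using succ_ne[OF i] by auto
  then show ?thesis unfolding F_indic using i by auto
qed

lemma F_indic_0: "z = 1 \<Longrightarrow> F (indic {0}) = 1"
proof -
  assume z: "z = 1"
  then have "{j \<in> {z..n + 1}. j \<in> {0} \<and> succ_ix j \<in> {0}} = {}" by auto
  then show ?thesis unfolding F_indic using z by simp
qed

lemma F_indic_pair:
  assumes "z = 0" "i \<in> {z..n + 1}"
  shows "F (indic {i, succ_ix i}) = 1"
proof -
  have "{j \<in> {z..n + 1}. j \<in> {i, succ_ix i} \<and> succ_ix j \<in> {i, succ_ix i}} = {i}"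
    using assms succ_ne[OF assms(2)] succ_succ_ne[OF assms(2)] succ_pred(1)[OF assms(2)]
      succ_ne[OF succ_pred(1)[OF assms(2)]] by auto
  then show ?thesis unfolding F_indic using assms by simp
qed

lemma ix_facts: "1 \<in> {z..n + 1}" "n \<in> {z..n + 1}" "n + 1 \<in> {z..n + 1}" "z \<in> {z..n + 1}" "r + 1 \<in> {z..n + 1}"
  "z \<noteq> n" "z \<noteq> n + 1" "2 \<le> n" "pred_ix z = n" "pred_ix (n + 1) = z"
  using n_eq r_eq z_cases r_pos by (auto simp: loop_pred_def)

text \<open>The polynomial is cubic in \<open>x\<^sub>1\<close>, because \<open>b\<^sub>1 = s\<^sub>1 = 3\<close>.\<close>

lemma F_slice_1:
  "F (x(1 := w)) = w ^ 3 * x (succ_ix 1) + x (pred_ix 1) ^ nexp (pred_ix 1) * w + rest 1 x"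
proof -
  have "expo 1 = 3" using ix_facts(8) r_pos by (simp add: loop_expo_def bseq_low sylvester_1_2)
  then show ?thesis using F_upd[OF ix_facts(1), of x w] by simp
qed

lemma odd_degree_cubic: "a \<noteq> 0 \<Longrightarrow> odd (degree [:c, b, 0, a :: complex:])"
  by simp

lemma prime_zeros_F: "prime_zeros F"
  using z_cases
proof
  assume z: "z = 0"
  define E where "E = (\<lambda>x::nat \<Rightarrow> complex. x n ^ nexp n)"
  have z_in: "0 \<in> {z..n + 1}" using z by simp
  have n4: "3 \<le> n" "succ_ix 1 = n" "pred_ix 0 = n" "succ_ix 0 = n + 1" "nexp 0 = 2"
    using z n_eq r_eq r_pos by (auto simp: loop_succ_def loop_pred_def loop_expo_def bseq_low)
  have f_eq: "F x = x (n + 1) ^ 1 * x 0 ^ 2 + E x * x 0 + rest 0 x" for x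
    using F_split[OF z_in, of x] unfolding n4 by (simp add: E_def mult.commute)
  have r_succ: "succ_ix (r + 1) = r" using z n_eq r_eq r_pos by (simp add: loop_succ_def)
  show ?thesis
  proof (rule prime_zeros_quadratic[of E 0 "rest 0" "n + 1" F 1 "indic {r + 1, r}"
        "\<lambda>x. x n * x (n + 1)" UNIV "\<lambda>_. 1" 1, OF _ rest_polyfuns[OF z_in] _ f_eq])
    show "E \<in> polyfuns (- {0})" unfolding E_def using n4 by (intro polyfuns_intros) simp
    show "F (indic {r + 1, r}) \<noteq> 0" using F_indic_pair[OF z ix_facts(5)] r_succ by simp
    show "indic {r + 1, r} (n + 1) = 0" using z n_eq r_eq by (simp add: indic_def)
    show "(\<lambda>x. x n * x (n + 1)) \<in> polyfuns UNIV" by (intro polyfuns_intros) simp_all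
  next
    fix x :: "nat \<Rightarrow> complex" assume T: "x n * x (n + 1) \<noteq> 0"
    define c where "c = rest 1 x - x (n + 1) * x 0 ^ 2 - E x * x 0"
    define d where "d = [:(E x)\<^sup>2 - 4 * x (n + 1) * c, - 4 * x (n + 1) * x (pred_ix 1) ^ nexp (pred_ix 1), 0, - 4 * x (n + 1) * x n:]"
    have "poly d w = (E (x(1 := w)))\<^sup>2 - 4 * (x(1 := w)) (n + 1) ^ 1 * rest 0 (x(1 := w))" for w
    proof -
      have u: "E (x(1 := w)) = E x" "(x(1 := w)) (n + 1) = x (n + 1)" "(x(1 := w)) 0 = x 0"
        using n4 by (auto simp: E_def)
      have rw: "rest 0 (x(1 := w)) = w ^ 3 * x n + x (pred_ix 1) ^ nexp (pred_ix 1) * w + c"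
        using f_eq[of "x(1 := w)"] unfolding F_slice_1 n4 c_def u
        by (simp add: algebra_simps del: fun_upd_apply One_nat_def)
      show ?thesis unfolding u rw d_def
        by (simp add: algebra_simps power3_eq_cube del: fun_upd_apply One_nat_def)
    qed
    moreover have "odd (degree d)" unfolding d_def using T by (intro odd_degree_cubic) simp
    ultimately show "\<exists>d. odd (degree d) \<and>
        (\<forall>w. poly d w = (E (x(1 := w)))\<^sup>2 - 4 * (x(1 := w)) (n + 1) ^ 1 * rest 0 (x(1 := w)))" by blast
  qed simp_all
next
  assume z: "z = 1"
  define R where "R = (\<lambda>x. \<Sum>j=z..n + 1. term_at j x)"
  have R: "R \<in> polyfuns (- {0})"
    unfolding R_def using loop_part_polyfuns by (rule polyfuns_mono) (use z in auto)
  have n4: "succ_ix 1 = n + 1" using z n_eq r_eq r_pos by (auto simp: loop_succ_def)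
  have f_eq: "F x = x (n + 1) ^ 0 * x 0 ^ 2 + 0 * x 0 + R x" for x
    unfolding peval_V R_def using z by simp
  show ?thesis
  proof (rule prime_zeros_quadratic[of "\<lambda>_. 0" 0 R "n + 1" F 0 "indic {0}"
        "\<lambda>x. x n * x (n + 1)" UNIV "\<lambda>_. 1" 1, OF polyfuns.const R _ f_eq])
    show "F (indic {0}) \<noteq> 0" using F_indic_0[OF z] by simp
    show "indic {0} (n + 1) = 0" by (simp add: indic_def)
    show "(\<lambda>x. x n * x (n + 1)) \<in> polyfuns UNIV" by (intro polyfuns_intros) simp_all
  next
    fix x :: "nat \<Rightarrow> complex" assume T: "x n * x (n + 1) \<noteq> 0"
    define d where "d = [:- 4 * (rest 1 x - x 0 ^ 2), - 4 * x (pred_ix 1) ^ nexp (pred_ix 1), 0, - 4 * x (n + 1):]"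
    have "poly d w = 0\<^sup>2 - 4 * (x(1 := w)) (n + 1) ^ 0 * R (x(1 := w))" for w
    proof -
      have rw: "R (x(1 := w)) = w ^ 3 * x (n + 1) + x (pred_ix 1) ^ nexp (pred_ix 1) * w + rest 1 x - x 0 ^ 2"
        using f_eq[of "x(1 := w)"] fun_upd_other[of 0 1 x w] unfolding F_slice_1 n4
        by (simp add: algebra_simps del: fun_upd_apply One_nat_def)
      show ?thesis unfolding rw d_def
        by (simp add: algebra_simps power3_eq_cube del: fun_upd_apply One_nat_def)
    qed
    moreover have "odd (degree d)" unfolding d_def using T by (intro odd_degree_cubic) simp
    ultimately show "\<exists>d. odd (degree d) \<and>
        (\<forall>w. poly d w = 0\<^sup>2 - 4 * (x(1 := w)) (n + 1) ^ 0 * R (x(1 := w)))" by blast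
  qed simp_all
qed

text \<open>Let \<open>q\<close> be the predecessor of \<open>c\<close> and \<open>p\<close> that of \<open>q\<close>.  For \<open>x\<^sub>c = 0\<close> the monomial of \<open>q\<close>
  vanishes, so \<open>x\<^sub>q\<close> only occurs in the monomial of \<open>p\<close>, and there linearly.\<close>

lemma prime_zeros_section:
  assumes c: "c \<in> {z..n + 1}"
    and nz: "F x0 \<noteq> 0" "x0 c = 0" "x0 (pred_ix (pred_ix c)) = 0"
  shows "prime_zeros (\<lambda>x. F (x(c := 0)))"
proof -
  define q where "q = pred_ix c"
  define p where "p = pred_ix q"
  have q: "q \<in> {z..n + 1}" "succ_ix q = c" using succ_pred[OF c] by (simp_all add: q_def)
  have p: "p \<in> {z..n + 1}" "succ_ix p = q" using succ_pred[OF q(1)] by (simp_all add: p_def)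
  have ne: "q \<noteq> c" "p \<noteq> q" "p \<noteq> c"
    using succ_ne[OF q(1)] succ_ne[OF p(1)] succ_succ_ne[OF p(1)] p q by auto
  define B where "B = (\<lambda>x. rest q (x(c := 0)))"
  have B: "B \<in> polyfuns (- {q})"
    unfolding B_def
  proof (rule polyfuns_subst[OF rest_polyfuns[OF q(1)]])
    fix i assume "i \<in> - {q}"
    then show "(\<lambda>x. (x(c := 0)) i) \<in> polyfuns (- {q})" by (cases "i = c") (auto intro: polyfuns.intros)
  qed
  have eq: "F (x(c := 0)) = x p ^ nexp p * x q + B x" for x
    using F_split[OF q(1), of "x(c := 0)"] ne q unfolding p_def[symmetric] by (simp add: B_def)
  have "F (x0(c := 0)) \<noteq> 0" using nz(1,2) by (metis fun_upd_triv)
  then show ?thesis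
    using prime_zeros_linear[OF B ne(2) eq, of x0] nz(3) by (simp add: p_def q_def)
qed

lemma prime_zeros_sections: "prime_zeros (\<lambda>x. F (x(n := 0)))" "prime_zeros (\<lambda>x. F (x(n + 1 := 0)))"
proof -
  have "\<exists>x0. F x0 \<noteq> 0 \<and> x0 n = 0 \<and> x0 (pred_ix (pred_ix n)) = 0" using z_cases
  proof
    assume z: "z = 0"
    have "pred_ix (pred_ix n) = 2 * r" "succ_ix z = n + 1" "0 < r" "2 * r < n"
      using z n_eq r_eq r_pos by (auto simp: loop_pred_def loop_succ_def)
    then show ?thesis using F_indic_pair[OF z ix_facts(4)] z
      by (intro exI[of _ "indic {z, succ_ix z}"]) (auto simp: indic_def)
  next
    assume z: "z = 1"
    have "pred_ix (pred_ix n) \<in> {z..n + 1}" using succ_pred(2) ix_facts(2) by blast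
    then show ?thesis using F_indic_0[OF z] z ix_facts(8) by (intro exI[of _ "indic {0}"]) (auto simp: indic_def)
  qed
  then show "prime_zeros (\<lambda>x. F (x(n := 0)))" using prime_zeros_section[OF ix_facts(2)] by blast
  have "\<exists>x0. F x0 \<noteq> 0 \<and> x0 (n + 1) = 0 \<and> x0 (pred_ix (pred_ix (n + 1))) = 0" using z_cases
  proof
    assume z: "z = 0"
    have "succ_ix (r + 1) = r" "r + 1 < n" "pred_ix (pred_ix (n + 1)) = n"
      using z n_eq r_eq r_pos ix_facts(9,10) by (auto simp: loop_succ_def)
    then show ?thesis using F_indic_pair[OF z ix_facts(5)]
      by (intro exI[of _ "indic {r + 1, succ_ix (r + 1)}"]) (auto simp: indic_def)
  next
    assume z: "z = 1"
    show ?thesis using F_indic_0[OF z] ix_facts(8-10)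
      by (intro exI[of _ "indic {0}"]) (auto simp: indic_def)
  qed
  then show "prime_zeros (\<lambda>x. F (x(n + 1 := 0)))" using prime_zeros_section[OF ix_facts(3)] by blast
qed

end

section \<open>Well-formedness\<close>

lemma peval_zero_vector:
  assumes "whomogeneous a N d g" "\<And>i. i \<le> N \<Longrightarrow> 0 < a i" "x \<in> affine_space N"
  shows "peval g (\<lambda>_. 0) = 0 ^ d * peval g x"
proof -
  have "(\<lambda>i. 0 ^ a i * x i) = (\<lambda>_. 0)"
  proof
    fix i
    show "0 ^ a i * x i = 0"
      using assms(2)[of i] assms(3) by (cases "i \<le> N") (auto simp: affine_space_def power_0_left)
  qed
  then show ?thesis using whomogeneous_eval[OF assms(1), of 0 x] by simp
qed

lemma prime_zerosD:
  assumes "prime_zeros f" "g \<in> polyfuns UNIV" "h \<in> polyfuns UNIV" "\<And>x. f x = 0 \<Longrightarrow> g x * h x = 0"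
  shows "(\<forall>x. f x = 0 \<longrightarrow> g x = 0) \<or> (\<forall>x. f x = 0 \<longrightarrow> h x = 0)"
  using assms unfolding prime_zeros_def by simp

text \<open>The section of a hypersurface by the coordinate subspace \<open>x\<^sub>i = 0\<close> for \<open>i \<in> K\<close>.\<close>

definition coord_section :: "(nat \<Rightarrow> nat) \<Rightarrow> nat \<Rightarrow> cpoly \<Rightarrow> nat set \<Rightarrow> wpoint set" where
  "coord_section a N f K = {P \<in> wproj a N. \<forall>x\<in>P. peval f x = 0 \<and> (\<forall>i\<in>K. x i = 0)}"

lemma coord_section_empty: "coord_section a N f {} = hypersurface a N f"
  by (simp add: coord_section_def hypersurface_def)

lemma coord_section_mono: "K \<subseteq> L \<Longrightarrow> coord_section a N f L \<subseteq> coord_section a N f K"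
  by (auto simp: coord_section_def)

lemma closedin_coord_section:
  assumes f: "whomogeneous a N d f" and "finite K" "K \<subseteq> {..N}"
  shows "closedin (zariski a N) (coord_section a N f K)"
  using assms(2,3)
proof (induction K rule: finite_induct)
  case empty
  show ?case unfolding coord_section_empty by (rule closedin_hypersurface[OF f])
next
  case (insert i K)
  have "coord_section a N f (insert i K) = coord_section a N f K \<inter> hypersurface a N (xpow i 1)"
    by (auto simp: coord_section_def hypersurface_def peval_xpow)
  moreover have "closedin (zariski a N) (hypersurface a N (xpow i 1))"
    using insert.prems by (intro closedin_hypersurface[OF whomogeneous_xpow]) simp
  ultimately show ?case using insert by (simp add: closedin_Int)
qed

lemma Gm_orbit_in_coord_section:
  assumes f: "whomogeneous a N d f" and x: "x \<in> affine_space N" "x \<noteq> (\<lambda>_. 0)"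
  shows "Gm_orbit a x \<in> coord_section a N f K \<longleftrightarrow> peval f x = 0 \<and> (\<forall>i\<in>K. x i = 0)"
proof
  assume "Gm_orbit a x \<in> coord_section a N f K"
  then show "peval f x = 0 \<and> (\<forall>i\<in>K. x i = 0)" using Gm_orbit_self by (auto simp: coord_section_def)
next
  assume 0: "peval f x = 0 \<and> (\<forall>i\<in>K. x i = 0)"
  have "peval f y = 0 \<and> (\<forall>i\<in>K. y i = 0)" if y: "y \<in> Gm_orbit a x" for y
  proof -
    obtain t where "y = (\<lambda>i. t ^ a i * x i)" using y by (auto simp: Gm_orbit_def)
    then show ?thesis using 0 by (simp add: whomogeneous_eval[OF f])
  qed
  then show "Gm_orbit a x \<in> coord_section a N f K" using wprojI[OF x] by (simp add: coord_section_def)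
qed

text \<open>Whether a coordinate vanishes does not depend on the representative.\<close>

lemma coord_section_vanish_rep:
  assumes f: "whomogeneous a N d f" and P: "P \<in> wproj a N" "x \<in> P" "P \<notin> coord_section a N f K"
    and "peval f x = 0"
  shows "\<exists>i\<in>K. x i \<noteq> 0"
  using Gm_orbit_in_coord_section[OF f wproj_rep(2,3)[OF P(1,2)], of K] wproj_rep(1)[OF P(1,2)] P(3) assms(5)
  by auto

lemma irreducible_coord_section:
  assumes f: "whomogeneous a N d f" and pos: "\<And>i. i \<le> N \<Longrightarrow> 0 < a i"
    and K: "finite K" "K \<subseteq> {..N}" and prime: "prime_zeros (\<lambda>x. peval f (\<lambda>i. if i \<in> K then 0 else x i))"
    and ne: "coord_section a N f K \<noteq> {}"
  shows "irreducible_closedin (zariski a N) (coord_section a N f K)"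
proof (rule irreducible_closedin_zariskiI[OF closedin_coord_section[OF f K] ne])
  fix g h e e'
  assume g: "whomogeneous a N e g" and h: "whomogeneous a N e' h"
    and gh: "\<forall>P\<in>coord_section a N f K. \<forall>x\<in>P. peval g x * peval h x = 0"
  define u where "u = (\<lambda>x i. if i \<in> K then 0 else x i :: complex)"
  have prime': "prime_zeros (\<lambda>x. peval f (u x))" using prime by (simp add: u_def)
  have u: "(\<lambda>x. p (u x)) \<in> polyfuns UNIV" if "p \<in> polyfuns {..N}" for p
  proof (rule polyfuns_subst[OF that])
    fix i show "(\<lambda>x. u x i) \<in> polyfuns UNIV"
      by (cases "i \<in> K") (auto simp: u_def intro: polyfuns.intros)
  qed
  have "peval g (u x) * peval h (u x) = 0" if x: "peval f (u x) = 0" for x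
  proof -
    define y where "y = (\<lambda>i. if i \<le> N then u x i else 0)"
    have y: "y \<in> affine_space N" by (simp add: y_def affine_space_def)
    have eq: "peval p (u x) = peval p y" if "whomogeneous a N c p" for p c
      using whomogeneous_polyfuns[OF that] by (rule polyfuns_cong) (simp add: y_def)
    have "peval g y * peval h y = 0"
    proof (cases "y = (\<lambda>_. 0)")
      case True
      \<comment> \<open>the cone over the section is nonempty, so its vertex lies in its closure\<close>
      obtain P where P: "P \<in> coord_section a N f K" using ne by blast
      then have Pw: "P \<in> wproj a N" by (simp add: coord_section_def)
      then obtain w where w: "w \<in> P" using wproj_nonempty by blast
      have "peval g (\<lambda>_. 0) = 0 ^ e * peval g w" "peval h (\<lambda>_. 0) = 0 ^ e' * peval h w"
        using peval_zero_vector[OF g _ wproj_rep(2)[OF Pw w]] peval_zero_vector[OF h _ wproj_rep(2)[OF Pw w]]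
          pos by blast+
      moreover have "peval g w * peval h w = 0" using gh P w by blast
      ultimately show ?thesis unfolding True by auto
    next
      case False
      have "peval f y = 0" using x eq[OF f] by simp
      moreover have "\<forall>i\<in>K. y i = 0" by (simp add: y_def u_def)
      ultimately have "Gm_orbit a y \<in> coord_section a N f K"
        using Gm_orbit_in_coord_section[OF f y False] by blast
      then show ?thesis using gh Gm_orbit_self by blast
    qed
    then show ?thesis using eq[OF g] eq[OF h] by simp
  qed
  then have "(\<forall>x. peval f (u x) = 0 \<longrightarrow> peval g (u x) = 0) \<or> (\<forall>x. peval f (u x) = 0 \<longrightarrow> peval h (u x) = 0)"
    by (rule prime_zerosD[OF prime' u[OF whomogeneous_polyfuns[OF g]] u[OF whomogeneous_polyfuns[OF h]]])
  moreover have "u x = x \<and> peval f x = 0" if "P \<in> coord_section a N f K" "x \<in> P" for P x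
    using that by (auto simp: coord_section_def u_def)
  ultimately show "(\<forall>P\<in>coord_section a N f K. \<forall>x\<in>P. peval g x = 0) \<or>
      (\<forall>P\<in>coord_section a N f K. \<forall>x\<in>P. peval h x = 0)" by metis
qed

lemma irreducible_closedin_Un3:
  assumes "irreducible_closedin T W" "closedin T A" "closedin T B" "closedin T C" "W \<subseteq> A \<union> B \<union> C"
  shows "W \<subseteq> A \<or> W \<subseteq> B \<or> W \<subseteq> C"
proof -
  have "closedin T (A \<union> B)" using assms by (intro closedin_Un)
  then have "W \<subseteq> A \<union> B \<or> W \<subseteq> C" using assms unfolding irreducible_closedin_def by blast
  then show ?thesis using assms unfolding irreducible_closedin_def by blast
qed

context loop_hypersurface
begin

abbreviation "N \<equiv> n + 1"
abbreviation "V \<equiv> hypersurface nweight N (V_poly n)"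
abbreviation "sec \<equiv> coord_section nweight N (V_poly n)"
abbreviation "TV \<equiv> zariski_on nweight N V"

lemma nweight_pos: "i \<le> N \<Longrightarrow> 0 < nweight i"
  using weight_pos by simp

lemma V_subset: "V \<subseteq> wproj nweight N"
  by (auto simp: hypersurface_def)

lemma closedin_V: "closedin (zariski nweight N) V"
  by (rule closedin_hypersurface[OF whomogeneous_V])

lemma coordinate_point:
  assumes "i \<in> {z..N}"
  shows "Gm_orbit nweight (indic {i}) \<in> sec K \<longleftrightarrow> i \<notin> K"
proof -
  have "indic {i} \<in> affine_space N" using assms by (auto simp: indic_def affine_space_def)
  moreover have "indic {i} i = 1" by (simp add: indic_def)
  then have "indic {i} \<noteq> (\<lambda>_. 0)" by (metis zero_neq_one)
  ultimately have "Gm_orbit nweight (indic {i}) \<in> sec K \<longleftrightarrow> F (indic {i}) = 0 \<and> (\<forall>j\<in>K. indic {i} j = 0)"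
    by (rule Gm_orbit_in_coord_section[OF whomogeneous_V])
  then show ?thesis using F_coordinate_point[OF assms] by (auto simp: indic_def)
qed

lemma irreducible_V: "irreducible_closedin (zariski nweight N) V"
proof -
  have "sec {} \<noteq> {}" using coordinate_point[OF ix_facts(2), of "{}"] by blast
  then have "irreducible_closedin (zariski nweight N) (sec {})"
    using prime_zeros_F nweight_pos by (intro irreducible_coord_section[OF whomogeneous_V]) auto
  then show ?thesis unfolding coord_section_empty .
qed

lemma irreducible_section:
  assumes "c = n \<or> c = N"
  shows "irreducible_closedin (zariski nweight N) (sec {c})"
proof (rule irreducible_coord_section[OF whomogeneous_V nweight_pos])
  have c: "c \<in> {z..N}" using assms ix_facts by blast
  then show "{c} \<subseteq> {..N}" by simp
  have "(\<lambda>i. if i \<in> {c} then 0 else x i) = x(c := 0)" for x :: "nat \<Rightarrow> complex" by auto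
  then show "prime_zeros (\<lambda>x. F (\<lambda>i. if i \<in> {c} then 0 else x i))"
    using assms prime_zeros_sections by auto
  have "z \<noteq> c" using assms ix_facts by auto
  then show "sec {c} \<noteq> {}" using coordinate_point[OF ix_facts(4), of "{c}"] by blast
qed auto

text \<open>A closed subset of codimension at least two that contains the singular points of the
  weighted projective space on \<open>V'\<close> and, as shown below, all points with nontrivial stabilizer.\<close>

definition exceptional :: "wpoint set" where
  "exceptional = sec {n, N} \<union> sec {n, z} \<union> sec {N, z}"

lemma codim_exceptional:
  assumes "Z \<subseteq> exceptional"
  shows "2 \<le> codim TV Z"
proof (rule codim_ge_2I)
  have sub: "sec K \<subseteq> V" for K
    using coord_section_mono[of "{}" K nweight N "V_poly n"] unfolding coord_section_empty by simp
  show "irreducible_closedin TV V"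
    by (rule irreducible_closedin_subtopology[OF irreducible_V subset_refl closedin_V])
  fix W assume W: "irreducible_closedin TV W" "W \<subseteq> Z"
  \<comment> \<open>\<open>W\<close> lies in one of the three pieces \<open>x\<^sub>c = x\<^sub>d = 0\<close>; the vertices of the coordinate simplex
    show that both inclusions in \<open>W \<subset> {x\<^sub>c = 0} \<subset> V'\<close> are strict\<close>
  have cl: "closedin TV (sec {i, j})" if "i \<in> {z..N}" "j \<in> {z..N}" for i j
    using that sub closedin_coord_section[OF whomogeneous_V, of "{i, j}"]
    unfolding closedin_closed_subtopology[OF closedin_V] by simp
  have mid: "\<exists>C. irreducible_closedin TV C \<and> W \<subset> C \<and> C \<subset> V"
    if "W \<subseteq> sec {c, d}" "c = n \<or> c = N" "d \<in> {z..N}" "c \<noteq> d" for c d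
  proof (intro exI[of _ "sec {c}"] conjI)
    show "irreducible_closedin TV (sec {c})"
      by (rule irreducible_closedin_subtopology[OF irreducible_section[OF that(2)] sub closedin_V])
    have "sec {c, d} \<subset> sec {c}"
      using coord_section_mono[of "{c}" "{c, d}"] coordinate_point[OF that(3), of "{c, d}"]
        coordinate_point[OF that(3), of "{c}"] that(4) by auto
    then show "W \<subset> sec {c}" using that(1) by blast
    have c: "c \<in> {z..N}" using that(2) ix_facts by blast
    show "sec {c} \<subset> V"
      using sub[of "{c}"] coordinate_point[OF c, of "{c}"] coordinate_point[OF c, of "{}"]
      unfolding coord_section_empty by auto
  qed
  have "W \<subseteq> sec {n, N} \<or> W \<subseteq> sec {n, z} \<or> W \<subseteq> sec {N, z}"
    by (rule irreducible_closedin_Un3[OF W(1)]; (rule cl)?)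
      (use W(2) assms ix_facts in \<open>auto simp: exceptional_def\<close>)
  then show "\<exists>C. irreducible_closedin TV C \<and> W \<subset> C \<and> C \<subset> V"
    using mid[of n N] mid[of n z] mid[of N z] ix_facts by auto
qed

lemma closedin_exceptional: "closedin TV exceptional"
proof -
  have "sec K \<subseteq> V" for K
    using coord_section_mono[of "{}" K nweight N "V_poly n"] unfolding coord_section_empty by simp
  moreover have "closedin (zariski nweight N) exceptional"
    unfolding exceptional_def using ix_facts
    by (intro closedin_Un closedin_coord_section[OF whomogeneous_V]) auto
  ultimately show ?thesis
    unfolding closedin_closed_subtopology[OF closedin_V] exceptional_def by auto
qed

lemma singular_points: "V \<inter> wproj_sing nweight N \<subseteq> exceptional"
proof
  fix P assume P: "P \<in> V \<inter> wproj_sing nweight N"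
  then have Pw: "P \<in> wproj nweight N" and sing: "\<not> max_ideal_generated_by nweight N (wproj nweight N) P N"
    by (auto simp: wproj_sing_def)
  have "x n = 0 \<and> x N = 0" if "x \<in> P" for x
    using smooth_point_weight_one[of n N nweight P x] smooth_point_weight_one[of N N nweight P x]
      Pw sing that nweight_n by auto
  then show "P \<in> exceptional"
    using P Pw by (auto simp: exceptional_def coord_section_def hypersurface_def)
qed

lemma well_formed_V: "well_formed nweight N V"
  unfolding well_formed_def
proof (intro conjI irreducible_V codim_exceptional singular_points)
  show "well_formed_space nweight N"
    unfolding well_formed_space_def
  proof (intro allI impI)
    fix j assume "j \<le> N"
    have "\<exists>i\<in>{..N} - {j}. nweight i = 1"
      using nweight_n by (cases "j = n") (auto intro: bexI[of _ n] bexI[of _ N])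
    then have "Gcd (nweight ` ({..N} - {j})) dvd 1" by (metis Gcd_dvd image_eqI)
    then show "Gcd (nweight ` ({..N} - {j})) = 1" by simp
  qed
qed

end

section \<open>The cyclic group action\<close>

context loop_hypersurface
begin

abbreviation "m \<equiv> m_val n"

text \<open>The \<open>j\<close>-th power of a primitive root of unity of order \<open>m'\<close>.\<close>

definition zeta :: "int \<Rightarrow> complex" where
  "zeta j = cis (2 * pi * (of_int j / of_int m))"

lemma m_pos: "0 < m"
  using ix_facts(8) by (rule m_val_pos)

lemma zeta_add: "zeta (i + j) = zeta i * zeta j"
  by (simp add: zeta_def cis_mult add_divide_distrib distrib_left)

lemma zeta_0 [simp]: "zeta 0 = 1"
  by (simp add: zeta_def)

lemma zeta_nz: "zeta j \<noteq> 0"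
  by (simp add: zeta_def)

lemma zeta_power: "zeta j ^ e = zeta (j * int e)"
  by (induction e) (simp_all add: zeta_add distrib_left mult.commute)

lemma zeta_eq_1_iff: "zeta j = 1 \<longleftrightarrow> m dvd j"
proof
  assume "zeta j = 1"
  define x :: real where "x = of_int j / of_int m"
  have "cos (2 * pi * x) = 1"
    using \<open>zeta j = 1\<close> unfolding zeta_def x_def by (metis cis.sel(1) one_complex.sel(1))
  then obtain l :: int where "2 * pi * x = of_int l * 2 * pi" using cos_one_2pi_int by blast
  then have "of_int j / of_int m = (of_int l :: real)" unfolding x_def[symmetric] by simp
  then have "(of_int j :: real) = of_int (l * m)" using m_pos by (simp add: field_simps)
  then have "j = l * m" by linarith
  then show "m dvd j" by simp
next
  assume "m dvd j"
  then obtain l where "j = m * l" ..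
  then have "2 * pi * (of_int j / of_int m) = 2 * pi * of_int l" using m_pos by simp
  then show "zeta j = 1" unfolding zeta_def by simp
qed

lemma zeta_cong:
  assumes "m dvd i - j"
  shows "zeta i = zeta j"
  using zeta_add[of j "i - j"] zeta_eq_1_iff[of "i - j"] assms by simp

text \<open>The diagonal entries of the automorphism attached to \<open>g\<close>.\<close>

definition scaling :: "int \<Rightarrow> nat \<Rightarrow> complex" where
  "scaling g i = zeta (g * dexp i)"

lemma scaling_nz: "scaling g i \<noteq> 0"
  by (simp add: scaling_def zeta_nz)

lemma scaling_add: "scaling (g + h) i = scaling g i * scaling h i"
  by (simp add: scaling_def distrib_right zeta_add)

lemma scaling_mod: "scaling (g mod m) = scaling g"
proof
  fix i
  have "m dvd g mod m - g" by (metis dvd_minus_iff minus_diff_eq minus_mod_eq_mult_div dvd_triv_left)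
  then have "m dvd (g mod m - g) * dexp i" by simp
  then show "scaling (g mod m) i = scaling g i"
    unfolding scaling_def by (intro zeta_cong) (simp add: left_diff_distrib)
qed

lemma F_scaling: "F (\<lambda>i. scaling g i * x i) = zeta g * F x"
proof -
  have t: "term_at j (\<lambda>i. scaling g i * x i) = zeta g * term_at j x" if j: "j \<in> {z..N}" for j
  proof -
    have "scaling g j ^ nexp j * scaling g (succ_ix j) = zeta (g * (expo j * dexp j + dexp (succ_ix j)))"
    proof -
      have "scaling g j ^ nexp j * scaling g (succ_ix j) = zeta (g * dexp j * int (nexp j) + g * dexp (succ_ix j))"
        unfolding scaling_def zeta_power zeta_add ..
      also have "g * dexp j * int (nexp j) + g * dexp (succ_ix j) = g * (expo j * dexp j + dexp (succ_ix j))"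
        using int_nexp[of j] j by (simp add: algebra_simps)
      finally show ?thesis .
    qed
    also have "\<dots> = zeta g"
    proof (rule zeta_cong)
      have "m dvd g * (expo j * dexp j + dexp (succ_ix j) - 1)" using dexp_step[OF j] by simp
      then show "m dvd g * (expo j * dexp j + dexp (succ_ix j)) - g" by (simp add: algebra_simps)
    qed
    finally show ?thesis by (simp add: term_at_def power_mult_distrib mult_ac)
  qed
  have "(scaling g 0 * x 0) ^ 2 = zeta g * x 0 ^ 2" if z: "z = 1"
  proof -
    have "scaling g 0 ^ 2 = zeta (g * (2 * dexp 0))" by (simp add: scaling_def zeta_power mult_ac)
    also have "\<dots> = zeta g" unfolding dexp_0[OF z] by (rule zeta_cong) (simp add: algebra_simps)
    finally show ?thesis by (simp add: power_mult_distrib)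
  qed
  then show ?thesis unfolding peval_V using t by (simp add: distrib_left sum_distrib_left)
qed

lemma diag_map_V:
  assumes "P \<in> V"
  shows "diag_map (scaling g) P \<in> V"
proof -
  have "diag_map (scaling g) P \<in> wproj nweight N"
    using assms V_subset by (intro diag_map_wproj scaling_nz) auto
  then show ?thesis using assms by (auto simp: hypersurface_def diag_map_def F_scaling)
qed

lemma diag_map_comp: "diag_map (scaling g) (diag_map (scaling h) P) = diag_map (scaling (g + h)) P"
  by (simp add: diag_map_def image_image scaling_add mult.assoc)

lemma diag_map_0: "diag_map (scaling 0) P = P"
  by (simp add: diag_map_def scaling_def)

text \<open>The action on \<open>V'\<close>, extended by the default value outside of \<open>V'\<close> as the group of
  bijections requires.\<close>

definition act :: "int \<Rightarrow> wpoint \<Rightarrow> wpoint" where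
  "act g = restrict (diag_map (scaling g)) V"

abbreviation "G \<equiv> integer_mod_group (nat m)"

lemma act_apply: "P \<in> V \<Longrightarrow> act g P = diag_map (scaling g) P"
  by (simp add: act_def)

lemma act_mem: "P \<in> V \<Longrightarrow> act g P \<in> V"
  by (metis act_apply diag_map_V)

lemma act_act: "P \<in> V \<Longrightarrow> act g (act h P) = act (g + h) P"
  by (metis act_apply act_mem diag_map_comp)

lemma act_Bij: "act g \<in> Bij V"
proof -
  have inv: "act (- h) (act h P) = P" if "P \<in> V" for h P
    using act_act[OF that, of "- h" h] act_apply[OF that, of 0] diag_map_0 by simp
  have "bij_betw (act g) V V"
  proof (rule bij_betw_byWitness[of _ "act (- g)"])
    show "\<forall>P\<in>V. act (- g) (act g P) = P" "\<forall>P\<in>V. act g (act (- g) P) = P"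
      using inv[of _ g] inv[of _ "- g"] by simp_all
  qed (use act_mem in blast)+
  then show ?thesis by (simp add: Bij_def act_def)
qed

lemma algebraic_action_act: "algebraic_action G nweight N V act"
  unfolding algebraic_action_def
proof (intro conjI ballI)
  have hom: "act ((g + h) mod m) = compose V (act g) (act h)" for g h
  proof
    fix P
    have "act ((g + h) mod m) = act (g + h)" unfolding act_def scaling_mod ..
    moreover have "act (g + h) P = compose V (act g) (act h) P"
    proof (cases "P \<in> V")
      case True
      then show ?thesis using act_act[OF True, of g h] by (simp add: compose_def)
    qed (simp add: compose_def act_def)
    ultimately show "act ((g + h) mod m) P = compose V (act g) (act h) P" by simp
  qed
  have "group_hom G (BijGroup V) act"
    by (intro group_hom.intro group_hom_axioms.intro group_integer_mod_group group_BijGroup homI)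
      (use m_pos hom act_Bij in \<open>auto simp: BijGroup_def\<close>)
  then show "group_action G V act" by (rule group_action.intro)
  show "self_morphism nweight N V (act g)" for g
    unfolding act_def by (rule self_morphism_diag[OF V_subset scaling_nz diag_map_V])
qed

lemma coprime_dvd_carrier:
  assumes "coprime c m" "m dvd g * c" "g \<in> carrier G"
  shows "g = 0"
proof -
  have "m dvd g" using assms(1,2) by (metis coprime_commute coprime_dvd_mult_left_iff)
  moreover have "0 \<le> g" "g < m" using assms(3) m_pos by (auto simp: carrier_integer_mod_group)
  ultimately show ?thesis using zdvd_not_zless by force
qed

text \<open>Outside of the exceptional set at least two of the coordinates \<open>x\<^sub>n\<close>, \<open>x\<^bsub>n+1\<^esub>\<close>, \<open>x\<^sub>z\<close> are
  nonzero.  One of them has weight one and determines the scalar \<open>t\<close> that identifies the two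
  representatives of a fixed point; the other one leaves a congruence modulo \<open>m'\<close>.\<close>

lemma act_free:
  assumes g: "g \<in> carrier G" and P: "P \<in> V" "P \<notin> exceptional" and fixed: "act g P = P"
  shows "g = 0"
proof -
  have Pw: "P \<in> wproj nweight N" using P V_subset by blast
  then obtain x where x: "x \<in> P" using wproj_nonempty by blast
  have Fx: "F x = 0" using P x by (simp add: hypersurface_def)
  have "(\<lambda>i. scaling g i * x i) \<in> P"
    using fixed x P(1) by (auto simp: act_def diag_map_def)
  then obtain t where t: "(\<lambda>i. scaling g i * x i) = (\<lambda>i. t ^ nweight i * x i)"
    using wproj_scale[OF Pw x] by metis
  have eq: "scaling g i = t ^ nweight i" if "x i \<noteq> 0" for i using fun_cong[OF t, of i] that by simp
  have tN: "t = 1" if "x N \<noteq> 0" using eq[OF that] nweight_n by (simp add: scaling_def dexp_simps(1)[simplified])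
  have tn: "t = zeta (g * zW r k)" if "x n \<noteq> 0" using eq[OF that] nweight_n by (simp add: scaling_def dexp_simps)
  have "(x n \<noteq> 0 \<or> x N \<noteq> 0) \<and> (x n \<noteq> 0 \<or> x z \<noteq> 0) \<and> (x N \<noteq> 0 \<or> x z \<noteq> 0)"
    using coord_section_vanish_rep[OF whomogeneous_V Pw x _ Fx] P(2) unfolding exceptional_def by auto
  then consider "x n \<noteq> 0" "x N \<noteq> 0" | "x N \<noteq> 0" "x z \<noteq> 0" | "x n \<noteq> 0" "x z \<noteq> 0" by blast
  then show ?thesis
  proof cases
    case 1
    then have "m dvd g * zW r k" using tN tn zeta_eq_1_iff by metis
    then show ?thesis using coprime_dvd_carrier[OF coprime_dexp(1)] g by blast
  next
    case 2
    then have "zeta (g * dexp z) = 1" using eq[OF 2(2)] tN by (simp add: scaling_def)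
    then show ?thesis using coprime_dvd_carrier[OF coprime_dexp(2)] g zeta_eq_1_iff by blast
  next
    case 3
    have "zeta (g * dexp z) = zeta (g * zW r k * weight z)"
      using eq[OF 3(2)] tn[OF 3(1)] int_nweight[of z] ix_facts(4)
      by (simp add: scaling_def zeta_power del: int_nat_eq of_nat_nat)
    then have "zeta (g * zW r k * weight z - g * dexp z) = 1"
      using zeta_add[of "g * zW r k * weight z - g * dexp z" "g * dexp z"] zeta_nz[of "g * dexp z"] by simp
    moreover have "g * zW r k * weight z - g * dexp z = g * (zP r k * v_top n)"
      using deg_zW unfolding weight_z dexp_simps by (simp add: algebra_simps)
    ultimately have "m dvd g * (zP r k * v_top n)" using zeta_eq_1_iff by metis
    then show ?thesis using coprime_dvd_carrier[OF coprime_dexp(3)] g by blast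
  qed
qed

lemma free_in_codim_one_act: "free_in_codim_one G TV act"
  unfolding free_in_codim_one_def
proof (intro exI[of _ exceptional] conjI ballI impI closedin_exceptional codim_exceptional subset_refl)
  fix g P assume "g \<in> carrier G" "P \<in> topspace TV - exceptional" "act g P = P"
  then show "g = \<one>\<^bsub>G\<^esub>" using act_free[of g P] by simp
qed

end

theorem theorem7p1:
  fixes n :: nat
  assumes "n \<ge> 2"
  shows "\<exists>a D. (\<forall>a' D'. V_weights n a' D' \<longleftrightarrow> a' = a \<and> D' = D) \<and>
    (let V = hypersurface a (n + 1) (V_poly n); G = integer_mod_group (nat (m_val n)) in
       well_formed a (n + 1) V \<and>
       quasi_smooth_hypersurface (n + 1) (V_poly n) \<and>
       D = (\<Sum>j\<le>n + 1. a j) \<and>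
       int D = (if odd n then u_val n else 2 * u_val n) \<and>
       a n = 1 \<and> a (n + 1) = 1 \<and>
       m_val n > 0 \<and>
       (\<exists>\<phi>. algebraic_action G a (n + 1) V \<phi> \<and>
            free_in_codim_one G (zariski_on a (n + 1) V) \<phi>))"
proof -
  define z :: nat where "z = (if odd n then 0 else 1)"
  define k where "k = (n - 1) div 2"
  have nkz: "n = 2 * k + 1 + z \<and> n div 2 = k + z"
  proof (cases "odd n")
    case True
    then obtain j where "n = 2 * j + 1" by (rule oddE)
    then show ?thesis by (simp add: z_def k_def)
  next
    case False
    then obtain j where "n = 2 * j" by (metis evenE)
    then show ?thesis using assms by (cases j) (simp_all add: z_def k_def)
  qed
  interpret loop_hypersurface n "n div 2" k z
  proof
    show "n = 2 * k + 1 + z" "n div 2 = k + z" using nkz by blast+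
    show "z \<le> 1" by (simp add: z_def)
    show "1 \<le> n div 2" using assms by simp
  qed
  have "int (\<Sum>j\<le>n + 1. nweight j) = (\<Sum>j\<le>n + 1. weight j)"
    unfolding of_nat_sum by (intro sum.cong int_nweight) auto
  then have "int (\<Sum>j\<le>n + 1. nweight j) = int ndeg" unfolding weight_sum int_ndeg .
  then have deg_sum: "ndeg = (\<Sum>j\<le>n + 1. nweight j)" by (simp only: of_nat_eq_iff)
  show ?thesis
    unfolding Let_def
  proof (rule exI[of _ nweight], rule exI[of _ ndeg], intro conjI allI)
    show "V_weights n a' D' \<longleftrightarrow> a' = nweight \<and> D' = ndeg" for a' D' by (rule V_weights_iff)
    show "well_formed nweight (n + 1) V" by (rule well_formed_V)
    show "quasi_smooth_hypersurface (n + 1) (V_poly n)" by (rule quasi_smooth)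
    show "ndeg = (\<Sum>j\<le>n + 1. nweight j)" by (rule deg_sum)
    show "int ndeg = (if odd n then u_val n else 2 * u_val n)" unfolding int_ndeg by (rule u_val_eq)
    show "nweight n = 1" "nweight (n + 1) = 1" by (rule nweight_n)+
    show "m_val n > 0" by (rule m_pos)
    show "\<exists>\<phi>. algebraic_action G nweight (n + 1) V \<phi> \<and> free_in_codim_one G TV \<phi>"
      using algebraic_action_act free_in_codim_one_act by blast
  qed
qed

end
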